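(* Let $R=\bigoplus_{n\in\mathbb{N}_0}R_n$ be a standard graded Noetherian commutative ring. Assume that $R$ is a flat $R_0$-module via $R_0\hookrightarrow R$, and let $X=\bigoplus_{n\in\mathbb{Z}}X_n$ be a graded $R$-module. Then for all $n\in\mathbb{Z}$, all $i\in\mathbb{N}_0$ and every ideal $I_0$ of $R_0$ there is an isomorphism of $R_0$-modules $$\operatorname{Ext}^i_R(R/I_0R,X)_n\cong\operatorname{Ext}^i_{R_0}(R_0/I_0,X_n).$$
   Context: All rings are commutative Noetherian with identity. "Standard graded" means $R_0$ is a Noetherian ring and $R$ is generated as an $R_0$-algebra by finitely many elements of degree $1$. For a finitely generated graded $R$-module $N$ and a graded $R$-module $X$, $\operatorname{Ext}^i_R(N,X)$ carries its natural grading (it coincides with ${}^*\operatorname{Ext}^i_R(N,X)$, the $i$-th right derived functor of the graded Hom functor ${}^*\operatorname{Hom}_R(N,-)$ in the category of graded $R$-modules and homogeneous homomorphisms of degree zero). The subscript $n$ denotes the degree-$n$ component, an $R_0$-module. *)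

theory Defs
  imports "HOL-Algebra.Algebra"
begin

section \<open>Modules over a commutative ring\<close>

text \<open>
  A module over \<open>A\<close> is a \<^locale>\<open>module\<close> of the library.  Its record type extends that of
  rings, but the fields \<^term>\<open>monoid.mult\<close> and \<^term>\<open>monoid.one\<close> of a module play no role, and
  are left undefined below.
\<close>

text \<open>Homomorphisms are normalised to be \<^term>\<open>undefined\<close> outside the carrier of the source, so
  that two of them are equal iff they agree on that carrier.\<close>

definition mhom :: "'a ring \<Rightarrow> ('a, 'm) module \<Rightarrow> ('a, 'n) module \<Rightarrow> ('m \<Rightarrow> 'n) set" where
  "mhom A M N = {f \<in> carrier M \<rightarrow>\<^sub>E carrier N.
     (\<forall>x \<in> carrier M. \<forall>y \<in> carrier M. f (x \<oplus>\<^bsub>M\<^esub> y) = f x \<oplus>\<^bsub>N\<^esub> f y) \<and>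
     (\<forall>a \<in> carrier A. \<forall>x \<in> carrier M. f (a \<odot>\<^bsub>M\<^esub> x) = a \<odot>\<^bsub>N\<^esub> f x)}"

definition mod_iso :: "'a ring \<Rightarrow> ('a, 'm) module \<Rightarrow> ('a, 'n) module \<Rightarrow> bool" where
  "mod_iso A M N \<longleftrightarrow> (\<exists>h \<in> mhom A M N. bij_betw h (carrier M) (carrier N))"

definition hom_mod :: "'a ring \<Rightarrow> ('a, 'm) module \<Rightarrow> ('a, 'n) module \<Rightarrow> ('a, 'm \<Rightarrow> 'n) module" where
  "hom_mod A M N =
    \<lparr>carrier = mhom A M N, monoid.mult = undefined, one = undefined,
     ring.zero = (\<lambda>x \<in> carrier M. \<zero>\<^bsub>N\<^esub>),
     ring.add = (\<lambda>f g. \<lambda>x \<in> carrier M. f x \<oplus>\<^bsub>N\<^esub> g x),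
     smult = (\<lambda>a f. \<lambda>x \<in> carrier M. a \<odot>\<^bsub>N\<^esub> f x)\<rparr>"

definition quot_mod :: "('a, 'm) module \<Rightarrow> 'm set \<Rightarrow> ('a, 'm set) module" where
  "quot_mod M K =
    \<lparr>carrier = a_rcosets\<^bsub>M\<^esub> K, monoid.mult = undefined, one = undefined,
     ring.zero = K, ring.add = (\<lambda>C D. C <+>\<^bsub>M\<^esub> D),
     smult = (\<lambda>a C. \<Union>x \<in> C. K +>\<^bsub>M\<^esub> (a \<odot>\<^bsub>M\<^esub> x))\<rparr>"

text \<open>A ring as a module over itself; for a subring \<open>S\<close> of \<open>A\<close>, the same record is also \<open>A\<close>
  as an \<open>S\<close>-module.\<close>

definition reg_mod :: "'a ring \<Rightarrow> ('a, 'a) module" where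
  "reg_mod A =
    \<lparr>carrier = carrier A, monoid.mult = monoid.mult A, one = one A,
     ring.zero = ring.zero A, ring.add = ring.add A, smult = monoid.mult A\<rparr>"


section \<open>Tensor products and flatness\<close>

text \<open>The abelian group \<open>M \<otimes>\<^sub>A P\<close> is the free abelian group on \<open>M \<times> P\<close> modulo the subgroup
  generated by the bilinearity relators.\<close>

definition tensor_relators ::
    "'a ring \<Rightarrow> ('a, 'm) module \<Rightarrow> ('a, 'p) module \<Rightarrow> ('m \<times> 'p \<Rightarrow>\<^sub>0 int) set" where
  "tensor_relators A M P =
     {frag_of (x \<oplus>\<^bsub>M\<^esub> y, p) - frag_of (x, p) - frag_of (y, p) | x y p.
        x \<in> carrier M \<and> y \<in> carrier M \<and> p \<in> carrier P} \<union>
     {frag_of (x, p \<oplus>\<^bsub>P\<^esub> q) - frag_of (x, p) - frag_of (x, q) | x p q.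
        x \<in> carrier M \<and> p \<in> carrier P \<and> q \<in> carrier P} \<union>
     {frag_of (a \<odot>\<^bsub>M\<^esub> x, p) - frag_of (x, a \<odot>\<^bsub>P\<^esub> p) | a x p.
        a \<in> carrier A \<and> x \<in> carrier M \<and> p \<in> carrier P}"

definition tensor_rel_group ::
    "'a ring \<Rightarrow> ('a, 'm) module \<Rightarrow> ('a, 'p) module \<Rightarrow> ('m \<times> 'p \<Rightarrow>\<^sub>0 int) set" where
  "tensor_rel_group A M P =
     generate (free_Abelian_group (carrier M \<times> carrier P)) (tensor_relators A M P)"

definition tensor ::
    "'a ring \<Rightarrow> ('a, 'm) module \<Rightarrow> ('a, 'p) module \<Rightarrow> ('m \<times> 'p \<Rightarrow>\<^sub>0 int) set monoid" where
  "tensor A M P = free_Abelian_group (carrier M \<times> carrier P) Mod tensor_rel_group A M P"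

text \<open>The map \<open>M \<otimes> f : M \<otimes>\<^sub>A P \<rightarrow> M \<otimes>\<^sub>A Q\<close> induced by a homomorphism \<open>f : P \<rightarrow> Q\<close>: the image
  of the coset of \<open>u\<close> is the coset of the image of \<open>u\<close> under the map of free abelian groups
  with \<open>(x, p) \<mapsto> (x, f p)\<close>.\<close>

definition tensor_map ::
    "'a ring \<Rightarrow> ('a, 'm) module \<Rightarrow> ('a, 'p) module \<Rightarrow> ('a, 'q) module \<Rightarrow> ('p \<Rightarrow> 'q) \<Rightarrow>
     ('m \<times> 'p \<Rightarrow>\<^sub>0 int) set \<Rightarrow> ('m \<times> 'q \<Rightarrow>\<^sub>0 int) set" where
  "tensor_map A M P Q f C =
     tensor_rel_group A M Q <#>\<^bsub>free_Abelian_group (carrier M \<times> carrier Q)\<^esub>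
       frag_extend (\<lambda>(x, p). frag_of (x, f p)) ` C"

text \<open>
  \<open>M\<close> is flat if \<open>M \<otimes>\<^sub>A _\<close> preserves injective homomorphisms.  HOL cannot quantify over the
  types of the test modules, so these are the \<open>A\<close>-modules whose carrier is a set of elements of
  the type \<open>'a\<close> of the ring.  Flatness in the usual sense clearly implies this condition.  The
  converse holds as well, since \<open>A\<close> and its ideals are among the test modules.
  The same remark applies (by Baer's criterion) to the two definitions of injectivity below.
\<close>

definition flat_module :: "'a ring \<Rightarrow> ('a, 'm) module \<Rightarrow> bool" where
  "flat_module A M \<longleftrightarrow> module A M \<and>
     (\<forall>(P :: ('a, 'a) module) (Q :: ('a, 'a) module). \<forall>f \<in> mhom A P Q.
        module A P \<longrightarrow> module A Q \<longrightarrow> inj_on f (carrier P) \<longrightarrow>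
        inj_on (tensor_map A M P Q f) (carrier (tensor A M P)))"


section \<open>Ext as a right derived functor\<close>

definition injective_module :: "'a ring \<Rightarrow> ('a, 'e) module \<Rightarrow> bool" where
  "injective_module A E \<longleftrightarrow> module A E \<and>
     (\<forall>(P :: ('a, 'a) module) (Q :: ('a, 'a) module). \<forall>j \<in> mhom A P Q. \<forall>f \<in> mhom A P E.
        module A P \<longrightarrow> module A Q \<longrightarrow> inj_on j (carrier P) \<longrightarrow>
        (\<exists>g \<in> mhom A Q E. \<forall>x \<in> carrier P. g (j x) = f x))"

text \<open>Exactness of \<open>0 \<rightarrow> M \<rightarrow> E 0 \<rightarrow> E 1 \<rightarrow> \<dots>\<close>, with first map \<open>\<epsilon>\<close> and differentials \<open>d i\<close>.\<close>

definition coresolution ::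
    "'a ring \<Rightarrow> ('a, 'm) module \<Rightarrow> ('m \<Rightarrow> 'e) \<Rightarrow> (nat \<Rightarrow> ('a, 'e) module) \<Rightarrow> (nat \<Rightarrow> 'e \<Rightarrow> 'e) \<Rightarrow> bool"
  where
  "coresolution A M \<epsilon> E d \<longleftrightarrow>
     (\<forall>i. module A (E i)) \<and> \<epsilon> \<in> mhom A M (E 0) \<and> (\<forall>i. d i \<in> mhom A (E i) (E (Suc i))) \<and>
     inj_on \<epsilon> (carrier M) \<and>
     \<epsilon> ` carrier M = a_kernel (E 0) (E 1) (d 0) \<and>
     (\<forall>i. d i ` carrier (E i) = a_kernel (E (Suc i)) (E (Suc (Suc i))) (d (Suc i)))"

definition injective_resolution ::
    "'a ring \<Rightarrow> ('a, 'm) module \<Rightarrow> ('m \<Rightarrow> 'e) \<Rightarrow> (nat \<Rightarrow> ('a, 'e) module) \<Rightarrow> (nat \<Rightarrow> 'e \<Rightarrow> 'e) \<Rightarrow> bool"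
  where
  "injective_resolution A M \<epsilon> E d \<longleftrightarrow>
     coresolution A M \<epsilon> E d \<and> (\<forall>i. injective_module A (E i))"

definition cocycles :: "(nat \<Rightarrow> ('a, 'c) module) \<Rightarrow> (nat \<Rightarrow> 'c \<Rightarrow> 'c) \<Rightarrow> nat \<Rightarrow> 'c set" where
  "cocycles C D i = a_kernel (C i) (C (Suc i)) (D i)"

definition coboundaries :: "(nat \<Rightarrow> ('a, 'c) module) \<Rightarrow> (nat \<Rightarrow> 'c \<Rightarrow> 'c) \<Rightarrow> nat \<Rightarrow> 'c set" where
  "coboundaries C D i = (case i of 0 \<Rightarrow> {\<zero>\<^bsub>C 0\<^esub>} | Suc j \<Rightarrow> D j ` carrier (C j))"

definition cohomology ::
    "(nat \<Rightarrow> ('a, 'c) module) \<Rightarrow> (nat \<Rightarrow> 'c \<Rightarrow> 'c) \<Rightarrow> nat \<Rightarrow> ('a, 'c set) module" where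
  "cohomology C D i = quot_mod ((C i)\<lparr>carrier := cocycles C D i\<rparr>) (coboundaries C D i)"

text \<open>\<open>Ext\<^sup>i\<^sub>A(N, M) = H\<^sup>i(Hom\<^sub>A(N, E))\<close>, where \<open>(E, d)\<close> is an injective resolution of \<open>M\<close>.
  The resolution is an argument: there is no canonical one, and as a derived functor Ext is
  determined up to isomorphism only.  A statement about Ext is therefore made for all resolutions.\<close>

definition Ext_mod ::
    "'a ring \<Rightarrow> ('a, 'n) module \<Rightarrow> (nat \<Rightarrow> ('a, 'e) module) \<Rightarrow> (nat \<Rightarrow> 'e \<Rightarrow> 'e) \<Rightarrow> nat \<Rightarrow>
     ('a, ('n \<Rightarrow> 'e) set) module" where
  "Ext_mod A N E d i =
     cohomology (\<lambda>k. hom_mod A N (E k)) (\<lambda>k f. compose (carrier N) (d k) f) i"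


section \<open>Graded rings and modules\<close>

text \<open>\<open>M\<close> is the (internal) direct sum of the additive subgroups \<open>g k\<close>.\<close>

definition direct_sum_dec :: "('m, 'z) ring_scheme \<Rightarrow> ('k \<Rightarrow> 'm set) \<Rightarrow> bool" where
  "direct_sum_dec M g \<longleftrightarrow> (\<forall>k. subgroup (g k) (add_monoid M)) \<and>
     (\<forall>x \<in> carrier M. \<exists>!c. (\<forall>k. c k \<in> g k) \<and> finite {k. c k \<noteq> \<zero>\<^bsub>M\<^esub>} \<and>
        x = (\<Oplus>\<^bsub>M\<^esub>k \<in> {k. c k \<noteq> \<zero>\<^bsub>M\<^esub>}. c k))"

definition graded_ring :: "'a ring \<Rightarrow> (nat \<Rightarrow> 'a set) \<Rightarrow> bool" where
  "graded_ring R gR \<longleftrightarrow> cring R \<and> direct_sum_dec R gR \<and> \<one>\<^bsub>R\<^esub> \<in> gR 0 \<and>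
     (\<forall>m n. \<forall>a \<in> gR m. \<forall>b \<in> gR n. a \<otimes>\<^bsub>R\<^esub> b \<in> gR (m + n))"

abbreviation deg0_ring :: "'a ring \<Rightarrow> (nat \<Rightarrow> 'a set) \<Rightarrow> 'a ring" where
  "deg0_ring R gR \<equiv> R\<lparr>carrier := gR 0\<rparr>"

definition standard_graded_ring :: "'a ring \<Rightarrow> (nat \<Rightarrow> 'a set) \<Rightarrow> bool" where
  "standard_graded_ring R gR \<longleftrightarrow> graded_ring R gR \<and> noetherian_ring (deg0_ring R gR) \<and>
     (\<exists>S. finite S \<and> S \<subseteq> gR 1 \<and> generate_ring R (gR 0 \<union> S) = carrier R)"

definition graded_module ::
    "'a ring \<Rightarrow> (nat \<Rightarrow> 'a set) \<Rightarrow> ('a, 'm) module \<Rightarrow> (int \<Rightarrow> 'm set) \<Rightarrow> bool" where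
  "graded_module R gR M gM \<longleftrightarrow> module R M \<and> direct_sum_dec M gM \<and>
     (\<forall>m k. \<forall>a \<in> gR m. \<forall>x \<in> gM k. a \<odot>\<^bsub>M\<^esub> x \<in> gM (int m + k))"

definition reg_grading :: "'a ring \<Rightarrow> (nat \<Rightarrow> 'a set) \<Rightarrow> int \<Rightarrow> 'a set" where
  "reg_grading R gR k = (if k < 0 then {\<zero>\<^bsub>R\<^esub>} else gR (nat k))"

definition quot_grading :: "('a, 'm) module \<Rightarrow> 'm set \<Rightarrow> (int \<Rightarrow> 'm set) \<Rightarrow> int \<Rightarrow> 'm set set" where
  "quot_grading M K gM k = (\<lambda>x. K +>\<^bsub>M\<^esub> x) ` gM k"

definition ghom ::
    "'a ring \<Rightarrow> ('a, 'm) module \<Rightarrow> (int \<Rightarrow> 'm set) \<Rightarrow> ('a, 'n) module \<Rightarrow> (int \<Rightarrow> 'n set) \<Rightarrow> int \<Rightarrow>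
     ('m \<Rightarrow> 'n) set" where
  "ghom R M gM N gN n = {f \<in> mhom R M N. \<forall>k. f ` gM k \<subseteq> gN (k + n)}"

text \<open>The graded Hom module \<open>*Hom\<^sub>R(M, N)\<close>: finite sums of homogeneous homomorphisms.  Its
  component of degree \<open>n\<close> is \<^term>\<open>ghom R M gM N gN n\<close>.\<close>

definition star_hom_mod ::
    "'a ring \<Rightarrow> ('a, 'm) module \<Rightarrow> (int \<Rightarrow> 'm set) \<Rightarrow> ('a, 'n) module \<Rightarrow> (int \<Rightarrow> 'n set) \<Rightarrow>
     ('a, 'm \<Rightarrow> 'n) module" where
  "star_hom_mod R M gM N gN = (hom_mod R M N)\<lparr>carrier :=
     {\<Oplus>\<^bsub>hom_mod R M N\<^esub>k \<in> S. h k | h S. finite S \<and> (\<forall>k \<in> S. h k \<in> ghom R M gM N gN k)}\<rparr>"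


section \<open>Graded Ext\<close>

text \<open>Injectivity in the category whose morphisms are the homogeneous homomorphisms of degree
  zero.  Shifts of gradings are covered, because \<open>gP\<close> and \<open>gQ\<close> are arbitrary.\<close>

definition star_injective_module ::
    "'a ring \<Rightarrow> (nat \<Rightarrow> 'a set) \<Rightarrow> ('a, 'e) module \<Rightarrow> (int \<Rightarrow> 'e set) \<Rightarrow> bool" where
  "star_injective_module R gR E gE \<longleftrightarrow> graded_module R gR E gE \<and>
     (\<forall>(P :: ('a, 'a) module) gP (Q :: ('a, 'a) module) gQ.
        \<forall>j \<in> ghom R P gP Q gQ 0. \<forall>f \<in> ghom R P gP E gE 0.
        graded_module R gR P gP \<longrightarrow> graded_module R gR Q gQ \<longrightarrow> inj_on j (carrier P) \<longrightarrow>
        (\<exists>g \<in> ghom R Q gQ E gE 0. \<forall>x \<in> carrier P. g (j x) = f x))"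

definition star_injective_resolution ::
    "'a ring \<Rightarrow> (nat \<Rightarrow> 'a set) \<Rightarrow> ('a, 'm) module \<Rightarrow> (int \<Rightarrow> 'm set) \<Rightarrow> ('m \<Rightarrow> 'e) \<Rightarrow>
     (nat \<Rightarrow> ('a, 'e) module) \<Rightarrow> (nat \<Rightarrow> int \<Rightarrow> 'e set) \<Rightarrow> (nat \<Rightarrow> 'e \<Rightarrow> 'e) \<Rightarrow> bool" where
  "star_injective_resolution R gR M gM \<epsilon> E gE d \<longleftrightarrow>
     coresolution R M \<epsilon> E d \<and>
     (\<forall>i. star_injective_module R gR (E i) (gE i)) \<and>
     \<epsilon> \<in> ghom R M gM (E 0) (gE 0) 0 \<and>
     (\<forall>i. d i \<in> ghom R (E i) (gE i) (E (Suc i)) (gE (Suc i)) 0)"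

text \<open>\<open>*Ext\<^sup>i\<^sub>R(N, M) = H\<^sup>i(*Hom\<^sub>R(N, E))\<close>, where \<open>(E, d)\<close> is an injective resolution of \<open>M\<close> in
  the graded category, and its grading: the component of degree \<open>n\<close> consists of the classes of the
  cocycles of degree \<open>n\<close>.\<close>

definition star_Ext_mod ::
    "'a ring \<Rightarrow> ('a, 'n) module \<Rightarrow> (int \<Rightarrow> 'n set) \<Rightarrow>
     (nat \<Rightarrow> ('a, 'e) module) \<Rightarrow> (nat \<Rightarrow> int \<Rightarrow> 'e set) \<Rightarrow> (nat \<Rightarrow> 'e \<Rightarrow> 'e) \<Rightarrow> nat \<Rightarrow>
     ('a, ('n \<Rightarrow> 'e) set) module" where
  "star_Ext_mod R N gN E gE d i =
     cohomology (\<lambda>k. star_hom_mod R N gN (E k) (gE k)) (\<lambda>k f. compose (carrier N) (d k) f) i"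

definition star_Ext_grading ::
    "'a ring \<Rightarrow> ('a, 'n) module \<Rightarrow> (int \<Rightarrow> 'n set) \<Rightarrow>
     (nat \<Rightarrow> ('a, 'e) module) \<Rightarrow> (nat \<Rightarrow> int \<Rightarrow> 'e set) \<Rightarrow> (nat \<Rightarrow> 'e \<Rightarrow> 'e) \<Rightarrow> nat \<Rightarrow>
     int \<Rightarrow> ('n \<Rightarrow> 'e) set set" where
  "star_Ext_grading R N gN E gE d i =
     (let C = (\<lambda>k. star_hom_mod R N gN (E k) (gE k));
          D = (\<lambda>k f. compose (carrier N) (d k) f)
      in quot_grading (C i) (coboundaries C D i)
           (\<lambda>n. cocycles C D i \<inter> ghom R N gN (E i) (gE i) n))"

text \<open>The component of degree \<open>n\<close> of a graded module.  Over a graded ring \<open>R\<close> it is a module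
  over \<^term>\<open>deg0_ring R gR\<close>.\<close>

abbreviation component :: "('a, 'm) module \<Rightarrow> (int \<Rightarrow> 'm set) \<Rightarrow> int \<Rightarrow> ('a, 'm) module" where
  "component M gM n \<equiv> M\<lparr>carrier := gM n\<rparr>"

end

theory Submission
  imports Defs
begin

text \<open>
  Write \<open>A = R\<^sub>0\<close>.  If \<open>E\<close> is an injective resolution of \<open>X\<close> in the graded category, then the
  components \<open>E\<^sub>n\<close> form an exact complex of \<open>A\<close>-modules resolving \<open>X\<^sub>n\<close>.  Flatness of \<open>R\<close> over \<open>A\<close>
  makes each \<open>E\<^sup>i\<^sub>n\<close> satisfy Baer's criterion, so that \<open>E\<^sub>n\<close> may be compared with any injective
  resolution \<open>J\<close> of \<open>X\<^sub>n\<close>.  A homomorphism from the cyclic module \<open>R/I\<^sub>0R\<close> is determined by the image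
  of the class of \<open>1\<close>, which may be any element annihilated by \<open>I\<^sub>0\<close>; hence the degree \<open>n\<close> parts of
  the two Hom complexes are the complexes of elements of \<open>E\<^sub>n\<close> and of \<open>J\<close> annihilated by \<open>I\<^sub>0\<close>.
\<close>

section \<open>Homomorphisms and quotients\<close>

text \<open>Injectivity is defined by testing against modules whose elements have the type of the
  ring, whereas resolutions have arbitrary carriers. Extending a map along a differential therefore
  needs Baer's criterion in full, with Zorn's lemma over arbitrary carriers. Baer's criterion also
  tells how much flatness is needed: only inclusions of ideals I of R_0 occur, and the one obstacle
  is that the assignment ar -> r f(a) on IR be well defined. Tensor products are handled through
  formal sums: if a sum of products ar vanishes in R, the formal sum must be a consequence of the
  bilinearity relations over I, which is what injectivity of R (x) I -> R (x) R_0 gives. With Baer's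
  criterion on both sides, comparison maps exist in both directions and are inverse up to homotopy.
  Both the maps and the homotopies are R_0-linear, hence preserve elements annihilated by I_0; this
  is why both Hom complexes are rewritten through such elements. Being annihilated by I_0 R and by
  I_0 is the same condition, and it passes to homogeneous components because I_0 sits in degree
  0.\<close>

lemma (in abelian_group) minus_eq_zero_iff:
  assumes "a \<in> carrier G" "b \<in> carrier G"
  shows "a \<ominus> b = \<zero> \<longleftrightarrow> a = b"
  using assms by (metis a_minus_def add.inv_closed minus_equality minus_minus r_neg)

lemma mhomI:
  assumes "f \<in> carrier M \<rightarrow>\<^sub>E carrier N"
    and "\<And>x y. x \<in> carrier M \<Longrightarrow> y \<in> carrier M \<Longrightarrow> f (x \<oplus>\<^bsub>M\<^esub> y) = f x \<oplus>\<^bsub>N\<^esub> f y"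
    and "\<And>a x. a \<in> carrier A \<Longrightarrow> x \<in> carrier M \<Longrightarrow> f (a \<odot>\<^bsub>M\<^esub> x) = a \<odot>\<^bsub>N\<^esub> f x"
  shows "f \<in> mhom A M N"
  using assms unfolding mhom_def by blast

lemma mhom_closed: "f \<in> mhom A M N \<Longrightarrow> x \<in> carrier M \<Longrightarrow> f x \<in> carrier N"
  by (auto simp: mhom_def)

lemma mhom_add:
  "f \<in> mhom A M N \<Longrightarrow> x \<in> carrier M \<Longrightarrow> y \<in> carrier M \<Longrightarrow> f (x \<oplus>\<^bsub>M\<^esub> y) = f x \<oplus>\<^bsub>N\<^esub> f y"
  by (simp add: mhom_def)

lemma mhom_smult:
  "f \<in> mhom A M N \<Longrightarrow> a \<in> carrier A \<Longrightarrow> x \<in> carrier M \<Longrightarrow> f (a \<odot>\<^bsub>M\<^esub> x) = a \<odot>\<^bsub>N\<^esub> f x"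
  by (simp add: mhom_def)

lemma mhom_extensional: "f \<in> mhom A M N \<Longrightarrow> f \<in> extensional (carrier M)"
  by (auto simp: mhom_def PiE_def)

lemma mhom_eqI:
  assumes "f \<in> mhom A M N" "g \<in> mhom A M N" "\<And>x. x \<in> carrier M \<Longrightarrow> f x = g x"
  shows "f = g"
  using assms mhom_extensional extensionalityI by metis

lemma mhom_zero:
  assumes "module A M" "module A N" "f \<in> mhom A M N"
  shows "f \<zero>\<^bsub>M\<^esub> = \<zero>\<^bsub>N\<^esub>"
proof -
  interpret M: module A M by fact
  interpret N: module A N by fact
  have "f \<zero>\<^bsub>M\<^esub> = f (\<zero>\<^bsub>A\<^esub> \<odot>\<^bsub>M\<^esub> \<zero>\<^bsub>M\<^esub>)" by simp
  also have "\<dots> = \<zero>\<^bsub>A\<^esub> \<odot>\<^bsub>N\<^esub> f \<zero>\<^bsub>M\<^esub>" using assms(3) by (intro mhom_smult) auto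
  finally show ?thesis using mhom_closed[OF assms(3)] by simp
qed

lemma mhom_minus:
  assumes "module A M" "module A N" "f \<in> mhom A M N" "x \<in> carrier M" "y \<in> carrier M"
  shows "f (x \<ominus>\<^bsub>M\<^esub> y) = f x \<ominus>\<^bsub>N\<^esub> f y"
proof -
  interpret M: module A M by fact
  interpret N: module A N by fact
  have y: "\<ominus>\<^bsub>M\<^esub> y = (\<ominus>\<^bsub>A\<^esub> \<one>\<^bsub>A\<^esub>) \<odot>\<^bsub>M\<^esub> y"
    using assms by (simp add: M.smult_l_minus)
  have "f (\<ominus>\<^bsub>M\<^esub> y) = (\<ominus>\<^bsub>A\<^esub> \<one>\<^bsub>A\<^esub>) \<odot>\<^bsub>N\<^esub> f y"
    unfolding y using assms by (intro mhom_smult) auto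
  also have "\<dots> = \<ominus>\<^bsub>N\<^esub> f y"
    using assms mhom_closed[OF assms(3)] by (simp add: N.smult_l_minus)
  finally show ?thesis
    using assms by (simp add: M.minus_eq N.minus_eq mhom_add[OF assms(3)])
qed

lemma mhom_compose:
  assumes "f \<in> mhom A M N" "g \<in> mhom A N P"
    and "\<And>x y. x \<in> carrier M \<Longrightarrow> y \<in> carrier M \<Longrightarrow> x \<oplus>\<^bsub>M\<^esub> y \<in> carrier M"
    and "\<And>a x. a \<in> carrier A \<Longrightarrow> x \<in> carrier M \<Longrightarrow> a \<odot>\<^bsub>M\<^esub> x \<in> carrier M"
  shows "compose (carrier M) g f \<in> mhom A M P"
  using assms
  by (intro mhomI) (auto simp: compose_def mhom_closed[OF assms(1)] mhom_closed[OF assms(2)]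
     mhom_add[OF assms(1)] mhom_add[OF assms(2)] mhom_smult[OF assms(1)] mhom_smult[OF assms(2)])

lemma mem_a_kernel: "x \<in> a_kernel M N f \<longleftrightarrow> x \<in> carrier M \<and> f x = \<zero>\<^bsub>N\<^esub>"
  by (simp add: a_kernel_def')

text \<open>Pointwise operations inherit every module law from \<open>E\<close>. Of the source only
  closure under its operations is used, so that a quotient can serve as the source as soon as its
  cosets are known to add and scale.\<close>

lemma mod_hom_module:
  assumes E: "module A E"
    and ad: "\<And>x y. x \<in> carrier N \<Longrightarrow> y \<in> carrier N \<Longrightarrow> x \<oplus>\<^bsub>N\<^esub> y \<in> carrier N"
    and sm: "\<And>a x. a \<in> carrier A \<Longrightarrow> x \<in> carrier N \<Longrightarrow> a \<odot>\<^bsub>N\<^esub> x \<in> carrier N"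
  shows "module A (hom_mod A N E)"
proof -
  interpret E: module A E by fact
  note cl = mhom_closed[of _ A N E]
  have add: "(\<lambda>x\<in>carrier N. f x \<oplus>\<^bsub>E\<^esub> g x) \<in> mhom A N E"
    if "f \<in> mhom A N E" "g \<in> mhom A N E" for f g
    using that ad sm
    by (intro mhomI)
      (auto simp: cl mhom_add[of _ A N E] mhom_smult[of _ A N E] E.smult_r_distr E.a_ac)
  have smult: "(\<lambda>x\<in>carrier N. a \<odot>\<^bsub>E\<^esub> f x) \<in> mhom A N E"
    if "f \<in> mhom A N E" "a \<in> carrier A" for f a
  proof (intro mhomI)
    fix b x assume b: "b \<in> carrier A" "x \<in> carrier N"
    \<comment> \<open>Commutativity of \<open>A\<close> is what makes a scalar multiple of a linear
      map linear.\<close>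
    have "a \<odot>\<^bsub>E\<^esub> (b \<odot>\<^bsub>E\<^esub> f x) = b \<odot>\<^bsub>E\<^esub> (a \<odot>\<^bsub>E\<^esub> f x)"
      using that b cl[OF that(1)]
      by (simp add: E.smult_assoc1[symmetric] E.R.m_comm)
    then show "(\<lambda>x\<in>carrier N. a \<odot>\<^bsub>E\<^esub> f x) (b \<odot>\<^bsub>N\<^esub> x) = b \<odot>\<^bsub>E\<^esub> (\<lambda>x\<in>carrier N. a \<odot>\<^bsub>E\<^esub> f x) x"
      using that b sm by (simp add: mhom_smult[of _ A N E])
  qed (use that ad in \<open>auto simp: cl mhom_add[of _ A N E] E.smult_r_distr\<close>)
  have zero: "(\<lambda>x\<in>carrier N. \<zero>\<^bsub>E\<^esub>) \<in> mhom A N E"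
    by (intro mhomI) (auto simp: ad sm)
  show ?thesis
  proof (rule moduleI)
    show "abelian_group (hom_mod A N E)"
    proof (rule abelian_groupI)
      fix f assume "f \<in> carrier (hom_mod A N E)"
      then have f: "f \<in> mhom A N E" by (simp add: hom_mod_def)
      \<comment> \<open>The additive inverse is written as the multiple by -1, so that its linearity
        is an instance of \<open>smult\<close>.\<close>
      define g where "g = (\<lambda>x\<in>carrier N. (\<ominus>\<^bsub>A\<^esub> \<one>\<^bsub>A\<^esub>) \<odot>\<^bsub>E\<^esub> f x)"
      have g: "g \<in> mhom A N E"
        unfolding g_def using smult[OF f] by simp
      have "g x \<oplus>\<^bsub>E\<^esub> f x = \<zero>\<^bsub>E\<^esub>" if "x \<in> carrier N" for x
        using that cl[OF f that] by (simp add: g_def E.smult_l_minus E.l_neg)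
      then have "(\<lambda>x\<in>carrier N. g x \<oplus>\<^bsub>E\<^esub> f x) = (\<lambda>x\<in>carrier N. \<zero>\<^bsub>E\<^esub>)"
        by (rule restrict_ext)
      then show "\<exists>y\<in>carrier (hom_mod A N E). y \<oplus>\<^bsub>hom_mod A N E\<^esub> f = \<zero>\<^bsub>hom_mod A N E\<^esub>"
        using g by (intro bexI[of _ g]) (simp_all only: hom_mod_def partial_object.simps ring.simps)
    next
      show "\<zero>\<^bsub>hom_mod A N E\<^esub> \<in> carrier (hom_mod A N E)"
        using zero by (simp only: hom_mod_def partial_object.simps ring.simps)
    next
      fix f g assume "f \<in> carrier (hom_mod A N E)" "g \<in> carrier (hom_mod A N E)"
      then show "f \<oplus>\<^bsub>hom_mod A N E\<^esub> g \<in> carrier (hom_mod A N E)"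
        using add by (simp only: hom_mod_def partial_object.simps ring.simps)
    next
      fix f assume "f \<in> carrier (hom_mod A N E)"
      then have f: "f \<in> mhom A N E" by (simp add: hom_mod_def)
      show "\<zero>\<^bsub>hom_mod A N E\<^esub> \<oplus>\<^bsub>hom_mod A N E\<^esub> f = f"
        using mhom_extensional[OF f] cl[OF f] by (auto simp: hom_mod_def fun_eq_iff extensional_def)
    qed (auto simp: hom_mod_def cl E.a_ac intro!: restrict_ext)
  next
    fix a f assume "a \<in> carrier A" "f \<in> carrier (hom_mod A N E)"
    then show "a \<odot>\<^bsub>hom_mod A N E\<^esub> f \<in> carrier (hom_mod A N E)"
      using smult by (simp add: hom_mod_def)
  next
    fix f assume "f \<in> carrier (hom_mod A N E)"
    then have f: "f \<in> mhom A N E" by (simp add: hom_mod_def)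
    show "\<one>\<^bsub>A\<^esub> \<odot>\<^bsub>hom_mod A N E\<^esub> f = f"
      using mhom_extensional[OF f] cl[OF f] by (auto simp: hom_mod_def fun_eq_iff extensional_def)
  qed (auto simp: hom_mod_def cl E.smult_l_distr E.smult_r_distr E.smult_assoc1
       E.cring_axioms intro!: restrict_ext)
qed

lemma submodule_coset_eq_iff:
  assumes "module A V" "submodule B A V" "x \<in> carrier V" "y \<in> carrier V"
  shows "B +>\<^bsub>V\<^esub> x = B +>\<^bsub>V\<^esub> y \<longleftrightarrow> x \<ominus>\<^bsub>V\<^esub> y \<in> B"
proof -
  interpret V: module A V by fact
  interpret B: submodule B A V by fact
  interpret B: abelian_subgroup B V
    using B.subgroup_axioms V.abelian_group_axioms
    by (intro abelian_subgroupI3) (auto intro: additive_subgroup.intro)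
  show ?thesis
    using B.a_rcos_module[OF assms(4,3)] B.a_repr_independence'[OF _ assms(4), of x]
      B.a_rcos_self[OF assms(3)] V.minus_eq[of x y] by auto
qed

lemma submodule_coset_add:
  assumes "module A V" "submodule B A V" "x \<in> carrier V" "y \<in> carrier V"
  shows "(B +>\<^bsub>V\<^esub> x) <+>\<^bsub>V\<^esub> (B +>\<^bsub>V\<^esub> y) = B +>\<^bsub>V\<^esub> (x \<oplus>\<^bsub>V\<^esub> y)"
proof -
  interpret V: module A V by fact
  interpret B: submodule B A V by fact
  interpret B: abelian_subgroup B V
    using B.subgroup_axioms V.abelian_group_axioms
    by (intro abelian_subgroupI3) (auto intro: additive_subgroup.intro)
  show ?thesis using assms by (simp add: B.a_rcos_sum)
qed

text \<open>\<open>quot_mod\<close> defines scalar multiplication as a union of cosets over all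
  representatives. Since \<open>B\<close> absorbs scalars, all these cosets coincide and the union
  is a single coset.\<close>

lemma submodule_coset_smult:
  assumes "module A V" "submodule B A V" "x \<in> carrier V" "a \<in> carrier A"
  shows "(\<Union>z \<in> B +>\<^bsub>V\<^esub> x. B +>\<^bsub>V\<^esub> (a \<odot>\<^bsub>V\<^esub> z)) = B +>\<^bsub>V\<^esub> (a \<odot>\<^bsub>V\<^esub> x)"
proof -
  interpret V: module A V by fact
  interpret B: submodule B A V by fact
  have zero: "\<zero>\<^bsub>V\<^esub> \<in> B" using B.one_closed by simp
  have sub: "B \<subseteq> carrier V" using B.subset by simp
  have "B +>\<^bsub>V\<^esub> (a \<odot>\<^bsub>V\<^esub> (b \<oplus>\<^bsub>V\<^esub> x)) = B +>\<^bsub>V\<^esub> (a \<odot>\<^bsub>V\<^esub> x)" if "b \<in> B" for b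
  proof -
    have b: "b \<in> carrier V" using that sub by auto
    have "a \<odot>\<^bsub>V\<^esub> (b \<oplus>\<^bsub>V\<^esub> x) \<ominus>\<^bsub>V\<^esub> a \<odot>\<^bsub>V\<^esub> x = a \<odot>\<^bsub>V\<^esub> b"
      using assms b by (simp add: V.smult_r_distr V.minus_eq V.a_assoc V.r_neg)
    then show ?thesis
      using assms b that by (subst submodule_coset_eq_iff[OF assms(1,2)]) (auto intro: B.smult_closed)
  qed
  then show ?thesis
    using zero by (auto simp: a_r_coset_def')
qed

text \<open>An isomorphism of subquotients \<open>W/B \<cong> Z'/B'\<close> from a map \<open>\<Phi>\<close> defined on \<open>W\<close> only.\<close>

lemma quot_mod_iso:
  assumes V: "module A V" "submodule B A V" "submodule W A V"
    and V': "module A V'" "submodule B' A V'" "submodule Z' A V'"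
    and sub: "W \<subseteq> Z"
    and map: "\<And>w. w \<in> W \<Longrightarrow> \<Phi> w \<in> Z'"
    and add: "\<And>w u. w \<in> W \<Longrightarrow> u \<in> W \<Longrightarrow> \<Phi> (w \<oplus>\<^bsub>V\<^esub> u) = \<Phi> w \<oplus>\<^bsub>V'\<^esub> \<Phi> u"
    and smult: "\<And>a w. a \<in> carrier A \<Longrightarrow> w \<in> W \<Longrightarrow> \<Phi> (a \<odot>\<^bsub>V\<^esub> w) = a \<odot>\<^bsub>V'\<^esub> \<Phi> w"
    and inj: "\<And>w. w \<in> W \<Longrightarrow> \<Phi> w \<in> B' \<longleftrightarrow> w \<in> B"
    and surj: "\<And>z. z \<in> Z' \<Longrightarrow> \<exists>w\<in>W. \<Phi> w \<ominus>\<^bsub>V'\<^esub> z \<in> B'"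
  shows "mod_iso A ((quot_mod (V\<lparr>carrier := Z\<rparr>) B)\<lparr>carrier := (\<lambda>w. B +>\<^bsub>V\<^esub> w) ` W\<rparr>)
           (quot_mod (V'\<lparr>carrier := Z'\<rparr>) B')"
proof -
  interpret V: module A V by fact
  interpret V': module A V' by fact
  interpret W: submodule W A V by fact
  interpret Z': submodule Z' A V' by fact
  have Wc: "w \<in> carrier V" if "w \<in> W" for w using that W.subset by auto
  have Z'c: "w \<in> carrier V'" if "w \<in> Z'" for w using that Z'.subset by auto
  have Wadd: "w \<oplus>\<^bsub>V\<^esub> u \<in> W" if "w \<in> W" "u \<in> W" for w u using W.m_closed that by simp
  have Wneg: "w \<ominus>\<^bsub>V\<^esub> u \<in> W" "\<Phi> (w \<ominus>\<^bsub>V\<^esub> u) = \<Phi> w \<ominus>\<^bsub>V'\<^esub> \<Phi> u" if "w \<in> W" "u \<in> W" for w u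
  proof -
    have n: "\<ominus>\<^bsub>V\<^esub> u = (\<ominus>\<^bsub>A\<^esub> \<one>\<^bsub>A\<^esub>) \<odot>\<^bsub>V\<^esub> u" using that Wc by (simp add: V.smult_l_minus)
    have W': "\<ominus>\<^bsub>V\<^esub> u \<in> W" unfolding n using that by (intro W.smult_closed) auto
    then show "w \<ominus>\<^bsub>V\<^esub> u \<in> W" using that Wadd by (simp add: V.minus_eq)
    have "\<Phi> (\<ominus>\<^bsub>V\<^esub> u) = (\<ominus>\<^bsub>A\<^esub> \<one>\<^bsub>A\<^esub>) \<odot>\<^bsub>V'\<^esub> \<Phi> u" unfolding n using that by (intro smult) auto
    also have "\<dots> = \<ominus>\<^bsub>V'\<^esub> \<Phi> u" using that Z'c map by (simp add: V'.smult_l_minus)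
    finally show "\<Phi> (w \<ominus>\<^bsub>V\<^esub> u) = \<Phi> w \<ominus>\<^bsub>V'\<^esub> \<Phi> u"
      using that W' by (simp add: V.minus_eq V'.minus_eq add)
  qed
  \<comment> \<open>\<open>B\<close> need not lie in \<open>W\<close>, so the source is in effect
    W/(W \<inter> B). Representatives are chosen in \<open>W\<close>, not merely in
    \<open>Z\<close>, because nothing is known about \<open>\<Phi>\<close> elsewhere.\<close>
  define r where "r C = (SOME w. w \<in> W \<and> B +>\<^bsub>V\<^esub> w = C)" for C
  define h where "h = (\<lambda>C \<in> (\<lambda>w. B +>\<^bsub>V\<^esub> w) ` W. B' +>\<^bsub>V'\<^esub> \<Phi> (r C))"
  \<comment> \<open>The two directions give independence of the representative and injectivity at
    once; both come from \<open>\<Phi>\<close> reflecting and preserving membership in the subgroups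
    of boundaries.\<close>
  have eq_iff: "B +>\<^bsub>V\<^esub> w = B +>\<^bsub>V\<^esub> u \<longleftrightarrow> B' +>\<^bsub>V'\<^esub> \<Phi> w = B' +>\<^bsub>V'\<^esub> \<Phi> u" if "w \<in> W" "u \<in> W" for w u
    using inj[OF Wneg(1)[OF that]] Wneg(2)[OF that]
      submodule_coset_eq_iff[OF V(1,2) Wc[OF that(1)] Wc[OF that(2)]]
      submodule_coset_eq_iff[OF V'(1,2) Z'c[OF map[OF that(1)]] Z'c[OF map[OF that(2)]]]
    by simp
  have h: "h (B +>\<^bsub>V\<^esub> w) = B' +>\<^bsub>V'\<^esub> \<Phi> w" if "w \<in> W" for w
  proof -
    have "r (B +>\<^bsub>V\<^esub> w) \<in> W \<and> B +>\<^bsub>V\<^esub> r (B +>\<^bsub>V\<^esub> w) = B +>\<^bsub>V\<^esub> w"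
      unfolding r_def using that by (intro someI_ex[of "\<lambda>u. u \<in> W \<and> B +>\<^bsub>V\<^esub> u = B +>\<^bsub>V\<^esub> w"]) auto
    then have "B' +>\<^bsub>V'\<^esub> \<Phi> (r (B +>\<^bsub>V\<^esub> w)) = B' +>\<^bsub>V'\<^esub> \<Phi> w"
      using that eq_iff by blast
    then show ?thesis using that by (simp add: h_def)
  qed
  have im: "B' +>\<^bsub>V'\<^esub> z \<in> (\<lambda>w. B' +>\<^bsub>V'\<^esub> \<Phi> w) ` W" if "z \<in> Z'" for z
  proof -
    obtain w where "w \<in> W" "\<Phi> w \<ominus>\<^bsub>V'\<^esub> z \<in> B'" using surj[OF \<open>z \<in> Z'\<close>] by auto
    then have "B' +>\<^bsub>V'\<^esub> z = B' +>\<^bsub>V'\<^esub> \<Phi> w"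
      using submodule_coset_eq_iff[OF V'(1,2) Z'c[OF map] Z'c[OF that], of w] by simp
    then show ?thesis using \<open>w \<in> W\<close> by (rule image_eqI)
  qed
  have rc: "a_rcosets\<^bsub>V'\<lparr>carrier := Z'\<rparr>\<^esub> B' = (\<lambda>z. B' +>\<^bsub>V'\<^esub> z) ` Z'"
    unfolding A_RCOSETS_defs a_r_coset_defs by auto
  let ?Q = "(quot_mod (V\<lparr>carrier := Z\<rparr>) B)\<lparr>carrier := (\<lambda>w. B +>\<^bsub>V\<^esub> w) ` W\<rparr>"
  let ?Q' = "quot_mod (V'\<lparr>carrier := Z'\<rparr>) B'"
  have carrier': "carrier ?Q' = (\<lambda>z. B' +>\<^bsub>V'\<^esub> z) ` Z'"
    by (simp add: quot_mod_def rc)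
  have add_Q: "(B +>\<^bsub>V\<^esub> w) \<oplus>\<^bsub>?Q\<^esub> (B +>\<^bsub>V\<^esub> u) = B +>\<^bsub>V\<^esub> (w \<oplus>\<^bsub>V\<^esub> u)" if "w \<in> W" "u \<in> W" for w u
    using submodule_coset_add[OF V(1,2) Wc[OF that(1)] Wc[OF that(2)]]
    by (simp add: quot_mod_def set_add_def')
  have add_Q': "(B' +>\<^bsub>V'\<^esub> w) \<oplus>\<^bsub>?Q'\<^esub> (B' +>\<^bsub>V'\<^esub> u) = B' +>\<^bsub>V'\<^esub> (w \<oplus>\<^bsub>V'\<^esub> u)"
    if "w \<in> Z'" "u \<in> Z'" for w u
    using submodule_coset_add[OF V'(1,2) Z'c[OF that(1)] Z'c[OF that(2)]]
    by (simp add: quot_mod_def set_add_def')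
  have smult_Q: "a \<odot>\<^bsub>?Q\<^esub> (B +>\<^bsub>V\<^esub> w) = B +>\<^bsub>V\<^esub> (a \<odot>\<^bsub>V\<^esub> w)" if "a \<in> carrier A" "w \<in> W" for a w
    using submodule_coset_smult[OF V(1,2) Wc[OF that(2)] that(1)]
    by (simp add: quot_mod_def a_r_coset_def')
  have smult_Q': "a \<odot>\<^bsub>?Q'\<^esub> (B' +>\<^bsub>V'\<^esub> w) = B' +>\<^bsub>V'\<^esub> (a \<odot>\<^bsub>V'\<^esub> w)"
    if "a \<in> carrier A" "w \<in> Z'" for a w
    using submodule_coset_smult[OF V'(1,2) Z'c[OF that(2)] that(1)]
    by (simp add: quot_mod_def a_r_coset_def')
  have "h \<in> mhom A ?Q ?Q'"
  proof (rule mhomI)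
    show "h \<in> carrier ?Q \<rightarrow>\<^sub>E carrier ?Q'"
      unfolding carrier' h_def using h map by (auto simp: h_def)
  next
    fix C D assume "C \<in> carrier ?Q" "D \<in> carrier ?Q"
    then obtain w u where "w \<in> W" "u \<in> W" "C = B +>\<^bsub>V\<^esub> w" "D = B +>\<^bsub>V\<^esub> u" by auto
    then show "h (C \<oplus>\<^bsub>?Q\<^esub> D) = h C \<oplus>\<^bsub>?Q'\<^esub> h D"
      by (simp only: add_Q h Wadd add_Q' map add)
  next
    fix a C assume "a \<in> carrier A" "C \<in> carrier ?Q"
    then obtain w where "a \<in> carrier A" "w \<in> W" "C = B +>\<^bsub>V\<^esub> w" by auto
    then show "h (a \<odot>\<^bsub>?Q\<^esub> C) = a \<odot>\<^bsub>?Q'\<^esub> h C"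
      by (simp only: smult_Q h W.smult_closed smult_Q' map smult)
  qed
  moreover have "bij_betw h (carrier ?Q) (carrier ?Q')"
  proof (rule bij_betw_imageI)
    show "inj_on h (carrier ?Q)"
    proof (rule inj_onI)
      fix C D assume "C \<in> carrier ?Q" "D \<in> carrier ?Q" "h C = h D"
      then obtain w u where "w \<in> W" "u \<in> W" "C = B +>\<^bsub>V\<^esub> w" "D = B +>\<^bsub>V\<^esub> u" by auto
      then show "C = D" using \<open>h C = h D\<close> h eq_iff by metis
    qed
    show "h ` carrier ?Q = carrier ?Q'"
      unfolding carrier' using h map im by (auto simp: image_image)
  qed
  ultimately show ?thesis
    unfolding mod_iso_def by blast
qed

section \<open>Baer's criterion\<close>

text \<open>The extension of a map from an ideal to all of \<open>A\<close> is recorded by the image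
  \<open>y\<close> of 1. Only ring elements and elements of \<open>D\<close> occur, so the condition
  is meaningful for a carrier of any type, and \<open>f\<close> may be a plain function that is not
  normalised outside the ideal.\<close>

definition baer_module :: "'a ring \<Rightarrow> ('a, 'm) module \<Rightarrow> bool" where
  "baer_module A D \<longleftrightarrow> module A D \<and>
     (\<forall>I f. ideal I A \<longrightarrow> f \<in> I \<rightarrow> carrier D \<longrightarrow>
        (\<forall>a\<in>I. \<forall>b\<in>I. f (a \<oplus>\<^bsub>A\<^esub> b) = f a \<oplus>\<^bsub>D\<^esub> f b) \<longrightarrow>
        (\<forall>r\<in>carrier A. \<forall>a\<in>I. f (r \<otimes>\<^bsub>A\<^esub> a) = r \<odot>\<^bsub>D\<^esub> f a) \<longrightarrow>
        (\<exists>y\<in>carrier D. \<forall>a\<in>I. f a = a \<odot>\<^bsub>D\<^esub> y))"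

lemma reg_mod_module:
  assumes "cring A" shows "module A (reg_mod A)"
proof -
  interpret cring A by fact
  show ?thesis
    by (rule moduleI)
      (auto simp: reg_mod_def cring_axioms l_distr r_distr m_assoc a_ac intro!: abelian_groupI
        intro: l_neg)
qed

lemma ideal_submodule_reg_mod:
  assumes "cring A" "ideal I A" shows "submodule I A (reg_mod A)"
proof -
  interpret cring A by fact
  interpret I: ideal I A by fact
  interpret A: module A "reg_mod A" using reg_mod_module[OF assms(1)] .
  show ?thesis
  proof (rule A.submoduleI)
    fix a assume a: "a \<in> I"
    then have "(\<ominus>\<^bsub>A\<^esub> \<one>\<^bsub>A\<^esub>) \<odot>\<^bsub>reg_mod A\<^esub> a = \<ominus>\<^bsub>reg_mod A\<^esub> a"
      using I.a_subset A.smult_l_minus[of "\<one>\<^bsub>A\<^esub>" a] A.smult_one[of a] by (auto simp: reg_mod_def)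
    moreover have "(\<ominus>\<^bsub>A\<^esub> \<one>\<^bsub>A\<^esub>) \<odot>\<^bsub>reg_mod A\<^esub> a \<in> I"
      using a by (simp add: reg_mod_def I.I_l_closed)
    ultimately show "\<ominus>\<^bsub>reg_mod A\<^esub> a \<in> I" by simp
  qed (use I.a_subset in \<open>auto simp: reg_mod_def I.I_l_closed\<close>)
qed

text \<open>The ideal and the ring itself are carried by the type of the ring, so they are
  admissible test modules. The element sought is the value at 1 of the extension of
  \<open>f\<close>.\<close>

lemma injective_imp_baer:
  assumes "cring A" "injective_module A D"
  shows "baer_module A D"
  unfolding baer_module_def
proof (intro conjI allI impI)
  show D: "module A D" using assms by (simp add: injective_module_def)
  interpret D: module A D by fact
  fix I f
  assume I: "ideal I A" and f: "f \<in> I \<rightarrow> carrier D"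
    "\<forall>a\<in>I. \<forall>b\<in>I. f (a \<oplus>\<^bsub>A\<^esub> b) = f a \<oplus>\<^bsub>D\<^esub> f b"
    "\<forall>r\<in>carrier A. \<forall>a\<in>I. f (r \<otimes>\<^bsub>A\<^esub> a) = r \<odot>\<^bsub>D\<^esub> f a"
  interpret I: ideal I A by fact
  let ?Q = "reg_mod A" and ?P = "(reg_mod A)\<lparr>carrier := I\<rparr>"
  have Q: "module A ?Q" by (rule reg_mod_module) fact
  have P: "module A ?P"
    using submodule.submodule_is_module[OF ideal_submodule_reg_mod[OF assms(1) I] Q] .
  have sub: "I \<subseteq> carrier A" using I.a_subset .
  have j: "(\<lambda>a\<in>I. a) \<in> mhom A ?P ?Q"
    using sub by (intro mhomI) (auto simp: reg_mod_def I.I_l_closed)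
  have f': "restrict f I \<in> mhom A ?P D"
    using f by (intro mhomI) (auto simp: reg_mod_def I.I_l_closed)
  have "inj_on (\<lambda>a\<in>I. a) (carrier ?P)" by (auto simp: inj_on_def)
  then obtain g where g: "g \<in> mhom A ?Q D" "\<forall>x\<in>I. g x = f x"
    using assms(2) P Q j f' unfolding injective_module_def by (fastforce simp: reg_mod_def)
  show "\<exists>y\<in>carrier D. \<forall>a\<in>I. f a = a \<odot>\<^bsub>D\<^esub> y"
  proof (intro bexI ballI)
    show "g \<one>\<^bsub>A\<^esub> \<in> carrier D" using mhom_closed[OF g(1)] by (simp add: reg_mod_def)
    fix a assume a: "a \<in> I"
    then have "g (a \<odot>\<^bsub>?Q\<^esub> \<one>\<^bsub>A\<^esub>) = a \<odot>\<^bsub>D\<^esub> g \<one>\<^bsub>A\<^esub>"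
      using sub by (intro mhom_smult[OF g(1)]) (auto simp: reg_mod_def)
    then show "f a = a \<odot>\<^bsub>D\<^esub> g \<one>\<^bsub>A\<^esub>" using a g(2) sub by (auto simp: reg_mod_def)
  qed
qed

text \<open>A homomorphism from a submodule of \<open>C\<close> to \<open>D\<close>, encoded by its
  graph: a set of pairs closed under the module operations that meets 0 x D only in zero. Extension
  of partial maps becomes inclusion and the upper bound of a chain becomes its union. The empty set
  is allowed.\<close>

definition partial_hom_graph ::
    "'a ring \<Rightarrow> ('a, 'm) module \<Rightarrow> ('a, 'n) module \<Rightarrow> ('m \<times> 'n) set \<Rightarrow> bool" where
  "partial_hom_graph A C D G \<longleftrightarrow> G \<subseteq> carrier C \<times> carrier D \<and>
     (\<forall>x y x' y'. (x, y) \<in> G \<longrightarrow> (x', y') \<in> G \<longrightarrow> (x \<oplus>\<^bsub>C\<^esub> x', y \<oplus>\<^bsub>D\<^esub> y') \<in> G) \<and>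
     (\<forall>a x y. a \<in> carrier A \<longrightarrow> (x, y) \<in> G \<longrightarrow> (a \<odot>\<^bsub>C\<^esub> x, a \<odot>\<^bsub>D\<^esub> y) \<in> G) \<and>
     (\<forall>y. (\<zero>\<^bsub>C\<^esub>, y) \<in> G \<longrightarrow> y = \<zero>\<^bsub>D\<^esub>)"

lemma partial_hom_graph_neg:
  assumes "module A C" "module A D" "partial_hom_graph A C D G" "(x, y) \<in> G"
  shows "(\<ominus>\<^bsub>C\<^esub> x, \<ominus>\<^bsub>D\<^esub> y) \<in> G"
proof -
  interpret C: module A C by fact
  interpret D: module A D by fact
  have "x \<in> carrier C" "y \<in> carrier D" using assms by (auto simp: partial_hom_graph_def)
  moreover have "((\<ominus>\<^bsub>A\<^esub> \<one>\<^bsub>A\<^esub>) \<odot>\<^bsub>C\<^esub> x, (\<ominus>\<^bsub>A\<^esub> \<one>\<^bsub>A\<^esub>) \<odot>\<^bsub>D\<^esub> y) \<in> G"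
    using assms C.R.a_inv_closed[OF C.R.one_closed] unfolding partial_hom_graph_def by blast
  ultimately show ?thesis by (simp add: C.smult_l_minus D.smult_l_minus)
qed

text \<open>The difference of two values at the same point lies over zero, where the definition
  admits only the value zero.\<close>

lemma partial_hom_graph_unique:
  assumes "module A C" "module A D" "partial_hom_graph A C D G" "(x, y) \<in> G" "(x, z) \<in> G"
  shows "y = z"
proof -
  interpret C: module A C by fact
  interpret D: module A D by fact
  have c: "x \<in> carrier C" "y \<in> carrier D" "z \<in> carrier D"
    using assms by (auto simp: partial_hom_graph_def)
  have "(x \<oplus>\<^bsub>C\<^esub> \<ominus>\<^bsub>C\<^esub> x, y \<oplus>\<^bsub>D\<^esub> \<ominus>\<^bsub>D\<^esub> z) \<in> G"
    using assms(3,4) partial_hom_graph_neg[OF assms(1,2,3,5)]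
    unfolding partial_hom_graph_def by blast
  then have "(\<zero>\<^bsub>C\<^esub>, y \<ominus>\<^bsub>D\<^esub> z) \<in> G" using c by (simp add: C.r_neg D.minus_eq)
  then have "y \<ominus>\<^bsub>D\<^esub> z = \<zero>\<^bsub>D\<^esub>"
    using assms(3) by (simp add: partial_hom_graph_def)
  then show ?thesis using c D.minus_eq_zero_iff by simp
qed

text \<open>The one-step extension in Baer's theorem. The ring elements carrying \<open>c\<close>
  into the domain of \<open>G\<close> form an ideal, on which \<open>G\<close> induces a map to
  \<open>D\<close>; Baer's criterion makes it multiplication by some \<open>y\<close>, and
  \<open>c\<close> may be sent to \<open>y\<close>.\<close>

lemma partial_hom_graph_extend:
  assumes D: "baer_module A D" and C: "module A C" and G: "partial_hom_graph A C D G"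
    and ne: "G \<noteq> {}" and c: "c \<in> carrier C"
  shows "\<exists>G'. partial_hom_graph A C D G' \<and> G \<subseteq> G' \<and> c \<in> fst ` G'"
proof -
  have mD: "module A D" using D by (simp add: baer_module_def)
  interpret C: module A C by fact
  interpret D: module A D by fact
  have GC: "x \<in> carrier C" "y \<in> carrier D" if "(x, y) \<in> G" for x y
    using that G by (auto simp: partial_hom_graph_def)
  have Gadd: "(x \<oplus>\<^bsub>C\<^esub> x', y \<oplus>\<^bsub>D\<^esub> y') \<in> G" if "(x, y) \<in> G" "(x', y') \<in> G" for x y x' y'
    using that G by (simp add: partial_hom_graph_def)
  have Gsm: "(a \<odot>\<^bsub>C\<^esub> x, a \<odot>\<^bsub>D\<^esub> y) \<in> G" if "(x, y) \<in> G" "a \<in> carrier A" for a x y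
    using that G by (simp add: partial_hom_graph_def)
  note Gneg = partial_hom_graph_neg[OF C mD G] and Guniq = partial_hom_graph_unique[OF C mD G]
  obtain x0 y0 where xy0: "(x0, y0) \<in> G" using ne by auto
  \<comment> \<open>A multiple by zero of any pair; nonemptiness of \<open>G\<close> enters
    here.\<close>
  have G0: "(\<zero>\<^bsub>C\<^esub>, \<zero>\<^bsub>D\<^esub>) \<in> G"
    using Gsm[OF xy0 C.R.zero_closed] GC[OF xy0] by simp
  define I where "I = {a \<in> carrier A. \<exists>y. (a \<odot>\<^bsub>C\<^esub> c, y) \<in> G}"
  define f where "f a = (THE y. (a \<odot>\<^bsub>C\<^esub> c, y) \<in> G)" for a
  have f_eq: "f a = y" if "(a \<odot>\<^bsub>C\<^esub> c, y) \<in> G" for a y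
    unfolding f_def using that Guniq by blast
  have fG: "(a \<odot>\<^bsub>C\<^esub> c, f a) \<in> G" "a \<in> carrier A" if "a \<in> I" for a
    using that f_eq by (auto simp: I_def)
  have mul: "r \<otimes>\<^bsub>A\<^esub> a \<in> I" "f (r \<otimes>\<^bsub>A\<^esub> a) = r \<odot>\<^bsub>D\<^esub> f a" if "r \<in> carrier A" "a \<in> I" for r a
  proof -
    have *: "((r \<otimes>\<^bsub>A\<^esub> a) \<odot>\<^bsub>C\<^esub> c, r \<odot>\<^bsub>D\<^esub> f a) \<in> G"
      using Gsm[OF fG(1)[OF that(2)] that(1)] fG(2)[OF that(2)] that c
      by (simp add: C.smult_assoc1)
    then show "r \<otimes>\<^bsub>A\<^esub> a \<in> I" using fG(2) that by (auto simp: I_def)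
    show "f (r \<otimes>\<^bsub>A\<^esub> a) = r \<odot>\<^bsub>D\<^esub> f a" using f_eq[OF *] .
  qed
  have add: "a \<oplus>\<^bsub>A\<^esub> b \<in> I" "f (a \<oplus>\<^bsub>A\<^esub> b) = f a \<oplus>\<^bsub>D\<^esub> f b" if "a \<in> I" "b \<in> I" for a b
  proof -
    have *: "((a \<oplus>\<^bsub>A\<^esub> b) \<odot>\<^bsub>C\<^esub> c, f a \<oplus>\<^bsub>D\<^esub> f b) \<in> G"
      using Gadd[OF fG(1)[OF that(1)] fG(1)[OF that(2)]] fG(2)[OF that(1)] fG(2)[OF that(2)] c
      by (simp add: C.smult_l_distr)
    then show "a \<oplus>\<^bsub>A\<^esub> b \<in> I" using fG(2) that by (auto simp: I_def)
    show "f (a \<oplus>\<^bsub>A\<^esub> b) = f a \<oplus>\<^bsub>D\<^esub> f b" using f_eq[OF *] .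
  qed
  have zero: "\<zero>\<^bsub>A\<^esub> \<in> I" using G0 c by (auto simp: I_def)
  have ideal: "ideal I A"
  proof (rule idealI)
    show "ring A" ..
    show "subgroup I (add_monoid A)"
    proof (rule C.R.add.subgroupI)
      show "I \<subseteq> carrier A" by (auto simp: I_def)
      show "I \<noteq> {}" using zero by auto
      fix a assume a: "a \<in> I"
      have "(\<ominus>\<^bsub>A\<^esub> \<one>\<^bsub>A\<^esub>) \<otimes>\<^bsub>A\<^esub> a \<in> I" using a by (intro mul) auto
      then show "\<ominus>\<^bsub>A\<^esub> a \<in> I" using fG(2)[OF a] by (simp add: C.R.l_minus)
    qed (use add in auto)
    show "x \<otimes>\<^bsub>A\<^esub> a \<in> I" "a \<otimes>\<^bsub>A\<^esub> x \<in> I" if "a \<in> I" "x \<in> carrier A" for a x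
      using mul(1)[OF that(2,1)] fG(2)[OF that(1)] that(2) by (auto simp: C.R.m_comm)
  qed
  have "f \<in> I \<rightarrow> carrier D" using fG GC by blast
  then obtain y where y: "y \<in> carrier D" "\<And>a. a \<in> I \<Longrightarrow> f a = a \<odot>\<^bsub>D\<^esub> y"
    using conjunct2[OF D[unfolded baer_module_def], rule_format, OF ideal, of f] add(2) mul(2) by auto
  \<comment> \<open>The sum of \<open>G\<close> and the submodule generated by the pair
    \<open>(c, y)\<close>.\<close>
  define G' where "G' = {(x \<oplus>\<^bsub>C\<^esub> a \<odot>\<^bsub>C\<^esub> c, z \<oplus>\<^bsub>D\<^esub> a \<odot>\<^bsub>D\<^esub> y) | x z a. (x, z) \<in> G \<and> a \<in> carrier A}"
  have G'I: "(u, v) \<in> G'"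
    if "(x, z) \<in> G" "a \<in> carrier A" "u = x \<oplus>\<^bsub>C\<^esub> a \<odot>\<^bsub>C\<^esub> c" "v = z \<oplus>\<^bsub>D\<^esub> a \<odot>\<^bsub>D\<^esub> y" for x z a u v
    using that unfolding G'_def by blast
  have G'E: "\<exists>x z a. (x, z) \<in> G \<and> a \<in> carrier A \<and> u = x \<oplus>\<^bsub>C\<^esub> a \<odot>\<^bsub>C\<^esub> c \<and> v = z \<oplus>\<^bsub>D\<^esub> a \<odot>\<^bsub>D\<^esub> y"
    if "(u, v) \<in> G'" for u v
    using that unfolding G'_def by blast
  have "partial_hom_graph A C D G'"
    unfolding partial_hom_graph_def
  proof (intro conjI allI impI)
    show "G' \<subseteq> carrier C \<times> carrier D" using GC c y(1) by (auto simp: G'_def)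
  next
    fix u v u' v' assume "(u, v) \<in> G'" "(u', v') \<in> G'"
    then obtain x z a x' z' a' where *: "(x, z) \<in> G" "a \<in> carrier A" "(x', z') \<in> G" "a' \<in> carrier A"
      "u = x \<oplus>\<^bsub>C\<^esub> a \<odot>\<^bsub>C\<^esub> c" "v = z \<oplus>\<^bsub>D\<^esub> a \<odot>\<^bsub>D\<^esub> y" "u' = x' \<oplus>\<^bsub>C\<^esub> a' \<odot>\<^bsub>C\<^esub> c" "v' = z' \<oplus>\<^bsub>D\<^esub> a' \<odot>\<^bsub>D\<^esub> y"
      using G'E by meson
    show "(u \<oplus>\<^bsub>C\<^esub> u', v \<oplus>\<^bsub>D\<^esub> v') \<in> G'"
    proof (rule G'I)
      show "(x \<oplus>\<^bsub>C\<^esub> x', z \<oplus>\<^bsub>D\<^esub> z') \<in> G" using Gadd * by blast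
      show "a \<oplus>\<^bsub>A\<^esub> a' \<in> carrier A" using * by simp
    qed (use * GC[OF *(1)] GC[OF *(3)] c y(1) in
        \<open>simp_all add: C.smult_l_distr D.smult_l_distr C.a_ac D.a_ac\<close>)
  next
    fix b u v assume b: "b \<in> carrier A" and "(u, v) \<in> G'"
    then obtain x z a where *: "(x, z) \<in> G" "a \<in> carrier A"
      "u = x \<oplus>\<^bsub>C\<^esub> a \<odot>\<^bsub>C\<^esub> c" "v = z \<oplus>\<^bsub>D\<^esub> a \<odot>\<^bsub>D\<^esub> y"
      using G'E by meson
    show "(b \<odot>\<^bsub>C\<^esub> u, b \<odot>\<^bsub>D\<^esub> v) \<in> G'"
    proof (rule G'I)
      show "(b \<odot>\<^bsub>C\<^esub> x, b \<odot>\<^bsub>D\<^esub> z) \<in> G" using Gsm * b by blast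
      show "b \<otimes>\<^bsub>A\<^esub> a \<in> carrier A" using * b by simp
    qed (use * b GC[OF *(1)] c y(1) in
        \<open>simp_all add: C.smult_r_distr D.smult_r_distr C.smult_assoc1 D.smult_assoc1\<close>)
  next
    fix v assume "(\<zero>\<^bsub>C\<^esub>, v) \<in> G'"
    then obtain x z a where *: "(x, z) \<in> G" "a \<in> carrier A"
      "\<zero>\<^bsub>C\<^esub> = x \<oplus>\<^bsub>C\<^esub> a \<odot>\<^bsub>C\<^esub> c" "v = z \<oplus>\<^bsub>D\<^esub> a \<odot>\<^bsub>D\<^esub> y"
      using G'E by meson
    \<comment> \<open>The two summands of \<open>G'\<close> are compatible: if \<open>x\<close> and
      \<open>a\<close> times \<open>c\<close> cancel, then \<open>a\<close> lies in
      \<open>I\<close>, and there \<open>y\<close> was chosen to agree with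
      \<open>G\<close>.\<close>
    have "a \<odot>\<^bsub>C\<^esub> c = \<ominus>\<^bsub>C\<^esub> x"
      using * c GC[OF *(1)] C.minus_equality[of "a \<odot>\<^bsub>C\<^esub> c" x] by (simp add: C.a_comm)
    then have n: "(a \<odot>\<^bsub>C\<^esub> c, \<ominus>\<^bsub>D\<^esub> z) \<in> G" using Gneg[OF *(1)] by simp
    then have "a \<in> I" using * by (auto simp: I_def)
    then have "a \<odot>\<^bsub>D\<^esub> y = \<ominus>\<^bsub>D\<^esub> z" using y(2) f_eq[OF n] by simp
    then show "v = \<zero>\<^bsub>D\<^esub>" using * GC[OF *(1)] by (simp add: D.r_neg)
  qed
  moreover have "G \<subseteq> G'"
  proof (rule subrelI)
    fix x z assume "(x, z) \<in> G"
    then show "(x, z) \<in> G'"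
      using GC[OF \<open>(x, z) \<in> G\<close>] c y(1) by (intro G'I[of x z "\<zero>\<^bsub>A\<^esub>"]) simp_all
  qed
  moreover have "(c, y) \<in> G'"
    using G0 c y(1) by (intro G'I[of "\<zero>\<^bsub>C\<^esub>" "\<zero>\<^bsub>D\<^esub>" "\<one>\<^bsub>A\<^esub>"]) simp_all
  ultimately show ?thesis by force
qed

text \<open>In place of injectivity of \<open>u\<close> it is only assumed that the kernel of
  \<open>u\<close> lies in that of \<open>f\<close>, so that \<open>f\<close> factors through the
  image of \<open>u\<close>. In this form \<open>u\<close> can be a differential of an exact
  complex. The three modules may have carriers of different types.\<close>

lemma baer_extension:
  assumes D: "baer_module A D" and B: "module A B" and C: "module A C"
    and u: "u \<in> mhom A B C" and f: "f \<in> mhom A B D"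
    and ker: "\<And>x. x \<in> carrier B \<Longrightarrow> u x = \<zero>\<^bsub>C\<^esub> \<Longrightarrow> f x = \<zero>\<^bsub>D\<^esub>"
  shows "\<exists>g\<in>mhom A C D. \<forall>x\<in>carrier B. g (u x) = f x"
proof -
  have mD: "module A D" using D by (simp add: baer_module_def)
  interpret B: module A B by fact
  interpret C: module A C by fact
  interpret D: module A D by fact
  \<comment> \<open>The graph of the map induced by \<open>f\<close> on the image of
    \<open>u\<close>; the kernel condition makes it single-valued. Zorn's lemma is applied to the
    graphs containing it.\<close>
  define G0 where "G0 = (\<lambda>x. (u x, f x)) ` carrier B"
  have G0: "partial_hom_graph A C D G0"
    unfolding partial_hom_graph_def G0_def
    by (auto simp: mhom_closed[OF u] mhom_closed[OF f] ker
        mhom_add[OF u, symmetric] mhom_add[OF f, symmetric]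
        mhom_smult[OF u, symmetric] mhom_smult[OF f, symmetric])
  have ne: "G0 \<noteq> {}" by (auto simp: G0_def)
  let ?S = "{G. partial_hom_graph A C D G \<and> G0 \<subseteq> G}"
  have "\<exists>M\<in>?S. \<forall>G\<in>?S. M \<subseteq> G \<longrightarrow> G = M"
  proof (rule subset_Zorn_nonempty)
    show "?S \<noteq> {}" using G0 by auto
    fix K assume K: "K \<noteq> {}" "subset.chain ?S K"
    then have mem: "\<And>G. G \<in> K \<Longrightarrow> partial_hom_graph A C D G \<and> G0 \<subseteq> G"
      and lin: "\<And>G H. G \<in> K \<Longrightarrow> H \<in> K \<Longrightarrow> G \<subseteq> H \<or> H \<subseteq> G"
      by (auto simp: subset_chain_def)
    have "partial_hom_graph A C D (\<Union>K)"
      unfolding partial_hom_graph_def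
    proof (intro conjI allI impI)
      show "\<Union>K \<subseteq> carrier C \<times> carrier D" using mem unfolding partial_hom_graph_def by blast
    next
      fix x y x' y' assume "(x, y) \<in> \<Union>K" "(x', y') \<in> \<Union>K"
      then obtain G H where GH: "G \<in> K" "H \<in> K" "(x, y) \<in> G" "(x', y') \<in> H" by auto
      then obtain L where "L \<in> K" "(x, y) \<in> L" "(x', y') \<in> L" using lin[OF GH(1,2)] by blast
      then show "(x \<oplus>\<^bsub>C\<^esub> x', y \<oplus>\<^bsub>D\<^esub> y') \<in> \<Union>K"
        using mem[of L] unfolding partial_hom_graph_def by blast
    next
      fix a x y assume "a \<in> carrier A" "(x, y) \<in> \<Union>K"
      then show "(a \<odot>\<^bsub>C\<^esub> x, a \<odot>\<^bsub>D\<^esub> y) \<in> \<Union>K"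
        using mem unfolding partial_hom_graph_def by blast
    next
      fix y assume "(\<zero>\<^bsub>C\<^esub>, y) \<in> \<Union>K"
      then show "y = \<zero>\<^bsub>D\<^esub>" using mem unfolding partial_hom_graph_def by blast
    qed
    moreover have "G0 \<subseteq> \<Union>K" using K(1) mem by blast
    ultimately show "\<Union>K \<in> ?S" by simp
  qed
  then obtain G where GS: "G \<in> ?S" and GM: "\<forall>H\<in>?S. G \<subseteq> H \<longrightarrow> H = G"
    by (rule bexE)
  have G: "partial_hom_graph A C D G" "G0 \<subseteq> G" using GS by auto
  have max: "H = G" if "partial_hom_graph A C D H" "G \<subseteq> H" for H
    using GM that G(2) by auto
  \<comment> \<open>A maximal graph absorbs its one-step extension at any \<open>c\<close>, hence is
    defined everywhere.\<close>
  have total: "\<exists>y. (c, y) \<in> G" if c: "c \<in> carrier C" for c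
  proof -
    obtain G' where "partial_hom_graph A C D G'" "G \<subseteq> G'" "c \<in> fst ` G'"
      using partial_hom_graph_extend[OF D C G(1) _ c] ne G(2) by auto
    then have "c \<in> fst ` G" using max[of G'] by metis
    then show ?thesis by force
  qed
  define g where "g = (\<lambda>c\<in>carrier C. THE y. (c, y) \<in> G)"
  have g_eq: "g x = y" if "(x, y) \<in> G" for x y
  proof -
    have "x \<in> carrier C" using that G(1) by (auto simp: partial_hom_graph_def)
    moreover have "(THE y. (x, y) \<in> G) = y"
      using that partial_hom_graph_unique[OF C mD G(1)] by (intro the_equality) blast+
    ultimately show ?thesis by (simp add: g_def)
  qed
  have gG: "(x, g x) \<in> G" if "x \<in> carrier C" for x
    using total[OF that] g_eq by metis
  have "g \<in> mhom A C D"
  proof (rule mhomI)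
    have "g x \<in> carrier D" if "x \<in> carrier C" for x
      using gG[OF that] G(1) by (auto simp: partial_hom_graph_def)
    moreover have "g \<in> extensional (carrier C)" by (simp add: g_def)
    ultimately show "g \<in> carrier C \<rightarrow>\<^sub>E carrier D" by (simp add: PiE_def)
    show "g (x \<oplus>\<^bsub>C\<^esub> y) = g x \<oplus>\<^bsub>D\<^esub> g y" if "x \<in> carrier C" "y \<in> carrier C" for x y
      using gG that G(1) by (intro g_eq) (simp add: partial_hom_graph_def)
    show "g (a \<odot>\<^bsub>C\<^esub> x) = a \<odot>\<^bsub>D\<^esub> g x" if "a \<in> carrier A" "x \<in> carrier C" for a x
      using gG that G(1) by (intro g_eq) (simp add: partial_hom_graph_def)
  qed
  moreover have "\<forall>x\<in>carrier B. g (u x) = f x"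
    using G(2) g_eq by (auto simp: G0_def)
  ultimately show ?thesis by blast
qed

section \<open>Comparison of coresolutions\<close>

lemma mhom_diff:
  assumes "module A M" "module A N" "f \<in> mhom A M N" "g \<in> mhom A M N"
  shows "(\<lambda>x\<in>carrier M. f x \<ominus>\<^bsub>N\<^esub> g x) \<in> mhom A M N"
proof -
  interpret M: module A M by fact
  interpret N: module A N by fact
  note cl = mhom_closed[OF assms(3)] mhom_closed[OF assms(4)]
  show ?thesis
  proof (rule mhomI)
    fix x y assume "x \<in> carrier M" "y \<in> carrier M"
    then show "(\<lambda>x\<in>carrier M. f x \<ominus>\<^bsub>N\<^esub> g x) (x \<oplus>\<^bsub>M\<^esub> y) =
        (\<lambda>x\<in>carrier M. f x \<ominus>\<^bsub>N\<^esub> g x) x \<oplus>\<^bsub>N\<^esub> (\<lambda>x\<in>carrier M. f x \<ominus>\<^bsub>N\<^esub> g x) y"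
      using cl by (simp add: mhom_add[OF assms(3)] mhom_add[OF assms(4)] N.minus_eq N.minus_add N.a_ac)
  next
    fix a x assume "a \<in> carrier A" "x \<in> carrier M"
    then show "(\<lambda>x\<in>carrier M. f x \<ominus>\<^bsub>N\<^esub> g x) (a \<odot>\<^bsub>M\<^esub> x) = a \<odot>\<^bsub>N\<^esub> (\<lambda>x\<in>carrier M. f x \<ominus>\<^bsub>N\<^esub> g x) x"
      using cl by (simp add: mhom_smult[OF assms(3)] mhom_smult[OF assms(4)] N.minus_eq
          N.smult_r_distr N.smult_r_minus)
  qed (use cl in auto)
qed

lemma mhom_compose_module:
  assumes "module A M" "f \<in> mhom A M N" "g \<in> mhom A N P"
  shows "compose (carrier M) g f \<in> mhom A M P"
proof -
  interpret M: module A M by fact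
  show ?thesis using mhom_compose[OF assms(2,3)] by simp
qed

lemma mhom_id:
  assumes "module A M" shows "(\<lambda>x\<in>carrier M. x) \<in> mhom A M M"
proof -
  interpret M: module A M by fact
  show ?thesis by (intro mhomI) auto
qed

context
  fixes A :: "'a ring" and M :: "('a, 'm) module"
    and \<epsilon> :: "'m \<Rightarrow> 'e" and E :: "nat \<Rightarrow> ('a, 'e) module" and d :: "nat \<Rightarrow> 'e \<Rightarrow> 'e"
  assumes res: "coresolution A M \<epsilon> E d"
begin

lemma coresolution_module: "module A (E i)"
  using res by (simp add: coresolution_def)

lemma coresolution_aug: "\<epsilon> \<in> mhom A M (E 0)"
  using res by (simp add: coresolution_def)

lemma coresolution_diff: "d i \<in> mhom A (E i) (E (Suc i))"
  using res by (simp add: coresolution_def)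

lemma coresolution_exact_0:
  assumes "x \<in> carrier (E 0)" "d 0 x = \<zero>\<^bsub>E (Suc 0)\<^esub>"
  shows "\<exists>m\<in>carrier M. x = \<epsilon> m"
proof -
  have "x \<in> a_kernel (E 0) (E 1) (d 0)" using assms by (simp add: mem_a_kernel)
  then show ?thesis using res unfolding coresolution_def by blast
qed

lemma coresolution_exact_Suc:
  assumes "x \<in> carrier (E (Suc i))" "d (Suc i) x = \<zero>\<^bsub>E (Suc (Suc i))\<^esub>"
  shows "\<exists>y\<in>carrier (E i). x = d i y"
proof -
  have "x \<in> a_kernel (E (Suc i)) (E (Suc (Suc i))) (d (Suc i))" using assms by (simp add: mem_a_kernel)
  then have "x \<in> d i ` carrier (E i)" using res unfolding coresolution_def by metis
  then show ?thesis by blast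
qed

lemma coresolution_diff_aug:
  assumes "m \<in> carrier M" shows "d 0 (\<epsilon> m) = \<zero>\<^bsub>E (Suc 0)\<^esub>"
proof -
  have "\<epsilon> m \<in> a_kernel (E 0) (E 1) (d 0)" using res assms unfolding coresolution_def by blast
  then show ?thesis by (simp add: mem_a_kernel)
qed

lemma coresolution_diff_diff:
  assumes "x \<in> carrier (E i)" shows "d (Suc i) (d i x) = \<zero>\<^bsub>E (Suc (Suc i))\<^esub>"
proof -
  have "d i x \<in> d i ` carrier (E i)" using assms by blast
  then have "d i x \<in> a_kernel (E (Suc i)) (E (Suc (Suc i))) (d (Suc i))"
    using res unfolding coresolution_def by metis
  then show ?thesis by (simp add: mem_a_kernel)
qed

lemma coresolution_aug_zero:
  assumes "module A M" "m \<in> carrier M" "\<epsilon> m = \<zero>\<^bsub>E 0\<^esub>"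
  shows "m = \<zero>\<^bsub>M\<^esub>"
proof -
  interpret M: module A M by fact
  have "inj_on \<epsilon> (carrier M)" using res by (simp add: coresolution_def)
  then show ?thesis
    using mhom_zero[OF assms(1) coresolution_module coresolution_aug] assms(2,3)
    by (metis inj_onD M.zero_closed)
qed

end

text \<open>A cochain map between two coresolutions of the same module that lifts the identity of
  that module.\<close>

definition coresolution_map ::
    "'a ring \<Rightarrow> ('a, 'm) module \<Rightarrow> ('m \<Rightarrow> 'e) \<Rightarrow> (nat \<Rightarrow> ('a, 'e) module) \<Rightarrow> (nat \<Rightarrow> 'e \<Rightarrow> 'e) \<Rightarrow>
     ('m \<Rightarrow> 'j) \<Rightarrow> (nat \<Rightarrow> ('a, 'j) module) \<Rightarrow> (nat \<Rightarrow> 'j \<Rightarrow> 'j) \<Rightarrow> (nat \<Rightarrow> 'e \<Rightarrow> 'j) \<Rightarrow> bool" where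
  "coresolution_map A M \<epsilon> E d \<eta> J \<delta> \<phi> \<longleftrightarrow> (\<forall>i. \<phi> i \<in> mhom A (E i) (J i)) \<and>
     (\<forall>m\<in>carrier M. \<phi> 0 (\<epsilon> m) = \<eta> m) \<and> (\<forall>i. \<forall>x\<in>carrier (E i). \<phi> (Suc i) (d i x) = \<delta> i (\<phi> i x))"

text \<open>Each component extends a map along the preceding differential, so the source has to be
  exact and the target has to satisfy Baer's criterion.\<close>

lemma coresolution_map_exists:
  assumes M: "module A M" and E: "coresolution A M \<epsilon> E d" and J: "coresolution A M \<eta> J \<delta>"
    and baer: "\<And>i. baer_module A (J i)"
  shows "\<exists>\<phi>. coresolution_map A M \<epsilon> E d \<eta> J \<delta> \<phi>"
proof -
  note mE = coresolution_module[OF E] and mJ = coresolution_module[OF J]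
  \<comment> \<open>The last clause is the invariant of the recursion: it is the kernel condition of
    \<open>baer_extension\<close> for the next component. The link between consecutive components is
    kept apart in \<open>Q\<close>.\<close>
  define P where "P n \<phi> \<longleftrightarrow> \<phi> \<in> mhom A (E n) (J n) \<and> (n = 0 \<longrightarrow> (\<forall>m\<in>carrier M. \<phi> (\<epsilon> m) = \<eta> m)) \<and>
    (\<forall>x\<in>carrier (E n). d n x = \<zero>\<^bsub>E (Suc n)\<^esub> \<longrightarrow> \<delta> n (\<phi> x) = \<zero>\<^bsub>J (Suc n)\<^esub>)" for n \<phi>
  define Q where "Q n \<phi> \<phi>' \<longleftrightarrow> (\<forall>x\<in>carrier (E n). \<phi>' (d n x) = \<delta> n (\<phi> x))" for n \<phi> \<phi>'
  have "\<exists>\<phi>. \<forall>n. P n (\<phi> n) \<and> Q n (\<phi> n) (\<phi> (Suc n))"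
  proof (rule dependent_nat_choice)
    have "\<eta> m = \<zero>\<^bsub>J 0\<^esub>" if "m \<in> carrier M" "\<epsilon> m = \<zero>\<^bsub>E 0\<^esub>" for m
      using coresolution_aug_zero[OF E M that] mhom_zero[OF M mJ coresolution_aug[OF J]] by simp
    then obtain \<phi> where \<phi>: "\<phi> \<in> mhom A (E 0) (J 0)" "\<forall>m\<in>carrier M. \<phi> (\<epsilon> m) = \<eta> m"
      using baer_extension[OF baer M mE coresolution_aug[OF E] coresolution_aug[OF J]] by blast
    have "\<delta> 0 (\<phi> x) = \<zero>\<^bsub>J (Suc 0)\<^esub>" if x: "x \<in> carrier (E 0)" "d 0 x = \<zero>\<^bsub>E (Suc 0)\<^esub>" for x
      using coresolution_exact_0[OF E x] \<phi>(2) coresolution_diff_aug[OF J] by auto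
    then show "\<exists>\<phi>. P 0 \<phi>" using \<phi> unfolding P_def by blast
  next
    fix \<phi> n assume "P n \<phi>"
    then have \<phi>: "\<phi> \<in> mhom A (E n) (J n)"
      and ker: "\<And>x. x \<in> carrier (E n) \<Longrightarrow> d n x = \<zero>\<^bsub>E (Suc n)\<^esub> \<Longrightarrow> \<delta> n (\<phi> x) = \<zero>\<^bsub>J (Suc n)\<^esub>"
      by (auto simp: P_def)
    have "\<exists>\<phi>'\<in>mhom A (E (Suc n)) (J (Suc n)). \<forall>x\<in>carrier (E n).
        \<phi>' (d n x) = compose (carrier (E n)) (\<delta> n) \<phi> x"
      by (rule baer_extension[OF baer mE mE coresolution_diff[OF E]
            mhom_compose_module[OF mE \<phi> coresolution_diff[OF J]]])
        (simp add: compose_def ker)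
    then obtain \<phi>' where \<phi>': "\<phi>' \<in> mhom A (E (Suc n)) (J (Suc n))"
      "\<And>x. x \<in> carrier (E n) \<Longrightarrow> \<phi>' (d n x) = \<delta> n (\<phi> x)"
      by (auto simp: compose_def)
    \<comment> \<open>By exactness \<open>x\<close> is a boundary, so \<open>\<phi>'\<close> sends
      it to a boundary, which the next differential kills.\<close>
    have "\<delta> (Suc n) (\<phi>' x) = \<zero>\<^bsub>J (Suc (Suc n))\<^esub>"
      if x: "x \<in> carrier (E (Suc n))" "d (Suc n) x = \<zero>\<^bsub>E (Suc (Suc n))\<^esub>" for x
      using coresolution_exact_Suc[OF E x] \<phi>'(2) coresolution_diff_diff[OF J mhom_closed[OF \<phi>]]
      by auto
    then show "\<exists>\<phi>'. P (Suc n) \<phi>' \<and> Q n \<phi> \<phi>'" using \<phi>' unfolding P_def Q_def by blast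
  qed
  then obtain \<phi> where \<phi>: "\<And>n. P n (\<phi> n)" "\<And>n. Q n (\<phi> n) (\<phi> (Suc n))" by blast
  then have "coresolution_map A M \<epsilon> E d \<eta> J \<delta> \<phi>"
    unfolding coresolution_map_def P_def Q_def by simp
  then show ?thesis by blast
qed

text \<open>The difference of the two maps lifts zero, so it can be contracted one degree at a time.
  The homotopy lowers degree: \<open>h i\<close> goes from \<open>E (Suc i)\<close> to
  \<open>J i\<close>, and in degree 0 only the term through \<open>d 0\<close> is present.\<close>

lemma coresolution_homotopy:
  assumes M: "module A M" and E: "coresolution A M \<epsilon> E d" and J: "coresolution A M \<eta> J \<delta>"
    and baer: "\<And>i. baer_module A (J i)"
    and f: "coresolution_map A M \<epsilon> E d \<eta> J \<delta> f" and g: "coresolution_map A M \<epsilon> E d \<eta> J \<delta> g"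
  shows "\<exists>h. (\<forall>i. h i \<in> mhom A (E (Suc i)) (J i)) \<and>
    (\<forall>x\<in>carrier (E 0). f 0 x \<ominus>\<^bsub>J 0\<^esub> g 0 x = h 0 (d 0 x)) \<and>
    (\<forall>i. \<forall>x\<in>carrier (E (Suc i)). f (Suc i) x \<ominus>\<^bsub>J (Suc i)\<^esub> g (Suc i) x =
       \<delta> i (h i x) \<oplus>\<^bsub>J (Suc i)\<^esub> h (Suc i) (d (Suc i) x))"
proof -
  note mE = coresolution_module[OF E] and mJ = coresolution_module[OF J]
  note dE = coresolution_diff[OF E] and dJ = coresolution_diff[OF J]
  interpret J: module A "J k" for k by (rule mJ)
  have fm: "f i \<in> mhom A (E i) (J i)" and gm: "g i \<in> mhom A (E i) (J i)" for i
    using f g by (auto simp: coresolution_map_def)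
  define \<theta> where "\<theta> i = (\<lambda>x\<in>carrier (E i). f i x \<ominus>\<^bsub>J i\<^esub> g i x)" for i
  have \<theta>: "\<theta> i \<in> mhom A (E i) (J i)" for i
    unfolding \<theta>_def by (rule mhom_diff[OF mE mJ fm gm])
  have \<theta>_aug: "\<theta> 0 (\<epsilon> m) = \<zero>\<^bsub>J 0\<^esub>" if "m \<in> carrier M" for m
    using that f g mhom_closed[OF coresolution_aug[OF E] that] mhom_closed[OF coresolution_aug[OF J] that]
    by (simp add: \<theta>_def coresolution_map_def J.minus_eq J.r_neg)
  have \<theta>_diff: "\<theta> (Suc i) (d i x) = \<delta> i (\<theta> i x)" if "x \<in> carrier (E i)" for i x
    using that f g mhom_closed[OF dE that]
      mhom_minus[OF mJ mJ dJ mhom_closed[OF fm that] mhom_closed[OF gm that]]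
    by (simp add: \<theta>_def coresolution_map_def)
  \<comment> \<open>The last clause says that what remains of \<open>\<theta>\<close> after
    subtracting the part already explained by \<open>h\<close> vanishes on cocycles, hence factors
    through the next differential.\<close>
  define P where "P n h \<longleftrightarrow> h \<in> mhom A (E (Suc n)) (J n) \<and>
      (n = 0 \<longrightarrow> (\<forall>x\<in>carrier (E 0). \<theta> 0 x = h (d 0 x))) \<and>
      (\<forall>x\<in>carrier (E (Suc n)). d (Suc n) x = \<zero>\<^bsub>E (Suc (Suc n))\<^esub> \<longrightarrow> \<theta> (Suc n) x = \<delta> n (h x))" for n h
  define Q where "Q n h h' \<longleftrightarrow>
      (\<forall>x\<in>carrier (E (Suc n)). \<theta> (Suc n) x \<ominus>\<^bsub>J (Suc n)\<^esub> \<delta> n (h x) = h' (d (Suc n) x))" for n h h'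
  have "\<exists>h. \<forall>n. P n (h n) \<and> Q n (h n) (h (Suc n))"
  proof (rule dependent_nat_choice)
    have "\<exists>h\<in>mhom A (E (Suc 0)) (J 0). \<forall>x\<in>carrier (E 0). h (d 0 x) = \<theta> 0 x"
      by (rule baer_extension[OF baer mE mE dE \<theta>])
        (use coresolution_exact_0[OF E] \<theta>_aug in blast)
    then obtain h where h: "h \<in> mhom A (E (Suc 0)) (J 0)" "\<And>x. x \<in> carrier (E 0) \<Longrightarrow> h (d 0 x) = \<theta> 0 x"
      by blast
    have "\<theta> (Suc 0) x = \<delta> 0 (h x)"
      if x: "x \<in> carrier (E (Suc 0))" "d (Suc 0) x = \<zero>\<^bsub>E (Suc (Suc 0))\<^esub>" for x
      using coresolution_exact_Suc[OF E x] \<theta>_diff h(2) by auto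
    then have "P 0 h" using h unfolding P_def by simp
    then show "\<exists>h. P 0 h" by blast
  next
    fix h n assume "P n h"
    then have h: "h \<in> mhom A (E (Suc n)) (J n)"
      and ker: "\<And>x. x \<in> carrier (E (Suc n)) \<Longrightarrow> d (Suc n) x = \<zero>\<^bsub>E (Suc (Suc n))\<^esub> \<Longrightarrow> \<theta> (Suc n) x = \<delta> n (h x)"
      by (auto simp: P_def)
    \<comment> \<open>The defect in degree \<open>Suc n\<close>; the next homotopy component is its
      extension along \<open>d (Suc n)\<close>.\<close>
    define k where "k = (\<lambda>x\<in>carrier (E (Suc n)). \<theta> (Suc n) x \<ominus>\<^bsub>J (Suc n)\<^esub> compose (carrier (E (Suc n))) (\<delta> n) h x)"
    have k: "k \<in> mhom A (E (Suc n)) (J (Suc n))"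
      unfolding k_def by (rule mhom_diff[OF mE mJ \<theta> mhom_compose_module[OF mE h dJ]])
    have k_eq: "k x = \<theta> (Suc n) x \<ominus>\<^bsub>J (Suc n)\<^esub> \<delta> n (h x)" if "x \<in> carrier (E (Suc n))" for x
      using that by (simp add: k_def compose_def)
    have cl: "\<delta> n (h x) \<in> carrier (J (Suc n))" if "x \<in> carrier (E (Suc n))" for x
      using mhom_closed[OF dJ mhom_closed[OF h that]] .
    have "\<exists>h'\<in>mhom A (E (Suc (Suc n))) (J (Suc n)). \<forall>x\<in>carrier (E (Suc n)). h' (d (Suc n) x) = k x"
      by (rule baer_extension[OF baer mE mE dE k]) (simp add: k_eq ker cl J.minus_eq J.r_neg)
    then obtain h' where h': "h' \<in> mhom A (E (Suc (Suc n))) (J (Suc n))"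
      "\<And>x. x \<in> carrier (E (Suc n)) \<Longrightarrow> h' (d (Suc n) x) = k x" by blast
    \<comment> \<open>On a boundary of \<open>x\<close>, applying the differential to the defect of
      \<open>x\<close> loses the term with \<open>\<delta> n (h x)\<close>, since two consecutive
      differentials compose to zero.\<close>
    have "\<theta> (Suc (Suc n)) z = \<delta> (Suc n) (h' z)"
      if z: "z \<in> carrier (E (Suc (Suc n)))" "d (Suc (Suc n)) z = \<zero>\<^bsub>E (Suc (Suc (Suc n)))\<^esub>" for z
    proof -
      obtain x where x: "x \<in> carrier (E (Suc n))" "z = d (Suc n) x"
        using coresolution_exact_Suc[OF E z] by blast
      have "\<delta> (Suc n) (h' z) = \<delta> (Suc n) (\<theta> (Suc n) x) \<ominus>\<^bsub>J (Suc (Suc n))\<^esub> \<delta> (Suc n) (\<delta> n (h x))"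
        using x h'(2) k_eq mhom_minus[OF mJ mJ dJ mhom_closed[OF \<theta> x(1)] cl[OF x(1)]] by simp
      also have "\<dots> = \<delta> (Suc n) (\<theta> (Suc n) x)"
        using coresolution_diff_diff[OF J mhom_closed[OF h x(1)]] mhom_closed[OF dJ mhom_closed[OF \<theta> x(1)]]
        by (simp add: J.minus_eq)
      finally show ?thesis using \<theta>_diff x by simp
    qed
    then have "P (Suc n) h'" using h' unfolding P_def by simp
    moreover have "Q n h h'" using h'(2) k_eq by (simp add: Q_def)
    ultimately show "\<exists>h'. P (Suc n) h' \<and> Q n h h'" by blast
  qed
  then obtain h where h: "\<And>n. P n (h n)" "\<And>n. Q n (h n) (h (Suc n))" by blast
  have hm: "h i \<in> mhom A (E (Suc i)) (J i)" for i using h(1) by (simp add: P_def)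
  have "f (Suc i) x \<ominus>\<^bsub>J (Suc i)\<^esub> g (Suc i) x = \<delta> i (h i x) \<oplus>\<^bsub>J (Suc i)\<^esub> h (Suc i) (d (Suc i) x)"
    if x: "x \<in> carrier (E (Suc i))" for i x
  proof -
    have "h (Suc i) (d (Suc i) x) = \<theta> (Suc i) x \<ominus>\<^bsub>J (Suc i)\<^esub> \<delta> i (h i x)"
      using h(2)[of i] x by (simp add: Q_def)
    then have "\<delta> i (h i x) \<oplus>\<^bsub>J (Suc i)\<^esub> h (Suc i) (d (Suc i) x) = \<theta> (Suc i) x"
      using mhom_closed[OF \<theta> x] mhom_closed[OF dJ mhom_closed[OF hm x]]
      by (simp add: J.minus_eq J.a_lcomm J.r_neg)
    then show ?thesis using x by (simp add: \<theta>_def)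
  qed
  moreover have "f 0 x \<ominus>\<^bsub>J 0\<^esub> g 0 x = h 0 (d 0 x)" if "x \<in> carrier (E 0)" for x
    using h(1)[of 0] that by (simp add: P_def \<theta>_def)
  ultimately show ?thesis using hm by blast
qed

section \<open>Cohomology of the subcomplex of elements annihilated by an ideal\<close>

text \<open>\<open>I\<close> may be any set of scalars. The same notion then applies to an ideal of
  R_0, to this ideal regarded as a subset of R, and to the ideal it generates in R.\<close>

definition annihilated :: "'a set \<Rightarrow> ('a, 'm) module \<Rightarrow> 'm set" where
  "annihilated I V = {x \<in> carrier V. \<forall>a\<in>I. a \<odot>\<^bsub>V\<^esub> x = \<zero>\<^bsub>V\<^esub>}"

lemma annihilated_minus:
  assumes "module A V" "I \<subseteq> carrier A" "x \<in> annihilated I V" "y \<in> annihilated I V"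
  shows "x \<ominus>\<^bsub>V\<^esub> y \<in> annihilated I V"
proof -
  interpret V: module A V by fact
  show ?thesis using assms
    by (auto simp: annihilated_def V.minus_eq V.smult_r_distr V.smult_r_minus subset_eq)
qed

lemma mhom_annihilated:
  assumes "module A V" "module A U" "f \<in> mhom A V U" "I \<subseteq> carrier A" "x \<in> annihilated I V"
  shows "f x \<in> annihilated I U"
proof -
  have "a \<odot>\<^bsub>U\<^esub> f x = \<zero>\<^bsub>U\<^esub>" if "a \<in> I" for a
    using assms that mhom_smult[OF assms(3), of a x] mhom_zero[OF assms(1-3)]
    by (auto simp: annihilated_def)
  then show ?thesis using assms mhom_closed[OF assms(3)] by (auto simp: annihilated_def)
qed

text \<open>Boundaries of annihilated elements, which can be fewer than the annihilated boundaries: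
  a coboundary of the Hom complex must come from a homomorphism one degree below. In degree 0 there
  is nothing below, so only zero remains.\<close>

definition annihilated_boundaries ::
    "'a set \<Rightarrow> (nat \<Rightarrow> ('a, 'e) module) \<Rightarrow> (nat \<Rightarrow> 'e \<Rightarrow> 'e) \<Rightarrow> nat \<Rightarrow> 'e set" where
  "annihilated_boundaries I E d i =
     (case i of 0 \<Rightarrow> {\<zero>\<^bsub>E 0\<^esub>} | Suc j \<Rightarrow> d j ` annihilated I (E j))"

lemma coresolution_map_boundaries:
  assumes "coresolution A M \<epsilon> E d" "coresolution A M \<eta> J \<delta>" "coresolution_map A M \<epsilon> E d \<eta> J \<delta> f"
    and "I \<subseteq> carrier A" "x \<in> annihilated_boundaries I E d i"
  shows "f i x \<in> annihilated_boundaries I J \<delta> i"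
proof (cases i)
  case 0
  then show ?thesis
    using assms mhom_zero[OF coresolution_module[OF assms(1)] coresolution_module[OF assms(2)], of "f 0"]
    by (simp add: annihilated_boundaries_def coresolution_map_def)
next
  case (Suc j)
  then obtain z where z: "z \<in> annihilated I (E j)" "x = d j z"
    using assms(5) by (auto simp: annihilated_boundaries_def)
  have fj: "f j \<in> mhom A (E j) (J j)" using assms(3) by (simp add: coresolution_map_def)
  have "f (Suc j) x = \<delta> j (f j z)"
    using z assms(3) by (auto simp: coresolution_map_def annihilated_def)
  then show ?thesis
    using mhom_annihilated[OF coresolution_module[OF assms(1)] coresolution_module[OF assms(2)] fj assms(4) z(1)]
    by (auto simp: annihilated_boundaries_def Suc)
qed

text \<open>The homotopy is linear, so it maps annihilated elements to annihilated elements and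
  restricts to the subcomplexes. Its term through \<open>d i\<close> vanishes on a cocycle.\<close>

lemma coresolution_map_homotopic_boundaries:
  assumes M: "module A M" and E: "coresolution A M \<epsilon> E d" and J: "coresolution A M \<eta> J \<delta>"
    and baer: "\<And>i. baer_module A (J i)"
    and f: "coresolution_map A M \<epsilon> E d \<eta> J \<delta> f" and g: "coresolution_map A M \<epsilon> E d \<eta> J \<delta> g"
    and I: "I \<subseteq> carrier A" and x: "x \<in> annihilated I (E i)" "d i x = \<zero>\<^bsub>E (Suc i)\<^esub>"
  shows "f i x \<ominus>\<^bsub>J i\<^esub> g i x \<in> annihilated_boundaries I J \<delta> i"
proof -
  note mE = coresolution_module[OF E] and mJ = coresolution_module[OF J]
  interpret J: module A "J k" for k by (rule mJ)
  obtain h where h: "\<And>i. h i \<in> mhom A (E (Suc i)) (J i)"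
    "\<And>x. x \<in> carrier (E 0) \<Longrightarrow> f 0 x \<ominus>\<^bsub>J 0\<^esub> g 0 x = h 0 (d 0 x)"
    "\<And>i x. x \<in> carrier (E (Suc i)) \<Longrightarrow> f (Suc i) x \<ominus>\<^bsub>J (Suc i)\<^esub> g (Suc i) x =
       \<delta> i (h i x) \<oplus>\<^bsub>J (Suc i)\<^esub> h (Suc i) (d (Suc i) x)"
    using coresolution_homotopy[OF M E J baer f g] by blast
  have xE: "x \<in> carrier (E i)" using x(1) unfolding annihilated_def by blast
  have h0: "h i (d i x) = \<zero>\<^bsub>J i\<^esub>" using x mhom_zero[OF mE mJ h(1)] by simp
  show ?thesis
  proof (cases i)
    case 0
    then show ?thesis using h(2) h0 xE by (simp add: annihilated_boundaries_def)
  next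
    case (Suc j)
    then have "h j x \<in> annihilated I (J j)"
      using mhom_annihilated[OF mE mJ h(1) I] x by simp
    moreover have "f (Suc j) x \<ominus>\<^bsub>J (Suc j)\<^esub> g (Suc j) x = \<delta> j (h j x)"
      using h(3)[of x j] h0 xE Suc mhom_closed[OF coresolution_diff[OF J] mhom_closed[OF h(1)], of x j]
      by simp
    ultimately show ?thesis by (simp add: annihilated_boundaries_def Suc)
  qed
qed

lemma annihilated_boundaries_minus:
  assumes E: "coresolution A M \<epsilon> E d" and I: "I \<subseteq> carrier A"
    and "x \<in> annihilated_boundaries I E d i" "y \<in> annihilated_boundaries I E d i"
  shows "x \<ominus>\<^bsub>E i\<^esub> y \<in> annihilated_boundaries I E d i"
proof -
  note mE = coresolution_module[OF E]
  interpret E: module A "E k" for k by (rule mE)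
  show ?thesis
  proof (cases i)
    case 0
    then have "x = \<zero>\<^bsub>E 0\<^esub>" "y = \<zero>\<^bsub>E 0\<^esub>"
      using assms(3,4) by (auto simp: annihilated_boundaries_def)
    then show ?thesis using 0 by (simp add: annihilated_boundaries_def E.minus_eq)
  next
    case (Suc j)
    then obtain u v where uv: "u \<in> annihilated I (E j)" "x = d j u" "v \<in> annihilated I (E j)" "y = d j v"
      using assms(3,4) by (auto simp: annihilated_boundaries_def)
    have "d j (u \<ominus>\<^bsub>E j\<^esub> v) = x \<ominus>\<^bsub>E i\<^esub> y"
      using mhom_minus[OF mE mE coresolution_diff[OF E], of u j v] uv Suc
      by (simp add: annihilated_def)
    then show ?thesis
      using annihilated_minus[OF mE I uv(1,3)] Suc by (force simp: annihilated_boundaries_def)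
  qed
qed

text \<open>The complex of elements annihilated by \<open>I\<close> is \<open>Hom\<^sub>A(A/I, E)\<close>, so this says that its
  cohomology does not depend on the coresolution.\<close>

lemma annihilated_cohomology_comparison:
  assumes M: "module A M" and E: "coresolution A M \<epsilon> E d" and J: "coresolution A M \<eta> J \<delta>"
    and bE: "\<And>i. baer_module A (E i)" and bJ: "\<And>i. baer_module A (J i)" and I: "I \<subseteq> carrier A"
  obtains \<phi> where "\<phi> \<in> mhom A (E i) (J i)"
    "\<And>x. x \<in> annihilated I (E i) \<Longrightarrow> d i x = \<zero>\<^bsub>E (Suc i)\<^esub> \<Longrightarrow> \<delta> i (\<phi> x) = \<zero>\<^bsub>J (Suc i)\<^esub>"
    "\<And>x. x \<in> annihilated I (E i) \<Longrightarrow> d i x = \<zero>\<^bsub>E (Suc i)\<^esub> \<Longrightarrow>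
       \<phi> x \<in> annihilated_boundaries I J \<delta> i \<longleftrightarrow> x \<in> annihilated_boundaries I E d i"
    "\<And>y. y \<in> annihilated I (J i) \<Longrightarrow> \<delta> i y = \<zero>\<^bsub>J (Suc i)\<^esub> \<Longrightarrow>
       \<exists>x\<in>annihilated I (E i). d i x = \<zero>\<^bsub>E (Suc i)\<^esub> \<and> \<phi> x \<ominus>\<^bsub>J i\<^esub> y \<in> annihilated_boundaries I J \<delta> i"
proof -
  note mE = coresolution_module[OF E] and mJ = coresolution_module[OF J]
  interpret E: module A "E k" for k by (rule mE)
  interpret J: module A "J k" for k by (rule mJ)
  obtain \<phi> where \<phi>: "coresolution_map A M \<epsilon> E d \<eta> J \<delta> \<phi>"
    using coresolution_map_exists[OF M E J bJ] by blast
  obtain \<psi> where \<psi>: "coresolution_map A M \<eta> J \<delta> \<epsilon> E d \<psi>"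
    using coresolution_map_exists[OF M J E bE] by blast
  have \<phi>m: "\<phi> i \<in> mhom A (E i) (J i)" and \<psi>m: "\<psi> i \<in> mhom A (J i) (E i)" for i
    using \<phi> \<psi> by (auto simp: coresolution_map_def)
  have \<phi>d: "\<phi> (Suc i) (d i x) = \<delta> i (\<phi> i x)" if "x \<in> carrier (E i)" for i x
    using \<phi> that by (simp add: coresolution_map_def)
  have \<psi>d: "\<psi> (Suc i) (\<delta> i x) = d i (\<psi> i x)" if "x \<in> carrier (J i)" for i x
    using \<psi> that by (simp add: coresolution_map_def)
  \<comment> \<open>The identity must be written as a restricted function, because homomorphisms are
    \<open>undefined\<close> outside the carrier.\<close>
  have idE: "coresolution_map A M \<epsilon> E d \<epsilon> E d (\<lambda>i. \<lambda>x\<in>carrier (E i). x)"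
    using mhom_closed[OF coresolution_aug[OF E]] mhom_closed[OF coresolution_diff[OF E]]
    by (simp add: coresolution_map_def mhom_id mE)
  have idJ: "coresolution_map A M \<eta> J \<delta> \<eta> J \<delta> (\<lambda>i. \<lambda>x\<in>carrier (J i). x)"
    using mhom_closed[OF coresolution_aug[OF J]] mhom_closed[OF coresolution_diff[OF J]]
    by (simp add: coresolution_map_def mhom_id mJ)
  have \<psi>\<phi>: "coresolution_map A M \<epsilon> E d \<epsilon> E d (\<lambda>i. compose (carrier (E i)) (\<psi> i) (\<phi> i))"
    using \<phi> \<psi> mhom_closed[OF coresolution_aug[OF E]] mhom_closed[OF coresolution_diff[OF E]]
      mhom_closed[OF \<phi>m]
    by (simp add: coresolution_map_def mhom_compose_module[OF mE \<phi>m \<psi>m] compose_eq)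
  have \<phi>\<psi>: "coresolution_map A M \<eta> J \<delta> \<eta> J \<delta> (\<lambda>i. compose (carrier (J i)) (\<phi> i) (\<psi> i))"
    using \<phi> \<psi> mhom_closed[OF coresolution_aug[OF J]] mhom_closed[OF coresolution_diff[OF J]]
      mhom_closed[OF \<psi>m]
    by (simp add: coresolution_map_def mhom_compose_module[OF mJ \<psi>m \<phi>m] compose_eq)
  have cocycle: "\<delta> i (\<phi> i x) = \<zero>\<^bsub>J (Suc i)\<^esub>" if "x \<in> carrier (E i)" "d i x = \<zero>\<^bsub>E (Suc i)\<^esub>" for x
    using \<phi>d[OF that(1)] that(2) mhom_zero[OF mE mJ \<phi>m] by simp
  \<comment> \<open>\<open>x\<close> is the difference of \<open>\<psi> i (\<phi> i x)\<close>, a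
    boundary because \<open>\<psi>\<close> is a cochain map, and of the deviation of this element
    from \<open>x\<close>, a boundary because the composite is homotopic to the identity.\<close>
  have reflect: "x \<in> annihilated_boundaries I E d i"
    if x: "x \<in> annihilated I (E i)" "d i x = \<zero>\<^bsub>E (Suc i)\<^esub>" and b: "\<phi> i x \<in> annihilated_boundaries I J \<delta> i" for x
  proof -
    have xE: "x \<in> carrier (E i)" using x by (simp add: annihilated_def)
    note cl = mhom_closed[OF \<psi>m mhom_closed[OF \<phi>m xE]]
    have "\<psi> i (\<phi> i x) \<in> annihilated_boundaries I E d i"
      by (rule coresolution_map_boundaries[OF J E \<psi> I b])
    moreover have "\<psi> i (\<phi> i x) \<ominus>\<^bsub>E i\<^esub> x \<in> annihilated_boundaries I E d i"
      using coresolution_map_homotopic_boundaries[OF M E E bE \<psi>\<phi> idE I x] xE by (simp add: compose_def)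
    ultimately have "\<psi> i (\<phi> i x) \<ominus>\<^bsub>E i\<^esub> (\<psi> i (\<phi> i x) \<ominus>\<^bsub>E i\<^esub> x) \<in> annihilated_boundaries I E d i"
      by (rule annihilated_boundaries_minus[OF E I])
    also have "\<psi> i (\<phi> i x) \<ominus>\<^bsub>E i\<^esub> (\<psi> i (\<phi> i x) \<ominus>\<^bsub>E i\<^esub> x) = x"
      using cl xE by (simp add: E.minus_eq E.minus_add E.a_assoc[symmetric] E.r_neg)
    finally show ?thesis .
  qed
  \<comment> \<open>The class of \<open>y\<close> is hit by that of \<open>\<psi> i y\<close>, by
    the homotopy on the side of \<open>J\<close>.\<close>
  have surj: "\<exists>x\<in>annihilated I (E i). d i x = \<zero>\<^bsub>E (Suc i)\<^esub> \<and> \<phi> i x \<ominus>\<^bsub>J i\<^esub> y \<in> annihilated_boundaries I J \<delta> i"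
    if y: "y \<in> annihilated I (J i)" "\<delta> i y = \<zero>\<^bsub>J (Suc i)\<^esub>" for y
  proof (intro bexI conjI)
    have yJ: "y \<in> carrier (J i)" using y by (simp add: annihilated_def)
    show "\<psi> i y \<in> annihilated I (E i)" by (rule mhom_annihilated[OF mJ mE \<psi>m I y(1)])
    show "d i (\<psi> i y) = \<zero>\<^bsub>E (Suc i)\<^esub>" using \<psi>d[OF yJ] y(2) mhom_zero[OF mJ mE \<psi>m] by simp
    show "\<phi> i (\<psi> i y) \<ominus>\<^bsub>J i\<^esub> y \<in> annihilated_boundaries I J \<delta> i"
      using coresolution_map_homotopic_boundaries[OF M J J bJ \<phi>\<psi> idJ I y] yJ by (simp add: compose_def)
  qed
  show thesis
  proof (rule that[OF \<phi>m[of i]])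
    fix x assume x: "x \<in> annihilated I (E i)" "d i x = \<zero>\<^bsub>E (Suc i)\<^esub>"
    then show "\<delta> i (\<phi> i x) = \<zero>\<^bsub>J (Suc i)\<^esub>" using cocycle by (simp add: annihilated_def)
    show "\<phi> i x \<in> annihilated_boundaries I J \<delta> i \<longleftrightarrow> x \<in> annihilated_boundaries I E d i"
      using reflect[OF x] coresolution_map_boundaries[OF E J \<phi> I] by blast
  qed (rule surj)
qed

section \<open>Homogeneous components\<close>

text \<open>The projection to the summand of index \<open>k\<close>. The index type is arbitrary
  because rings are graded by natural numbers and modules by integers.\<close>

definition hom_component :: "('m, 'z) ring_scheme \<Rightarrow> ('k \<Rightarrow> 'm set) \<Rightarrow> 'k \<Rightarrow> 'm \<Rightarrow> 'm" where
  "hom_component M g k x = (THE c. (\<forall>k. c k \<in> g k) \<and> finite {k. c k \<noteq> \<zero>\<^bsub>M\<^esub>} \<and>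
     x = (\<Oplus>\<^bsub>M\<^esub>k \<in> {k. c k \<noteq> \<zero>\<^bsub>M\<^esub>}. c k)) k"

text \<open>A sum over an infinite index set is zero by convention, and the condition that
  \<open>h\<close> preserves zero covers this case.\<close>

lemma finsum_hom:
  assumes "abelian_group M" "abelian_group N" "h \<in> carrier M \<rightarrow> carrier N" "h \<zero>\<^bsub>M\<^esub> = \<zero>\<^bsub>N\<^esub>"
    and add: "\<And>x y. x \<in> carrier M \<Longrightarrow> y \<in> carrier M \<Longrightarrow> h (x \<oplus>\<^bsub>M\<^esub> y) = h x \<oplus>\<^bsub>N\<^esub> h y"
    and "f \<in> S \<rightarrow> carrier M"
  shows "h (\<Oplus>\<^bsub>M\<^esub>k\<in>S. f k) = (\<Oplus>\<^bsub>N\<^esub>k\<in>S. h (f k))"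
proof -
  interpret M: abelian_group M by fact
  interpret N: abelian_group N by fact
  show ?thesis using assms(6)
  proof (induction S rule: infinite_finite_induct)
    case (insert x F)
    then have "f x \<in> carrier M" "f \<in> F \<rightarrow> carrier M" by auto
    moreover have "h (f x) \<in> carrier N" "(\<lambda>k. h (f k)) \<in> F \<rightarrow> carrier N"
      using calculation assms(3) by auto
    ultimately show ?case
      using insert by (simp add: M.finsum_insert N.finsum_insert add)
  qed (use assms in \<open>auto simp: M.finsum_infinite N.finsum_infinite\<close>)
qed

context
  fixes M :: "('m, 'z) ring_scheme" and g :: "'k \<Rightarrow> 'm set"
  assumes grp: "abelian_group M" and dec: "direct_sum_dec M g"
begin

interpretation M: abelian_group M by (rule grp)

lemma hom_part_subgroup: "subgroup (g k) (add_monoid M)"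
  using dec by (simp add: direct_sum_dec_def)

lemma hom_part_carrier: "x \<in> g k \<Longrightarrow> x \<in> carrier M"
  using subgroup.subset[OF hom_part_subgroup, of k] by auto

lemma hom_part_zero: "\<zero>\<^bsub>M\<^esub> \<in> g k"
  using subgroup.one_closed[OF hom_part_subgroup, of k] by simp

lemma hom_part_add: "x \<in> g k \<Longrightarrow> y \<in> g k \<Longrightarrow> x \<oplus>\<^bsub>M\<^esub> y \<in> g k"
  using subgroup.m_closed[OF hom_part_subgroup, of x k y] by simp

lemma hom_part_neg: "x \<in> g k \<Longrightarrow> \<ominus>\<^bsub>M\<^esub> x \<in> g k"
  using subgroup.m_inv_closed[OF hom_part_subgroup, of x k] by (simp add: a_inv_def)

lemma hom_component_props:
  assumes "x \<in> carrier M"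
  shows "hom_component M g k x \<in> g k" "finite {k. hom_component M g k x \<noteq> \<zero>\<^bsub>M\<^esub>}"
    "x = (\<Oplus>\<^bsub>M\<^esub>k \<in> {k. hom_component M g k x \<noteq> \<zero>\<^bsub>M\<^esub>}. hom_component M g k x)"
proof -
  define c where "c = (THE c. (\<forall>k. c k \<in> g k) \<and> finite {k. c k \<noteq> \<zero>\<^bsub>M\<^esub>} \<and>
     x = (\<Oplus>\<^bsub>M\<^esub>k \<in> {k. c k \<noteq> \<zero>\<^bsub>M\<^esub>}. c k))"
  have ex1: "\<exists>!c. (\<forall>k. c k \<in> g k) \<and> finite {k. c k \<noteq> \<zero>\<^bsub>M\<^esub>} \<and>
     x = (\<Oplus>\<^bsub>M\<^esub>k \<in> {k. c k \<noteq> \<zero>\<^bsub>M\<^esub>}. c k)"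
    using dec assms unfolding direct_sum_dec_def by blast
  have c: "(\<forall>k. c k \<in> g k) \<and> finite {k. c k \<noteq> \<zero>\<^bsub>M\<^esub>} \<and>
     x = (\<Oplus>\<^bsub>M\<^esub>k \<in> {k. c k \<noteq> \<zero>\<^bsub>M\<^esub>}. c k)"
    unfolding c_def by (rule theI'[OF ex1])
  have h: "hom_component M g k x = c k" for k by (simp add: hom_component_def c_def)
  show "hom_component M g k x \<in> g k" "finite {k. hom_component M g k x \<noteq> \<zero>\<^bsub>M\<^esub>}"
    "x = (\<Oplus>\<^bsub>M\<^esub>k \<in> {k. hom_component M g k x \<noteq> \<zero>\<^bsub>M\<^esub>}. hom_component M g k x)"
    unfolding h using c by auto
qed

text \<open>Projections are computed from any finite decomposition; \<open>S\<close> may be larger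
  than the support, so that decompositions of several elements can be taken over a common index
  set.\<close>

lemma hom_component_eqI:
  assumes S: "finite S" and c: "\<And>k. c k \<in> g k" and out: "\<And>k. k \<notin> S \<Longrightarrow> c k = \<zero>\<^bsub>M\<^esub>"
    and x: "x = (\<Oplus>\<^bsub>M\<^esub>k\<in>S. c k)"
  shows "hom_component M g k x = c k"
proof -
  have cM: "c k \<in> carrier M" for k using c hom_part_carrier by blast
  have sub: "{k. c k \<noteq> \<zero>\<^bsub>M\<^esub>} \<subseteq> S" using out by auto
  have sum: "x = (\<Oplus>\<^bsub>M\<^esub>k \<in> {k. c k \<noteq> \<zero>\<^bsub>M\<^esub>}. c k)"
    unfolding x by (rule M.add.finprod_mono_neutral_cong_right) (use S sub cM in auto)
  then have xM: "x \<in> carrier M" using cM by (auto intro: M.finsum_closed)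
  have ex1: "\<exists>!c. (\<forall>k. c k \<in> g k) \<and> finite {k. c k \<noteq> \<zero>\<^bsub>M\<^esub>} \<and>
     x = (\<Oplus>\<^bsub>M\<^esub>k \<in> {k. c k \<noteq> \<zero>\<^bsub>M\<^esub>}. c k)"
    using dec xM unfolding direct_sum_dec_def by blast
  have "(THE c. (\<forall>k. c k \<in> g k) \<and> finite {k. c k \<noteq> \<zero>\<^bsub>M\<^esub>} \<and>
     x = (\<Oplus>\<^bsub>M\<^esub>k \<in> {k. c k \<noteq> \<zero>\<^bsub>M\<^esub>}. c k)) = c"
    by (rule the1_equality[OF ex1]) (use c sum finite_subset[OF sub S] in auto)
  then show ?thesis by (simp add: hom_component_def)
qed

lemma hom_component_homogeneous:
  assumes "x \<in> g k" shows "hom_component M g j x = (if j = k then x else \<zero>\<^bsub>M\<^esub>)"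
  by (rule hom_component_eqI[of "{k}"])
    (use assms hom_part_carrier[OF assms] hom_part_zero in \<open>auto simp: M.finsum_insert\<close>)

lemma hom_component_add:
  assumes "x \<in> carrier M" "y \<in> carrier M"
  shows "hom_component M g k (x \<oplus>\<^bsub>M\<^esub> y) = hom_component M g k x \<oplus>\<^bsub>M\<^esub> hom_component M g k y"
proof -
  let ?c = "\<lambda>x k. hom_component M g k x"
  let ?S = "\<lambda>x. {k. ?c x k \<noteq> \<zero>\<^bsub>M\<^esub>}"
  have cM: "?c x k \<in> carrier M" if "x \<in> carrier M" for x k
    using hom_component_props(1)[OF that] hom_part_carrier by blast
  have sum: "z = (\<Oplus>\<^bsub>M\<^esub>k\<in>?S x \<union> ?S y. ?c z k)" if "z = x \<or> z = y" for z
  proof -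
    have z: "z \<in> carrier M" using that assms by auto
    have "(\<Oplus>\<^bsub>M\<^esub>k\<in>?S z. ?c z k) = (\<Oplus>\<^bsub>M\<^esub>k\<in>?S x \<union> ?S y. ?c z k)"
      by (rule M.add.finprod_mono_neutral_cong_left)
        (use hom_component_props(2) assms cM[OF z] that in auto)
    then show ?thesis using hom_component_props(3)[OF z] by simp
  qed
  show ?thesis
  proof (rule hom_component_eqI[of "?S x \<union> ?S y"])
    have "x \<oplus>\<^bsub>M\<^esub> y = (\<Oplus>\<^bsub>M\<^esub>k\<in>?S x \<union> ?S y. ?c x k) \<oplus>\<^bsub>M\<^esub> (\<Oplus>\<^bsub>M\<^esub>k\<in>?S x \<union> ?S y. ?c y k)"
      using sum[of x] sum[of y] by simp
    also have "\<dots> = (\<Oplus>\<^bsub>M\<^esub>k\<in>?S x \<union> ?S y. ?c x k \<oplus>\<^bsub>M\<^esub> ?c y k)"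
      by (rule M.finsum_addf[symmetric]) (use cM assms in auto)
    finally show "x \<oplus>\<^bsub>M\<^esub> y = (\<Oplus>\<^bsub>M\<^esub>k\<in>?S x \<union> ?S y. ?c x k \<oplus>\<^bsub>M\<^esub> ?c y k)" .
  qed (use assms hom_component_props hom_part_add in auto)
qed

end

text \<open>The image of the decomposition of \<open>x\<close> is a decomposition of
  \<open>h x\<close>. Only additivity and preservation of degrees are used, so that the lemma
  applies to homogeneous homomorphisms, to multiplication by a scalar of degree 0 and to
  negation.\<close>

lemma hom_component_map:
  assumes M: "abelian_group M" "direct_sum_dec M g" and N: "abelian_group N" "direct_sum_dec N g'"
    and h: "h \<in> carrier M \<rightarrow> carrier N" "h \<zero>\<^bsub>M\<^esub> = \<zero>\<^bsub>N\<^esub>"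
    and add: "\<And>x y. x \<in> carrier M \<Longrightarrow> y \<in> carrier M \<Longrightarrow> h (x \<oplus>\<^bsub>M\<^esub> y) = h x \<oplus>\<^bsub>N\<^esub> h y"
    and hom: "\<And>k x. x \<in> g k \<Longrightarrow> h x \<in> g' k"
    and x: "x \<in> carrier M"
  shows "hom_component N g' k (h x) = h (hom_component M g k x)"
proof (rule hom_component_eqI[OF N])
  let ?S = "{k. hom_component M g k x \<noteq> \<zero>\<^bsub>M\<^esub>}"
  note p = hom_component_props[OF M x]
  show "finite ?S" by (rule p(2))
  show "h (hom_component M g k x) \<in> g' k" for k using hom p(1) by blast
  show "h (hom_component M g k x) = \<zero>\<^bsub>N\<^esub>" if "k \<notin> ?S" for k using that h(2) by simp
  have "h (\<Oplus>\<^bsub>M\<^esub>k\<in>?S. hom_component M g k x) = (\<Oplus>\<^bsub>N\<^esub>k\<in>?S. h (hom_component M g k x))"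
    by (rule finsum_hom[OF M(1) N(1) h add]) (use p(1) hom_part_carrier[OF M] in blast)+
  then show "h x = (\<Oplus>\<^bsub>N\<^esub>k\<in>?S. h (hom_component M g k x))" using p(3) by simp
qed

lemma hom_component_neg:
  assumes M: "abelian_group M" "direct_sum_dec M g" and x: "x \<in> carrier M"
  shows "hom_component M g k (\<ominus>\<^bsub>M\<^esub> x) = \<ominus>\<^bsub>M\<^esub> hom_component M g k x"
proof -
  interpret M: abelian_group M by fact
  show ?thesis
    by (rule hom_component_map[OF M M _ _ _ _ x])
      (auto simp: M.minus_add hom_part_neg[OF M])
qed

text \<open>This covers both shifts of a grading and the grading induced on a graded subgroup.\<close>

lemma direct_sum_dec_transfer:
  assumes M: "abelian_group M" "direct_sum_dec M g" and N: "abelian_group N"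
    and sub: "carrier N \<subseteq> carrier M"
    and add: "\<And>x y. x \<in> carrier N \<Longrightarrow> y \<in> carrier N \<Longrightarrow> x \<oplus>\<^bsub>N\<^esub> y = x \<oplus>\<^bsub>M\<^esub> y"
    and zero: "\<zero>\<^bsub>N\<^esub> = \<zero>\<^bsub>M\<^esub>"
    and \<sigma>: "inj \<sigma>" and g': "\<And>k. g' (\<sigma> k) = g k \<inter> carrier N" and out: "\<And>l. l \<notin> range \<sigma> \<Longrightarrow> g' l = {\<zero>\<^bsub>M\<^esub>}"
    and comp: "\<And>x k. x \<in> carrier N \<Longrightarrow> hom_component M g k x \<in> carrier N"
  shows "direct_sum_dec N g'"
  unfolding direct_sum_dec_def
proof (intro conjI allI ballI)
  interpret M: abelian_group M by fact
  interpret N: abelian_group N by fact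
  have neg: "\<ominus>\<^bsub>N\<^esub> x = \<ominus>\<^bsub>M\<^esub> x" if "x \<in> carrier N" for x
  proof (rule M.minus_equality[symmetric])
    show "\<ominus>\<^bsub>N\<^esub> x \<oplus>\<^bsub>M\<^esub> x = \<zero>\<^bsub>M\<^esub>" using add[of "\<ominus>\<^bsub>N\<^esub> x" x] that zero by (simp add: N.l_neg)
  qed (use that sub in auto)
  have g'N: "g' l \<subseteq> carrier N" for l
    using g' out[of l] zero N.zero_closed by (cases "l \<in> range \<sigma>") (auto simp del: N.zero_closed)
  show "subgroup (g' l) (add_monoid N)" for l
  proof (cases "l \<in> range \<sigma>")
    case True
    then obtain k where l: "l = \<sigma> k" by auto
    show ?thesis
    proof (rule N.add.subgroupI)
      show "g' l \<noteq> {}" using hom_part_zero[OF M, of k] zero N.zero_closed by (auto simp: l g')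
      show "\<ominus>\<^bsub>N\<^esub> x \<in> g' l" if "x \<in> g' l" for x
        using that neg N.a_inv_closed[of x] hom_part_neg[OF M] by (auto simp: l g')
      show "x \<oplus>\<^bsub>N\<^esub> y \<in> g' l" if "x \<in> g' l" "y \<in> g' l" for x y
        using that add N.a_closed[of x y] hom_part_add[OF M] by (auto simp: l g')
    qed (rule g'N)
  next
    case False
    then have "g' l = {\<zero>\<^bsub>N\<^esub>}" using out zero by simp
    then show ?thesis by (intro N.add.subgroupI) auto
  qed
  fix x assume x: "x \<in> carrier N"
  then have xM: "x \<in> carrier M" using sub by auto
  \<comment> \<open>The decomposition in \<open>M\<close>, moved along \<open>\<sigma>\<close> and
    filled up with zeros at the remaining indices.\<close>
  define c where "c l = (if l \<in> range \<sigma> then hom_component M g (inv_into UNIV \<sigma> l) x else \<zero>\<^bsub>M\<^esub>)" for l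
  have c\<sigma>: "c (\<sigma> k) = hom_component M g k x" for k using \<sigma> by (simp add: c_def)
  have sum_eq: "(\<Oplus>\<^bsub>N\<^esub>l\<in>\<sigma> ` S. b l) = (\<Oplus>\<^bsub>M\<^esub>k\<in>S. b (\<sigma> k))" if "\<And>l. b l \<in> carrier N" for b S
  proof -
    have "(\<Oplus>\<^bsub>N\<^esub>l\<in>\<sigma> ` S. b l) = (\<Oplus>\<^bsub>N\<^esub>k\<in>S. b (\<sigma> k))"
      by (rule N.finsum_reindex) (use that \<sigma> in \<open>auto intro: inj_on_subset\<close>)
    also have "\<dots> = (\<Oplus>\<^bsub>M\<^esub>k\<in>S. b (\<sigma> k))"
      using finsum_hom[OF N M(1), of "\<lambda>x. x" "\<lambda>k. b (\<sigma> k)" S] sub zero add that by auto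
    finally show ?thesis .
  qed
  have supp: "{l. b l \<noteq> \<zero>\<^bsub>N\<^esub>} = \<sigma> ` {k. b (\<sigma> k) \<noteq> \<zero>\<^bsub>M\<^esub>}"
    if "\<And>l. l \<notin> range \<sigma> \<Longrightarrow> b l = \<zero>\<^bsub>M\<^esub>" for b
    using that zero by (auto simp: image_iff) (metis rangeE)
  note p = hom_component_props[OF M xM]
  show "\<exists>!c. (\<forall>k. c k \<in> g' k) \<and> finite {k. c k \<noteq> \<zero>\<^bsub>N\<^esub>} \<and> x = (\<Oplus>\<^bsub>N\<^esub>k\<in>{k. c k \<noteq> \<zero>\<^bsub>N\<^esub>}. c k)"
  proof (rule ex1I[of _ c])
    have out_c: "c l = \<zero>\<^bsub>M\<^esub>" if "l \<notin> range \<sigma>" for l using that by (simp add: c_def)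
    have cN: "c l \<in> carrier N" for l
      using comp[OF x] zero N.zero_closed by (auto simp: c_def)
    have mem: "c l \<in> g' l" for l
    proof (cases "l \<in> range \<sigma>")
      case True
      then obtain k where "l = \<sigma> k" by auto
      then show ?thesis using p(1) comp[OF x] by (simp add: c\<sigma> g')
    qed (simp add: out out_c)
    have supp_c: "{l. c l \<noteq> \<zero>\<^bsub>N\<^esub>} = \<sigma> ` {k. hom_component M g k x \<noteq> \<zero>\<^bsub>M\<^esub>}"
      using supp[OF out_c] by (simp add: c\<sigma>)
    have "(\<Oplus>\<^bsub>N\<^esub>l\<in>{l. c l \<noteq> \<zero>\<^bsub>N\<^esub>}. c l) = x"
      unfolding supp_c sum_eq[OF cN] c\<sigma> using p(3) by (rule sym)
    moreover have "finite {l. c l \<noteq> \<zero>\<^bsub>N\<^esub>}"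
      unfolding supp_c using p(2) by (rule finite_imageI)
    ultimately show "(\<forall>k. c k \<in> g' k) \<and> finite {k. c k \<noteq> \<zero>\<^bsub>N\<^esub>} \<and> x = (\<Oplus>\<^bsub>N\<^esub>k\<in>{k. c k \<noteq> \<zero>\<^bsub>N\<^esub>}. c k)"
      using mem by simp
  next
    fix b assume b: "(\<forall>k. b k \<in> g' k) \<and> finite {k. b k \<noteq> \<zero>\<^bsub>N\<^esub>} \<and> x = (\<Oplus>\<^bsub>N\<^esub>k\<in>{k. b k \<noteq> \<zero>\<^bsub>N\<^esub>}. b k)"
    have out_b: "b l = \<zero>\<^bsub>M\<^esub>" if "l \<notin> range \<sigma>" for l
    proof -
      have "b l \<in> g' l" using b by blast
      then show ?thesis using out[OF that] by simp
    qed
    have bN: "b l \<in> carrier N" for l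
    proof -
      have "b l \<in> g' l" using b by blast
      then show ?thesis using g'N by auto
    qed
    \<comment> \<open>Any competing decomposition, read back along \<open>\<sigma>\<close>, is a
      decomposition in \<open>M\<close> and hence consists of the components there.\<close>
    have "hom_component M g k x = b (\<sigma> k)" for k
    proof (rule hom_component_eqI[OF M, of "{k. b (\<sigma> k) \<noteq> \<zero>\<^bsub>M\<^esub>}"])
      have "finite (\<sigma> ` {k. b (\<sigma> k) \<noteq> \<zero>\<^bsub>M\<^esub>})"
        using b supp[OF out_b] by simp
      then show "finite {k. b (\<sigma> k) \<noteq> \<zero>\<^bsub>M\<^esub>}"
        using inj_on_subset[OF \<sigma> subset_UNIV] by (rule finite_imageD)
      show "b (\<sigma> k) \<in> g k" for k
      proof -
        have "b (\<sigma> k) \<in> g' (\<sigma> k)" using b by blast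
        then show ?thesis by (simp add: g')
      qed
      show "x = (\<Oplus>\<^bsub>M\<^esub>k\<in>{k. b (\<sigma> k) \<noteq> \<zero>\<^bsub>M\<^esub>}. b (\<sigma> k))"
        using b sum_eq[where S = "{k. b (\<sigma> k) \<noteq> \<zero>\<^bsub>M\<^esub>}", OF bN] supp[OF out_b] by simp
    qed simp
    then have "b (\<sigma> k) = c (\<sigma> k)" for k by (simp add: c\<sigma>)
    then show "b = c" using out_b by (auto simp: fun_eq_iff c_def)
  qed
qed

section \<open>Scalars of degree zero\<close>

lemma module_restrict_scalars:
  assumes V: "module R V" and S: "cring (R\<lparr>carrier := S\<rparr>)" "S \<subseteq> carrier R"
  shows "module (R\<lparr>carrier := S\<rparr>) V"
proof -
  interpret V: module R V by fact
  show ?thesis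
    by (rule moduleI) (use S(1) subsetD[OF S(2)] in \<open>auto simp: V.smult_l_distr V.smult_r_distr V.smult_assoc1
      V.abelian_group_axioms\<close>)
qed

lemma deg0_ring_cring:
  assumes "graded_ring R gR" shows "cring (deg0_ring R gR)" "gR 0 \<subseteq> carrier R"
proof -
  interpret R: cring R using assms by (simp add: graded_ring_def)
  have dec: "direct_sum_dec R gR" using assms by (simp add: graded_ring_def)
  note M = R.abelian_group_axioms dec
  show sub: "gR 0 \<subseteq> carrier R" using hom_part_carrier[OF M] by blast
  have "subring (gR 0) R"
  proof (rule R.subringI)
    show "x \<otimes>\<^bsub>R\<^esub> y \<in> gR 0" if "x \<in> gR 0" "y \<in> gR 0" for x y
      using assms that unfolding graded_ring_def by (metis add_0)
  qed (use sub assms hom_part_neg[OF M] hom_part_add[OF M] in \<open>auto simp: graded_ring_def\<close>)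
  then show "cring (deg0_ring R gR)"
    using R.subcring_iff[OF sub] R.subcringI' by blast
qed

lemma component_module:
  assumes "graded_ring R gR" "graded_module R gR E gE"
  shows "module (deg0_ring R gR) (component E gE n)"
proof -
  interpret E: module R E using assms by (simp add: graded_module_def)
  have dec: "direct_sum_dec E gE" using assms by (simp add: graded_module_def)
  note M = E.abelian_group_axioms dec
  interpret A: module "deg0_ring R gR" E
    using module_restrict_scalars[OF E.module_axioms deg0_ring_cring[OF assms(1)]] .
  have "submodule (gE n) (deg0_ring R gR) E"
  proof (rule A.submoduleI)
    show "a \<odot>\<^bsub>E\<^esub> x \<in> gE n" if "a \<in> carrier (deg0_ring R gR)" "x \<in> gE n" for a x
    proof -
      have a: "a \<in> gR 0" using that by simp
      have "a \<odot>\<^bsub>E\<^esub> x \<in> gE (int 0 + n)"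
        using assms(2) a that(2) unfolding graded_module_def by blast
      then show ?thesis by simp
    qed
  qed (use hom_part_carrier[OF M] hom_part_zero[OF M] hom_part_neg[OF M] hom_part_add[OF M] in auto)
  then show ?thesis by (rule submodule.submodule_is_module[OF _ A.module_axioms])
qed

lemma ghom_hom_component:
  assumes "graded_module R gR P gP" "graded_module R gR Q gQ" "f \<in> ghom R P gP Q gQ 0" "x \<in> carrier P"
  shows "hom_component Q gQ k (f x) = f (hom_component P gP k x)"
proof -
  interpret P: module R P using assms by (simp add: graded_module_def)
  interpret Q: module R Q using assms by (simp add: graded_module_def)
  have f: "f \<in> mhom R P Q" using assms(3) by (simp add: ghom_def)
  show ?thesis
  proof (rule hom_component_map[OF P.abelian_group_axioms _ Q.abelian_group_axioms])
    show "f y \<in> gQ l" if "y \<in> gP l" for l y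
    proof -
      have "f ` gP l \<subseteq> gQ (l + 0)" using assms(3) by (simp add: ghom_def)
      then show ?thesis using that by auto
    qed
  qed (use assms mhom_closed[OF f] mhom_add[OF f] mhom_zero[OF P.module_axioms Q.module_axioms f] in
      \<open>auto simp: graded_module_def\<close>)
qed

lemma hom_component_smult_deg0:
  assumes "graded_module R gR E gE" "a \<in> gR 0" "a \<in> carrier R" "x \<in> carrier E"
  shows "hom_component E gE k (a \<odot>\<^bsub>E\<^esub> x) = a \<odot>\<^bsub>E\<^esub> hom_component E gE k x"
proof -
  interpret E: module R E using assms by (simp add: graded_module_def)
  have dec: "direct_sum_dec E gE" using assms by (simp add: graded_module_def)
  show ?thesis
  proof (rule hom_component_map[OF E.abelian_group_axioms dec E.abelian_group_axioms dec])
    show "a \<odot>\<^bsub>E\<^esub> y \<in> gE l" if "y \<in> gE l" for l y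
    proof -
      have "a \<odot>\<^bsub>E\<^esub> y \<in> gE (int 0 + l)" using assms(1,2) that unfolding graded_module_def by blast
      then show ?thesis by simp
    qed
  qed (use assms in \<open>auto simp: E.smult_r_distr\<close>)
qed

text \<open>\<open>restrict\<close> makes the map \<open>undefined\<close> off the component again,
  as membership in \<open>mhom\<close> demands.\<close>

lemma mhom_component:
  assumes "graded_ring R gR" "graded_module R gR P gP" "f \<in> ghom R P gP Q gQ 0"
  shows "restrict f (gP n) \<in> mhom (deg0_ring R gR) (component P gP n) (component Q gQ n)"
proof -
  interpret P: module R P using assms by (simp add: graded_module_def)
  have f: "f \<in> mhom R P Q" using assms(3) by (simp add: ghom_def)
  interpret C: module "deg0_ring R gR" "component P gP n" by (rule component_module[OF assms(1,2)])
  have c: "x \<in> carrier P" if "x \<in> gP n" for x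
    using hom_part_carrier[OF P.abelian_group_axioms, of gP x n] assms(2) that by (simp add: graded_module_def)
  have "f ` gP n \<subseteq> gQ (n + 0)" using assms(3) by (simp add: ghom_def)
  then show ?thesis
    using C.a_closed C.smult_closed deg0_ring_cring(2)[OF assms(1)] c
    by (intro mhomI) (auto simp: mhom_add[OF f] mhom_smult[OF f])
qed

text \<open>A preimage supplied by exactness over \<open>R\<close> need not be homogeneous, but its
  component of degree \<open>n\<close> is again a preimage, because the maps commute with the
  projections.\<close>

lemma component_coresolution:
  assumes R: "graded_ring R gR" and M: "graded_module R gR M gM"
    and res: "coresolution R M \<epsilon> E d" and E: "\<And>i. graded_module R gR (E i) (gE i)"
    and \<epsilon>: "\<epsilon> \<in> ghom R M gM (E 0) (gE 0) 0"
    and d: "\<And>i. d i \<in> ghom R (E i) (gE i) (E (Suc i)) (gE (Suc i)) 0"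
  shows "coresolution (deg0_ring R gR) (component M gM n) (restrict \<epsilon> (gM n))
    (\<lambda>i. component (E i) (gE i) n) (\<lambda>i. restrict (d i) (gE i n))"
proof -
  have grp: "abelian_group M" "direct_sum_dec M gM"
    using M by (auto simp: graded_module_def module_def)
  have grpE: "abelian_group (E i)" "direct_sum_dec (E i) (gE i)" for i
    using E[of i] by (auto simp: graded_module_def module_def)
  have \<epsilon>n: "\<epsilon> x \<in> gE 0 n" if "x \<in> gM n" for x
  proof -
    have "\<epsilon> ` gM n \<subseteq> gE 0 (n + 0)" using \<epsilon> by (simp add: ghom_def)
    then show ?thesis using that by auto
  qed
  have dn: "d i x \<in> gE (Suc i) n" if "x \<in> gE i n" for i x
  proof -
    have "d i ` gE i n \<subseteq> gE (Suc i) (n + 0)" using d by (simp add: ghom_def)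
    then show ?thesis using that by auto
  qed
  note cM = hom_part_carrier[OF grp] and cE = hom_part_carrier[OF grpE]
  have inj: "inj_on \<epsilon> (carrier M)" using res by (simp add: coresolution_def)
  show ?thesis
    unfolding coresolution_def
  proof (intro conjI allI)
    show "module (deg0_ring R gR) (component (E i) (gE i) n)" for i by (rule component_module[OF R E])
    show "restrict \<epsilon> (gM n) \<in> mhom (deg0_ring R gR) (component M gM n) (component (E 0) (gE 0) n)"
      by (rule mhom_component[OF R M \<epsilon>])
    show "restrict (d i) (gE i n) \<in> mhom (deg0_ring R gR) (component (E i) (gE i) n)
        (component (E (Suc i)) (gE (Suc i)) n)" for i
      by (rule mhom_component[OF R E d])
    show "inj_on (restrict \<epsilon> (gM n)) (carrier (component M gM n))"
      using inj_on_subset[OF inj, of "gM n"] cM by (auto simp: inj_on_def)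
    show "restrict \<epsilon> (gM n) ` carrier (component M gM n) =
        a_kernel (component (E 0) (gE 0) n) (component (E 1) (gE 1) n) (restrict (d 0) (gE 0 n))"
    proof (rule Set.set_eqI, rule iffI)
      fix x assume "x \<in> restrict \<epsilon> (gM n) ` carrier (component M gM n)"
      then show "x \<in> a_kernel (component (E 0) (gE 0) n) (component (E 1) (gE 1) n) (restrict (d 0) (gE 0 n))"
        using \<epsilon>n coresolution_diff_aug[OF res] cM by (auto simp: mem_a_kernel)
    next
      fix x assume "x \<in> a_kernel (component (E 0) (gE 0) n) (component (E 1) (gE 1) n) (restrict (d 0) (gE 0 n))"
      then have x: "x \<in> gE 0 n" "d 0 x = \<zero>\<^bsub>E (Suc 0)\<^esub>" by (auto simp: mem_a_kernel)
      then obtain m where m: "m \<in> carrier M" "x = \<epsilon> m"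
        using coresolution_exact_0[OF res cE] by blast
      \<comment> \<open>The preimage \<open>m\<close> is replaced by its component of degree
        \<open>n\<close>; this does not change the image, since \<open>x\<close> already has degree
        \<open>n\<close>.\<close>
      have "x = hom_component (E 0) (gE 0) n (\<epsilon> m)"
        using hom_component_homogeneous[OF grpE x(1)] m by simp
      also have "\<dots> = \<epsilon> (hom_component M gM n m)"
        by (rule ghom_hom_component[OF M E \<epsilon> m(1)])
      finally show "x \<in> restrict \<epsilon> (gM n) ` carrier (component M gM n)"
        using hom_component_props(1)[OF grp m(1), of n] by (auto intro!: image_eqI)
    qed
    show "restrict (d i) (gE i n) ` carrier (component (E i) (gE i) n) =
        a_kernel (component (E (Suc i)) (gE (Suc i)) n) (component (E (Suc (Suc i))) (gE (Suc (Suc i))) n)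
          (restrict (d (Suc i)) (gE (Suc i) n))" for i
    proof (rule Set.set_eqI, rule iffI)
      fix x assume "x \<in> restrict (d i) (gE i n) ` carrier (component (E i) (gE i) n)"
      then show "x \<in> a_kernel (component (E (Suc i)) (gE (Suc i)) n)
          (component (E (Suc (Suc i))) (gE (Suc (Suc i))) n) (restrict (d (Suc i)) (gE (Suc i) n))"
        using dn coresolution_diff_diff[OF res] cE by (auto simp: mem_a_kernel)
    next
      fix x assume "x \<in> a_kernel (component (E (Suc i)) (gE (Suc i)) n)
          (component (E (Suc (Suc i))) (gE (Suc (Suc i))) n) (restrict (d (Suc i)) (gE (Suc i) n))"
      then have x: "x \<in> gE (Suc i) n" "d (Suc i) x = \<zero>\<^bsub>E (Suc (Suc i))\<^esub>" by (auto simp: mem_a_kernel)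
      then obtain m where m: "m \<in> carrier (E i)" "x = d i m"
        using coresolution_exact_Suc[OF res cE] by blast
      have "x = hom_component (E (Suc i)) (gE (Suc i)) n (d i m)"
        using hom_component_homogeneous[OF grpE x(1)] m by simp
      also have "\<dots> = d i (hom_component (E i) (gE i) n m)"
        by (rule ghom_hom_component[OF E E d m(1)])
      finally show "x \<in> restrict (d i) (gE i n) ` carrier (component (E i) (gE i) n)"
        using hom_component_props(1)[OF grpE m(1), of n] by (auto intro!: image_eqI)
    qed
  qed
qed

section \<open>Flatness\<close>

text \<open>The free abelian group consists of finitely supported integer functions and is written
  multiplicatively as a group; this translates homomorphisms out of it into the additive notation of
  both sides, with the support condition as membership.\<close>

lemma free_hom_props:
  assumes "abelian_group G" "h \<in> hom (free_Abelian_group S) (add_monoid G)"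
  shows "\<And>u. Poly_Mapping.keys u \<subseteq> S \<Longrightarrow> h u \<in> carrier G"
    and "\<And>u v. Poly_Mapping.keys u \<subseteq> S \<Longrightarrow> Poly_Mapping.keys v \<subseteq> S \<Longrightarrow> h (u + v) = h u \<oplus>\<^bsub>G\<^esub> h v"
    and "h 0 = \<zero>\<^bsub>G\<^esub>"
    and "\<And>u v. Poly_Mapping.keys u \<subseteq> S \<Longrightarrow> Poly_Mapping.keys v \<subseteq> S \<Longrightarrow> h (u - v) = h u \<ominus>\<^bsub>G\<^esub> h v"
proof -
  interpret G: abelian_group G by fact
  show c: "h u \<in> carrier G" if "Poly_Mapping.keys u \<subseteq> S" for u
    using hom_in_carrier[OF assms(2), of u] that by simp
  show a: "h (u + v) = h u \<oplus>\<^bsub>G\<^esub> h v"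
    if "Poly_Mapping.keys u \<subseteq> S" "Poly_Mapping.keys v \<subseteq> S" for u v
    using hom_mult[OF assms(2), of u v] that by simp
  show "h 0 = \<zero>\<^bsub>G\<^esub>"
    using hom_one[OF assms(2) group_free_Abelian_group G.a_group] by simp
  show "h (u - v) = h u \<ominus>\<^bsub>G\<^esub> h v"
    if "Poly_Mapping.keys u \<subseteq> S" "Poly_Mapping.keys v \<subseteq> S" for u v
  proof -
    have k: "Poly_Mapping.keys (u - v) \<subseteq> S" using keys_diff[of u v] that by blast
    have "h (u - v) \<oplus>\<^bsub>G\<^esub> h v = h u" using a[OF k that(2)] by simp
    then have "h u \<ominus>\<^bsub>G\<^esub> h v = h (u - v) \<oplus>\<^bsub>G\<^esub> h v \<ominus>\<^bsub>G\<^esub> h v" by simp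
    also have "\<dots> = h (u - v)" using c[OF k] c[OF that(2)] by (simp add: G.minus_eq G.a_assoc G.r_neg)
    finally show ?thesis by simp
  qed
qed

lemma tensor_relators_keys:
  assumes "module A F" "module A P" "u \<in> tensor_relators A F P"
  shows "Poly_Mapping.keys u \<subseteq> carrier F \<times> carrier P"
proof -
  interpret F: module A F by fact
  interpret P: module A P by fact
  have 3: "Poly_Mapping.keys (frag_of a - frag_of b - frag_of c) \<subseteq> {a, b, c}" for a b c :: "'b \<times> 'c"
    using keys_diff[of "frag_of a - frag_of b" "frag_of c"] keys_diff[of "frag_of a" "frag_of b"] by auto
  have 2: "Poly_Mapping.keys (frag_of a - frag_of b) \<subseteq> {a, b}" for a b :: "'b \<times> 'c"
    using keys_diff[of "frag_of a" "frag_of b"] by auto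
  from assms(3) consider
    (a) x y p where "u = frag_of (x \<oplus>\<^bsub>F\<^esub> y, p) - frag_of (x, p) - frag_of (y, p)"
      "x \<in> carrier F" "y \<in> carrier F" "p \<in> carrier P"
  | (b) x p q where "u = frag_of (x, p \<oplus>\<^bsub>P\<^esub> q) - frag_of (x, p) - frag_of (x, q)"
      "x \<in> carrier F" "p \<in> carrier P" "q \<in> carrier P"
  | (c) a x p where "u = frag_of (a \<odot>\<^bsub>F\<^esub> x, p) - frag_of (x, a \<odot>\<^bsub>P\<^esub> p)"
      "a \<in> carrier A" "x \<in> carrier F" "p \<in> carrier P"
    unfolding tensor_relators_def by blast
  then show ?thesis
  proof cases
    case a then show ?thesis using 3[of "(x \<oplus>\<^bsub>F\<^esub> y, p)" "(x, p)" "(y, p)"] by auto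
  next
    case b then show ?thesis using 3[of "(x, p \<oplus>\<^bsub>P\<^esub> q)" "(x, p)" "(x, q)"] by auto
  next
    case c then show ?thesis using 2[of "(a \<odot>\<^bsub>F\<^esub> x, p)" "(x, a \<odot>\<^bsub>P\<^esub> p)"] by auto
  qed
qed

lemma tensor_rel_group_subgroup:
  assumes "module A F" "module A P"
  shows "subgroup (tensor_rel_group A F P) (free_Abelian_group (carrier F \<times> carrier P))"
  unfolding tensor_rel_group_def
  by (rule group.generate_is_subgroup[OF group_free_Abelian_group])
    (use tensor_relators_keys[OF assms] in auto)

lemma tensor_rel_group_keys:
  assumes "module A F" "module A P" "u \<in> tensor_rel_group A F P"
  shows "Poly_Mapping.keys u \<subseteq> carrier F \<times> carrier P"
  using subsetD[OF subgroup.subset[OF tensor_rel_group_subgroup[OF assms(1,2)]] assms(3)] by simp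

lemma tensor_rel_group_closed:
  assumes "module A F" "module A P"
  shows "\<And>u v. u \<in> tensor_rel_group A F P \<Longrightarrow> v \<in> tensor_rel_group A F P \<Longrightarrow> u + v \<in> tensor_rel_group A F P"
    and "\<And>u. u \<in> tensor_rel_group A F P \<Longrightarrow> - u \<in> tensor_rel_group A F P"
    and "0 \<in> tensor_rel_group A F P"
    and "\<And>u v. u \<in> tensor_rel_group A F P \<Longrightarrow> v \<in> tensor_rel_group A F P \<Longrightarrow> u - v \<in> tensor_rel_group A F P"
proof -
  interpret subgroup "tensor_rel_group A F P" "free_Abelian_group (carrier F \<times> carrier P)"
    by (rule tensor_rel_group_subgroup[OF assms])
  show a: "u + v \<in> tensor_rel_group A F P"
    if "u \<in> tensor_rel_group A F P" "v \<in> tensor_rel_group A F P" for u v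
    using m_closed[OF that] by simp
  show m: "- u \<in> tensor_rel_group A F P" if "u \<in> tensor_rel_group A F P" for u
    using m_inv_closed[OF that] tensor_rel_group_keys[OF assms that] by simp
  show "0 \<in> tensor_rel_group A F P" using one_closed by simp
  show "u - v \<in> tensor_rel_group A F P"
    if "u \<in> tensor_rel_group A F P" "v \<in> tensor_rel_group A F P" for u v
    using a[OF that(1) m[OF that(2)]] by simp
qed

lemma tensor_rel_group_incl: "u \<in> tensor_relators A F P \<Longrightarrow> u \<in> tensor_rel_group A F P"
  unfolding tensor_rel_group_def by (rule generate.incl)

text \<open>Induction over the relations of a tensor product. Closure under differences is enough:
  the inverse of \<open>h\<close> is \<open>0 - h\<close>, and a sum is
  \<open>u - (0 - v)\<close>.\<close>

lemma tensor_rel_group_minimal: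
  assumes F: "module A F" and P: "module A P"
    and rel: "\<And>u. u \<in> tensor_relators A F P \<Longrightarrow> T u" and zero: "T 0"
    and diff: "\<And>u v. T u \<Longrightarrow> T v \<Longrightarrow> Poly_Mapping.keys u \<subseteq> carrier F \<times> carrier P \<Longrightarrow>
      Poly_Mapping.keys v \<subseteq> carrier F \<times> carrier P \<Longrightarrow> T (u - v)"
    and u: "u \<in> tensor_rel_group A F P"
  shows "T u"
proof -
  have "T u \<and> Poly_Mapping.keys u \<subseteq> carrier F \<times> carrier P"
    using u unfolding tensor_rel_group_def
  proof (induction rule: generate.induct)
    case one then show ?case using zero by simp
  next
    case (incl h) then show ?case using rel tensor_relators_keys[OF F P] by blast
  next
    case (inv h)
    then have h: "T h" "Poly_Mapping.keys h \<subseteq> carrier F \<times> carrier P"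
      using rel tensor_relators_keys[OF F P] by blast+
    then show ?case using diff[OF zero h(1)] by simp
  next
    case (eng u v)
    then have "T (u - (0 - v))" using keys_diff[of 0 v]
      by (intro diff zero) auto
    then show ?case using eng keys_add[of u v] by auto
  qed
  then show ?thesis ..
qed

text \<open>Injectivity of F (x) I -> F (x) A, read on representatives: a formal sum supported on
  \<open>I\<close> that is a relation over \<open>A\<close> is already a relation over
  \<open>I\<close>.\<close>

lemma flat_tensor_rel_group:
  assumes A: "cring A" and flat: "flat_module A F" and I: "ideal I A"
    and keys: "Poly_Mapping.keys u \<subseteq> carrier F \<times> I" and u: "u \<in> tensor_rel_group A F (reg_mod A)"
  shows "u \<in> tensor_rel_group A F ((reg_mod A)\<lparr>carrier := I\<rparr>)"
proof -
  let ?Q = "reg_mod A" and ?P = "(reg_mod A)\<lparr>carrier := I\<rparr>"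
  let ?FQ = "free_Abelian_group (carrier F \<times> carrier ?Q)" and ?FP = "free_Abelian_group (carrier F \<times> carrier ?P)"
  interpret I: ideal I A by fact
  have F: "module A F" using flat by (simp add: flat_module_def)
  have Q: "module A ?Q" by (rule reg_mod_module) fact
  have P: "module A ?P"
    using submodule.submodule_is_module[OF ideal_submodule_reg_mod[OF A I] Q] .
  have sub: "I \<subseteq> carrier A" using I.a_subset .
  define j where "j = (\<lambda>a\<in>I. a)"
  have j: "j \<in> mhom A ?P ?Q"
    unfolding j_def using sub by (intro mhomI) (auto simp: reg_mod_def I.I_l_closed)
  have "inj_on j (carrier ?P)" by (auto simp: inj_on_def j_def)
  then have inj: "inj_on (tensor_map A F ?P ?Q j) (carrier (tensor A F ?P))"
    using flat j P Q unfolding flat_module_def by blast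
  have rel_sub: "v \<in> tensor_rel_group A F ?Q" if "v \<in> tensor_rel_group A F ?P" for v
  proof (rule tensor_rel_group_minimal[OF F P _ _ _ that])
    fix w assume "w \<in> tensor_relators A F ?P"
    then have "w \<in> tensor_relators A F ?Q"
      using sub unfolding tensor_relators_def by (auto simp: reg_mod_def; blast)
    then show "w \<in> tensor_rel_group A F ?Q" by (rule tensor_rel_group_incl)
  qed (use tensor_rel_group_closed[OF F Q] in auto)
  \<comment> \<open>The inclusion induces the identity on formal sums with second entries in
    \<open>I\<close>, so that the tensor map only enlarges cosets.\<close>
  have ext: "frag_extend (\<lambda>(x, p). frag_of (x, j p)) v = v"
    if "Poly_Mapping.keys v \<subseteq> carrier F \<times> I" for v
    using that
  proof (induction v rule: frag_induction)
    case (diff a b) then show ?case by (simp add: frag_extend_diff)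
  qed (auto simp: j_def)
  \<comment> \<open>The class of a relation over \<open>A\<close> becomes zero in F (x) A. Applied
    to \<open>u\<close> and to 0 this gives two classes of F (x) I with the same image.\<close>
  have coset: "tensor_map A F ?P ?Q j (tensor_rel_group A F ?P #>\<^bsub>?FP\<^esub> v) = tensor_rel_group A F ?Q"
    if v: "v \<in> tensor_rel_group A F ?Q" "Poly_Mapping.keys v \<subseteq> carrier F \<times> I" for v
  proof -
    let ?C = "tensor_rel_group A F ?P #>\<^bsub>?FP\<^esub> v"
    have C: "?C = (\<lambda>r. r + v) ` tensor_rel_group A F ?P" by (auto simp: r_coset_def)
    have "frag_extend (\<lambda>(x, p). frag_of (x, j p)) w = w" if "w \<in> ?C" for w
    proof (rule ext)
      obtain r where r: "r \<in> tensor_rel_group A F ?P" "w = r + v" using \<open>w \<in> ?C\<close> C by auto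
      then show "Poly_Mapping.keys w \<subseteq> carrier F \<times> I"
        using tensor_rel_group_keys[OF F P r(1)] v(2) keys_add[of r v] by auto
    qed
    then have im: "frag_extend (\<lambda>(x, p). frag_of (x, j p)) ` ?C = ?C" by (auto intro: rev_image_eqI)
    have CQ: "w \<in> tensor_rel_group A F ?Q" if "w \<in> ?C" for w
      using that rel_sub v(1) tensor_rel_group_closed(1)[OF F Q] unfolding C by blast
    have vC: "v \<in> ?C" using tensor_rel_group_closed(3)[OF F P] unfolding C by force
    have "tensor_rel_group A F ?Q <#>\<^bsub>?FQ\<^esub> ?C = tensor_rel_group A F ?Q"
    proof (rule Set.set_eqI, rule iffI)
      fix w assume "w \<in> tensor_rel_group A F ?Q <#>\<^bsub>?FQ\<^esub> ?C"
      then obtain r c where "r \<in> tensor_rel_group A F ?Q" "c \<in> ?C" "w = r + c"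
        unfolding set_mult_def by auto
      then show "w \<in> tensor_rel_group A F ?Q" using CQ tensor_rel_group_closed(1)[OF F Q] by blast
    next
      fix w assume "w \<in> tensor_rel_group A F ?Q"
      then have "w - v \<in> tensor_rel_group A F ?Q" using v(1) tensor_rel_group_closed(4)[OF F Q] by blast
      moreover have "w = (w - v) + v" by simp
      ultimately show "w \<in> tensor_rel_group A F ?Q <#>\<^bsub>?FQ\<^esub> ?C"
        using vC unfolding set_mult_def by fastforce
    qed
    then show ?thesis unfolding tensor_map_def im .
  qed
  have mem: "tensor_rel_group A F ?P #>\<^bsub>?FP\<^esub> v \<in> carrier (tensor A F ?P)"
    if "Poly_Mapping.keys v \<subseteq> carrier F \<times> I" for v
    using that by (auto simp: tensor_def FactGroup_def RCOSETS_def)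
  have "tensor_rel_group A F ?P #>\<^bsub>?FP\<^esub> u = tensor_rel_group A F ?P #>\<^bsub>?FP\<^esub> 0"
    by (rule inj_onD[OF inj]) (use coset[OF u keys] coset[of 0] tensor_rel_group_closed(3)[OF F Q]
        mem[OF keys] mem[of 0] in auto)
  moreover have "u \<in> tensor_rel_group A F ?P #>\<^bsub>?FP\<^esub> u"
    using tensor_rel_group_closed(3)[OF F P] by (force simp: r_coset_def)
  ultimately show ?thesis by (auto simp: r_coset_def)
qed

text \<open>The isomorphism of F (x) A with F: every tensor equals \<open>\<mu> u\<close> (x) 1, the
  scalar being moved to the left factor.\<close>

lemma tensor_reg_mod_normal_form:
  assumes A: "cring A" and F: "module A F"
    and \<mu>: "\<mu> \<in> hom (free_Abelian_group (carrier F \<times> carrier A)) (add_monoid F)"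
    and \<mu>_of: "\<And>x a. x \<in> carrier F \<Longrightarrow> a \<in> carrier A \<Longrightarrow> \<mu> (frag_of (x, a)) = a \<odot>\<^bsub>F\<^esub> x"
    and keys: "Poly_Mapping.keys u \<subseteq> carrier F \<times> carrier A"
  shows "u - frag_of (\<mu> u, \<one>\<^bsub>A\<^esub>) \<in> tensor_rel_group A F (reg_mod A)"
proof -
  interpret F: module A F by fact
  let ?T = "tensor_rel_group A F (reg_mod A)"
  note Q = reg_mod_module[OF A]
  note cl = tensor_rel_group_closed[OF F Q]
  note \<mu>p = free_hom_props[OF F.abelian_group_axioms \<mu>]
  have add_rel: "frag_of (x \<oplus>\<^bsub>F\<^esub> y, \<one>\<^bsub>A\<^esub>) - frag_of (x, \<one>\<^bsub>A\<^esub>) - frag_of (y, \<one>\<^bsub>A\<^esub>) \<in> ?T"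
    if "x \<in> carrier F" "y \<in> carrier F" for x y
    by (rule tensor_rel_group_incl) (use that in \<open>auto simp: tensor_relators_def reg_mod_def\<close>)
  have "u - frag_of (\<mu> u, \<one>\<^bsub>A\<^esub>) \<in> ?T \<and> Poly_Mapping.keys u \<subseteq> carrier F \<times> carrier A"
    using keys
  proof (induction u rule: frag_induction)
    case zero
    \<comment> \<open>The generator for 0 (x) 1 is not the zero formal sum; it is a relation by
      additivity, applied to 0 + 0 = 0.\<close>
    show ?case using add_rel[of "\<zero>\<^bsub>F\<^esub>" "\<zero>\<^bsub>F\<^esub>"] \<mu>p(3) by simp
  next
    case (one z)
    then obtain x a where z: "z = (x, a)" "x \<in> carrier F" "a \<in> carrier A" by auto
    have "frag_of (a \<odot>\<^bsub>F\<^esub> x, \<one>\<^bsub>A\<^esub>) - frag_of (x, a) \<in> tensor_relators A F (reg_mod A)"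
      unfolding tensor_relators_def
    proof (intro UnI2 CollectI exI conjI)
      show "frag_of (a \<odot>\<^bsub>F\<^esub> x, \<one>\<^bsub>A\<^esub>) - frag_of (x, a) =
          frag_of (a \<odot>\<^bsub>F\<^esub> x, \<one>\<^bsub>A\<^esub>) - frag_of (x, a \<odot>\<^bsub>reg_mod A\<^esub> \<one>\<^bsub>A\<^esub>)"
        using z by (simp add: reg_mod_def)
    qed (use z in \<open>auto simp: reg_mod_def\<close>)
    then have "- (frag_of (a \<odot>\<^bsub>F\<^esub> x, \<one>\<^bsub>A\<^esub>) - frag_of (x, a)) \<in> ?T"
      by (intro cl(2) tensor_rel_group_incl)
    then show ?case using z \<mu>_of by simp
  next
    case (diff u v)
    then have k: "Poly_Mapping.keys u \<subseteq> carrier F \<times> carrier A" "Poly_Mapping.keys v \<subseteq> carrier F \<times> carrier A"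
      by auto
    note c = \<mu>p(1)[OF k(1)] \<mu>p(1)[OF k(2)]
    have "(\<mu> u \<ominus>\<^bsub>F\<^esub> \<mu> v) \<oplus>\<^bsub>F\<^esub> \<mu> v = \<mu> u" using c by (simp add: F.minus_eq F.a_assoc F.l_neg)
    then have "frag_of (\<mu> u, \<one>\<^bsub>A\<^esub>) - frag_of (\<mu> u \<ominus>\<^bsub>F\<^esub> \<mu> v, \<one>\<^bsub>A\<^esub>) - frag_of (\<mu> v, \<one>\<^bsub>A\<^esub>) \<in> ?T"
      using add_rel[of "\<mu> u \<ominus>\<^bsub>F\<^esub> \<mu> v" "\<mu> v"] c by simp
    \<comment> \<open>The normal forms of \<open>u\<close> and \<open>v\<close> differ from that of
      \<open>u - v\<close> by one additivity relation between their right hand sides.\<close>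
    then have "(u - frag_of (\<mu> u, \<one>\<^bsub>A\<^esub>)) - (v - frag_of (\<mu> v, \<one>\<^bsub>A\<^esub>)) +
        (frag_of (\<mu> u, \<one>\<^bsub>A\<^esub>) - frag_of (\<mu> u \<ominus>\<^bsub>F\<^esub> \<mu> v, \<one>\<^bsub>A\<^esub>) - frag_of (\<mu> v, \<one>\<^bsub>A\<^esub>)) \<in> ?T"
      using diff(1,2) cl(1)[OF cl(4)] by blast
    moreover have "Poly_Mapping.keys (u - v) \<subseteq> carrier F \<times> carrier A" using k keys_diff[of u v] by blast
    ultimately show ?case using \<mu>p(4)[OF k] by (simp add: algebra_simps)
  qed
  then show ?thesis ..
qed

text \<open>The consequence of flatness in the form needed to define maps on IF: a balanced map
  \<open>b\<close> on F x I sends a formal sum to zero whenever the corresponding sum of products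
  vanishes in \<open>F\<close>. The normal form makes such a sum a relation over \<open>A\<close>,
  flatness makes it one over \<open>I\<close>, and \<open>\<Phi>\<close> kills each relator over
  \<open>I\<close>.\<close>

lemma flat_balanced_map_zero:
  assumes A: "cring A" and flat: "flat_module A F" and I: "ideal I A" and G: "abelian_group G"
    and \<mu>: "\<mu> \<in> hom (free_Abelian_group (carrier F \<times> carrier A)) (add_monoid F)"
    and \<mu>_of: "\<And>x a. x \<in> carrier F \<Longrightarrow> a \<in> carrier A \<Longrightarrow> \<mu> (frag_of (x, a)) = a \<odot>\<^bsub>F\<^esub> x"
    and \<Phi>: "\<Phi> \<in> hom (free_Abelian_group (carrier F \<times> I)) (add_monoid G)"
    and \<Phi>_of: "\<And>x a. x \<in> carrier F \<Longrightarrow> a \<in> I \<Longrightarrow> \<Phi> (frag_of (x, a)) = b x a"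
    and b_l: "\<And>x y a. x \<in> carrier F \<Longrightarrow> y \<in> carrier F \<Longrightarrow> a \<in> I \<Longrightarrow> b (x \<oplus>\<^bsub>F\<^esub> y) a = b x a \<oplus>\<^bsub>G\<^esub> b y a"
    and b_r: "\<And>x a a'. x \<in> carrier F \<Longrightarrow> a \<in> I \<Longrightarrow> a' \<in> I \<Longrightarrow> b x (a \<oplus>\<^bsub>A\<^esub> a') = b x a \<oplus>\<^bsub>G\<^esub> b x a'"
    and b_bal: "\<And>x r a. x \<in> carrier F \<Longrightarrow> r \<in> carrier A \<Longrightarrow> a \<in> I \<Longrightarrow> b (r \<odot>\<^bsub>F\<^esub> x) a = b x (r \<otimes>\<^bsub>A\<^esub> a)"
    and keys: "Poly_Mapping.keys u \<subseteq> carrier F \<times> I" and u: "\<mu> u = \<zero>\<^bsub>F\<^esub>"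
  shows "\<Phi> u = \<zero>\<^bsub>G\<^esub>"
proof -
  have F: "module A F" using flat by (simp add: flat_module_def)
  interpret F: module A F by fact
  interpret G: abelian_group G by fact
  interpret I: ideal I A by fact
  let ?P = "(reg_mod A)\<lparr>carrier := I\<rparr>"
  note Q = reg_mod_module[OF A]
  note cl = tensor_rel_group_closed[OF F Q]
  note \<Phi>p = free_hom_props[OF G \<Phi>]
  have P: "module A ?P"
    using submodule.submodule_is_module[OF ideal_submodule_reg_mod[OF A I] Q] .
  have keysA: "Poly_Mapping.keys u \<subseteq> carrier F \<times> carrier A" using keys I.a_subset by auto
  have nf: "u - frag_of (\<zero>\<^bsub>F\<^esub>, \<one>\<^bsub>A\<^esub>) \<in> tensor_rel_group A F (reg_mod A)"
    using tensor_reg_mod_normal_form[OF A F \<mu> \<mu>_of keysA] u by simp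
  \<comment> \<open>The normal form of 0 again contains the generator for 0 (x) 1; subtracting it
    from \<open>nf\<close> leaves \<open>u\<close> alone.\<close>
  have nf0: "0 - frag_of (\<zero>\<^bsub>F\<^esub>, \<one>\<^bsub>A\<^esub>) \<in> tensor_rel_group A F (reg_mod A)"
    using tensor_reg_mod_normal_form[OF A F \<mu> \<mu>_of, of 0] free_hom_props(3)[OF F.abelian_group_axioms \<mu>] by simp
  have "u \<in> tensor_rel_group A F (reg_mod A)" using cl(4)[OF nf nf0] by simp
  then have "u \<in> tensor_rel_group A F ?P" by (rule flat_tensor_rel_group[OF A flat I keys])
  then show ?thesis
  proof (rule tensor_rel_group_minimal[OF F P, of "\<lambda>u. \<Phi> u = \<zero>\<^bsub>G\<^esub>", rotated 3])
    show "\<Phi> 0 = \<zero>\<^bsub>G\<^esub>" by (rule \<Phi>p(3))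
    show "\<Phi> (v - w) = \<zero>\<^bsub>G\<^esub>" if "\<Phi> v = \<zero>\<^bsub>G\<^esub>" "\<Phi> w = \<zero>\<^bsub>G\<^esub>"
      "Poly_Mapping.keys v \<subseteq> carrier F \<times> carrier ?P" "Poly_Mapping.keys w \<subseteq> carrier F \<times> carrier ?P" for v w
      using \<Phi>p(4)[of v w] that by (simp add: G.minus_eq)
    fix v assume v: "v \<in> tensor_relators A F ?P"
    have k: "Poly_Mapping.keys (frag_of (x, a)) \<subseteq> carrier F \<times> I" if "x \<in> carrier F" "a \<in> I" for x a
      using that by simp
    have k2: "Poly_Mapping.keys (frag_of (x, a) - frag_of (y, a')) \<subseteq> carrier F \<times> I"
      if "x \<in> carrier F" "a \<in> I" "y \<in> carrier F" "a' \<in> I" for x a y a'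
      using that keys_diff[of "frag_of (x, a)" "frag_of (y, a')"] by auto
    have bG: "b x a \<in> carrier G" if "x \<in> carrier F" "a \<in> I" for x a
      using \<Phi>p(1)[OF k[OF that]] \<Phi>_of[OF that] by simp
    have d3: "\<Phi> (frag_of (x, a) - frag_of (y, a') - frag_of (z, a'')) = b x a \<ominus>\<^bsub>G\<^esub> b y a' \<ominus>\<^bsub>G\<^esub> b z a''"
      if "x \<in> carrier F" "a \<in> I" "y \<in> carrier F" "a' \<in> I" "z \<in> carrier F" "a'' \<in> I" for x y z a a' a''
      using \<Phi>p(4)[OF k2[OF that(1-4)] k[OF that(5,6)]] \<Phi>p(4)[OF k[OF that(1,2)] k[OF that(3,4)]] \<Phi>_of that
      by simp
    have canc: "(s \<oplus>\<^bsub>G\<^esub> t) \<ominus>\<^bsub>G\<^esub> s \<ominus>\<^bsub>G\<^esub> t = \<zero>\<^bsub>G\<^esub>" if "s \<in> carrier G" "t \<in> carrier G" for s t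
    proof -
      have "(s \<oplus>\<^bsub>G\<^esub> t) \<ominus>\<^bsub>G\<^esub> s = t" using that by (simp add: G.minus_eq G.a_comm[of s t] G.a_assoc G.r_neg)
      then show ?thesis using that by (simp add: G.minus_eq G.r_neg)
    qed
    from v consider
      (a) x y p where "v = frag_of (x \<oplus>\<^bsub>F\<^esub> y, p) - frag_of (x, p) - frag_of (y, p)"
        "x \<in> carrier F" "y \<in> carrier F" "p \<in> I"
    | (b) x p q where "v = frag_of (x, p \<oplus>\<^bsub>A\<^esub> q) - frag_of (x, p) - frag_of (x, q)"
        "x \<in> carrier F" "p \<in> I" "q \<in> I"
    | (c) r x p where "v = frag_of (r \<odot>\<^bsub>F\<^esub> x, p) - frag_of (x, r \<otimes>\<^bsub>A\<^esub> p)"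
        "r \<in> carrier A" "x \<in> carrier F" "p \<in> I"
      unfolding tensor_relators_def by (auto simp: reg_mod_def)
    then show "\<Phi> v = \<zero>\<^bsub>G\<^esub>"
    proof cases
      case a then show ?thesis by (simp add: d3 b_l bG canc)
    next
      case b then show ?thesis by (simp add: d3 b_r bG canc)
    next
      case c
      have rp: "r \<otimes>\<^bsub>A\<^esub> p \<in> I" using c by (simp add: I.I_l_closed)
      have "\<Phi> v = b (r \<odot>\<^bsub>F\<^esub> x) p \<ominus>\<^bsub>G\<^esub> b x (r \<otimes>\<^bsub>A\<^esub> p)"
        using \<Phi>p(4)[OF k[of "r \<odot>\<^bsub>F\<^esub> x" p] k[OF c(3) rp]] \<Phi>_of c rp by simp
      then show ?thesis using c rp bG by (simp add: b_bal G.minus_eq G.r_neg)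
    qed
  qed
qed

section \<open>Baer's criterion for the components of a graded injective module\<close>

text \<open>The grading is that of a homogeneous ideal shifted by \<open>n\<close>, so that in R(-n)
  the element 1 has degree \<open>n\<close>. A homomorphism of degree 0 out of it then sends 1 into
  the component of degree \<open>n\<close>.\<close>

lemma reg_mod_graded_submodule:
  assumes R: "graded_ring R gR" and H: "submodule H R (reg_mod R)"
    and comp: "\<And>x k. x \<in> H \<Longrightarrow> hom_component R gR k x \<in> H"
  shows "graded_module R gR ((reg_mod R)\<lparr>carrier := H\<rparr>) (\<lambda>l. reg_grading R gR (l - n) \<inter> H)"
proof -
  interpret R: cring R using R by (simp add: graded_ring_def)
  have M: "abelian_group R" "direct_sum_dec R gR" using R R.abelian_group_axioms by (auto simp: graded_ring_def)
  interpret H: submodule H R "reg_mod R" by fact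
  let ?P = "(reg_mod R)\<lparr>carrier := H\<rparr>"
  have P: "module R ?P" using H.submodule_is_module[OF reg_mod_module[OF R.cring_axioms]] .
  interpret P: module R ?P by fact
  have sub: "H \<subseteq> carrier R" using H.subset by (simp add: reg_mod_def)
  have zH: "\<zero>\<^bsub>R\<^esub> \<in> H" using H.one_closed by (simp add: reg_mod_def)
  show ?thesis
    unfolding graded_module_def
  proof (intro conjI allI ballI)
    show "module R ?P" by fact
    show "direct_sum_dec ?P (\<lambda>l. reg_grading R gR (l - n) \<inter> H)"
    \<comment> \<open>The natural degree \<open>k\<close> of \<open>R\<close> becomes the integer
      degree \<open>k + n\<close>; the degrees below \<open>n\<close> are the ones outside the range
      and carry zero.\<close>
    proof (rule direct_sum_dec_transfer[OF M P.abelian_group_axioms, where \<sigma> = "\<lambda>k. int k + n"])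
      show "inj (\<lambda>k. int k + n)" by (auto simp: inj_def)
      show "reg_grading R gR (l - n) \<inter> H = {\<zero>\<^bsub>R\<^esub>}" if "l \<notin> range (\<lambda>k. int k + n)" for l
      proof -
        have "l - n < 0"
        proof (rule ccontr)
          assume "\<not> l - n < 0"
          then have "l = int (nat (l - n)) + n" by simp
          then show False using that by blast
        qed
        then show ?thesis using zH by (auto simp: reg_grading_def)
      qed
    qed (use sub comp in \<open>auto simp: reg_mod_def reg_grading_def\<close>)
    fix m k a x
    assume a: "a \<in> gR m" and x: "x \<in> reg_grading R gR (k - n) \<inter> H"
    have aR: "a \<in> carrier R" by (rule hom_part_carrier[OF M a])
    have "a \<otimes>\<^bsub>R\<^esub> x \<in> reg_grading R gR (int m + k - n)"
    proof (cases "k - n < 0")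
      case True
      then have "a \<otimes>\<^bsub>R\<^esub> x = \<zero>\<^bsub>R\<^esub>" using x aR by (simp add: reg_grading_def)
      then show ?thesis using hom_part_zero[OF M] by (simp add: reg_grading_def)
    next
      case False
      then have "x \<in> gR (nat (k - n))" using x by (simp add: reg_grading_def)
      then have "a \<otimes>\<^bsub>R\<^esub> x \<in> gR (m + nat (k - n))"
        using a R unfolding graded_ring_def by blast
      moreover have "nat (int m + k - n) = m + nat (k - n)" using False by simp
      ultimately show ?thesis using False by (simp add: reg_grading_def)
    qed
    moreover have "a \<otimes>\<^bsub>R\<^esub> x \<in> H" using H.smult_closed[OF aR, of x] x by (simp add: reg_mod_def)
    ultimately show "a \<odot>\<^bsub>?P\<^esub> x \<in> reg_grading R gR (int m + k - n) \<inter> H"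
      by (simp add: reg_mod_def)
  qed
qed

text \<open>Let \<open>f : I \<rightarrow> E\<^sub>n\<close> be linear over \<open>A = R\<^sub>0\<close>.  By flatness \<open>I \<otimes>\<^sub>A R \<rightarrow> IR\<close> is bijective, so
  \<open>a r \<mapsto> r f(a)\<close> is a well defined graded homomorphism \<open>IR(-n) \<rightarrow> E\<close>.  It extends to
  \<open>R(-n)\<close>, and the image of \<open>1\<close> is the element sought by Baer's criterion.\<close>

lemma star_injective_component_baer:
  assumes R: "graded_ring R gR" and flat: "flat_module (deg0_ring R gR) (reg_mod R)"
    and star: "star_injective_module R gR E gE"
  shows "baer_module (deg0_ring R gR) (component E gE n)"
  unfolding baer_module_def
proof (intro conjI allI impI)
  let ?A = "deg0_ring R gR" and ?D = "component E gE n"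
  have E: "graded_module R gR E gE" using star by (simp add: star_injective_module_def)
  show "module ?A ?D" by (rule component_module[OF R E])
  fix I f
  assume I: "ideal I ?A" and f: "f \<in> I \<rightarrow> carrier ?D"
    and f_add: "\<forall>a\<in>I. \<forall>b\<in>I. f (a \<oplus>\<^bsub>?A\<^esub> b) = f a \<oplus>\<^bsub>?D\<^esub> f b"
    and f_smult: "\<forall>r\<in>carrier ?A. \<forall>a\<in>I. f (r \<otimes>\<^bsub>?A\<^esub> a) = r \<odot>\<^bsub>?D\<^esub> f a"
  interpret R: cring R using R by (simp add: graded_ring_def)
  have M: "abelian_group R" "direct_sum_dec R gR" using R R.abelian_group_axioms by (auto simp: graded_ring_def)
  interpret E: module R E using E by (simp add: graded_module_def)
  have ME: "abelian_group E" "direct_sum_dec E gE" using E E.abelian_group_axioms by (auto simp: graded_module_def)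
  interpret I: ideal I ?A by fact
  have A: "cring ?A" "gR 0 \<subseteq> carrier R" using deg0_ring_cring[OF R] by auto
  interpret Q: module R "reg_mod R" by (rule reg_mod_module) (rule R.cring_axioms)
  have I0: "a \<in> gR 0" if "a \<in> I" for a using I.a_subset that by auto
  have IR: "a \<in> carrier R" if "a \<in> I" for a using I0[OF that] A(2) by auto
  have fE: "f a \<in> gE n" "f a \<in> carrier E" if "a \<in> I" for a
    using f that hom_part_carrier[OF ME] by auto

  have car: "carrier (reg_mod R) = carrier R" by (simp add: reg_mod_def)
  have "(\<lambda>(r, a). a \<otimes>\<^bsub>R\<^esub> r) ` (carrier (reg_mod R) \<times> carrier ?A) \<subseteq> carrier (add_monoid (reg_mod R))"
    using A(2) by (auto simp: car)
  note universal_\<mu> = comm_group.free_Abelian_group_universal[OF Q.a_comm_group this]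
  \<comment> \<open>A pair \<open>(r, a)\<close> stands for r (x) a. The map \<open>\<mu>\<close>
    multiplies out a formal sum, while \<open>\<Phi>\<close> below evaluates the intended
    homomorphism on it; the task is to show that \<open>\<Phi>\<close> depends on the value of
    \<open>\<mu>\<close> only.\<close>
  obtain \<mu> where \<mu>: "\<mu> \<in> hom (free_Abelian_group (carrier (reg_mod R) \<times> carrier ?A)) (add_monoid (reg_mod R))"
    and \<mu>_of': "\<And>z. z \<in> carrier (reg_mod R) \<times> carrier ?A \<Longrightarrow> \<mu> (frag_of z) = (\<lambda>(r, a). a \<otimes>\<^bsub>R\<^esub> r) z"
    by (rule universal_\<mu>) (rule that, assumption, simp only:)
  have "(\<lambda>(r, a). r \<odot>\<^bsub>E\<^esub> f a) ` (carrier (reg_mod R) \<times> I) \<subseteq> carrier (add_monoid E)"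
    using fE by (auto simp: car)
  note universal_\<Phi> = comm_group.free_Abelian_group_universal[OF E.a_comm_group this]
  obtain \<Phi> where \<Phi>: "\<Phi> \<in> hom (free_Abelian_group (carrier (reg_mod R) \<times> I)) (add_monoid E)"
    and \<Phi>_of': "\<And>z. z \<in> carrier (reg_mod R) \<times> I \<Longrightarrow> \<Phi> (frag_of z) = (\<lambda>(r, a). r \<odot>\<^bsub>E\<^esub> f a) z"
    by (rule universal_\<Phi>) (rule that, assumption, simp only:)
  have \<mu>_of: "\<mu> (frag_of (r, a)) = a \<otimes>\<^bsub>R\<^esub> r" if "r \<in> carrier R" "a \<in> gR 0" for r a
    using \<mu>_of'[of "(r, a)"] that by (simp add: car)
  have \<Phi>_of: "\<Phi> (frag_of (r, a)) = r \<odot>\<^bsub>E\<^esub> f a" if "r \<in> carrier R" "a \<in> I" for r a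
    using \<Phi>_of'[of "(r, a)"] that by (simp add: car)
  define U where "U = {u :: 'a \<times> 'a \<Rightarrow>\<^sub>0 int. Poly_Mapping.keys u \<subseteq> carrier R \<times> I}"
  have U_A: "Poly_Mapping.keys u \<subseteq> carrier (reg_mod R) \<times> carrier ?A" if "u \<in> U" for u
    using that I0 by (auto simp: U_def car)
  have U_I: "Poly_Mapping.keys u \<subseteq> carrier (reg_mod R) \<times> I" if "u \<in> U" for u
    using that by (auto simp: U_def car)
  have U_of: "frag_of (r, a) \<in> U" if "r \<in> carrier R" "a \<in> I" for r a using that by (simp add: U_def)
  have U_add: "u + v \<in> U" if "u \<in> U" "v \<in> U" for u v using that keys_add[of u v] by (auto simp: U_def)
  have U_diff: "u - v \<in> U" if "u \<in> U" "v \<in> U" for u v using that keys_diff[of u v] by (auto simp: U_def)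
  have U_0: "0 \<in> U" by (simp add: U_def)
  note \<mu>p = free_hom_props[OF Q.abelian_group_axioms \<mu>] and \<Phi>p = free_hom_props[OF ME(1) \<Phi>]
  \<comment> \<open>Inverses depend on the record, so those of \<open>reg_mod R\<close> and of
    \<open>R\<close> are identified by uniqueness of inverses.\<close>
  have neg_reg: "x \<ominus>\<^bsub>reg_mod R\<^esub> y = x \<ominus>\<^bsub>R\<^esub> y" if "x \<in> carrier R" "y \<in> carrier R" for x y
  proof -
    have "\<ominus>\<^bsub>R\<^esub> y = \<ominus>\<^bsub>reg_mod R\<^esub> y"
      using Q.l_neg[of y] Q.a_inv_closed[of y] that
      by (intro R.minus_equality) (auto simp: reg_mod_def)
    then show ?thesis by (simp add: R.minus_eq Q.minus_eq) (simp add: reg_mod_def)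
  qed
  have \<mu>c: "\<mu> u \<in> carrier R" if "u \<in> U" for u using \<mu>p(1)[OF U_A[OF that]] by (simp add: car)
  have \<mu>_add: "\<mu> (u + v) = \<mu> u \<oplus>\<^bsub>R\<^esub> \<mu> v" if "u \<in> U" "v \<in> U" for u v
    using \<mu>p(2)[OF U_A U_A, OF that] by (simp add: reg_mod_def)
  have \<mu>_diff: "\<mu> (u - v) = \<mu> u \<ominus>\<^bsub>R\<^esub> \<mu> v" if "u \<in> U" "v \<in> U" for u v
    using \<mu>p(4)[OF U_A U_A, OF that] neg_reg \<mu>c that by simp
  have \<mu>_0: "\<mu> 0 = \<zero>\<^bsub>R\<^esub>" using \<mu>p(3) by (simp add: reg_mod_def)
  have \<Phi>c: "\<Phi> u \<in> carrier E" if "u \<in> U" for u using \<Phi>p(1)[OF U_I[OF that]] .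
  have \<Phi>_add: "\<Phi> (u + v) = \<Phi> u \<oplus>\<^bsub>E\<^esub> \<Phi> v" if "u \<in> U" "v \<in> U" for u v
    using \<Phi>p(2)[OF U_I U_I, OF that] .
  have \<Phi>_diff: "\<Phi> (u - v) = \<Phi> u \<ominus>\<^bsub>E\<^esub> \<Phi> v" if "u \<in> U" "v \<in> U" for u v
    using \<Phi>p(4)[OF U_I U_I, OF that] .
  have wd0: "\<Phi> u = \<zero>\<^bsub>E\<^esub>" if "u \<in> U" "\<mu> u = \<zero>\<^bsub>R\<^esub>" for u
  proof (rule flat_balanced_map_zero[OF A(1) flat I ME(1) \<mu> _ \<Phi>, where b = "\<lambda>r a. r \<odot>\<^bsub>E\<^esub> f a"])
    fix x a assume "x \<in> carrier (reg_mod R)" "a \<in> carrier ?A"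
    then show "\<mu> (frag_of (x, a)) = a \<odot>\<^bsub>reg_mod R\<^esub> x" by (simp add: \<mu>_of reg_mod_def)
  next
    fix x a assume "x \<in> carrier (reg_mod R)" "a \<in> I"
    then show "\<Phi> (frag_of (x, a)) = x \<odot>\<^bsub>E\<^esub> f a" by (simp add: \<Phi>_of car)
  next
    fix x y a assume "x \<in> carrier (reg_mod R)" "y \<in> carrier (reg_mod R)" "a \<in> I"
    then show "(x \<oplus>\<^bsub>reg_mod R\<^esub> y) \<odot>\<^bsub>E\<^esub> f a = x \<odot>\<^bsub>E\<^esub> f a \<oplus>\<^bsub>E\<^esub> y \<odot>\<^bsub>E\<^esub> f a"
      using fE by (simp add: reg_mod_def E.smult_l_distr)
  next
    fix x a a' assume "x \<in> carrier (reg_mod R)" "a \<in> I" "a' \<in> I"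
    then show "x \<odot>\<^bsub>E\<^esub> f (a \<oplus>\<^bsub>?A\<^esub> a') = x \<odot>\<^bsub>E\<^esub> f a \<oplus>\<^bsub>E\<^esub> x \<odot>\<^bsub>E\<^esub> f a'"
      using fE f_add by (simp add: reg_mod_def E.smult_r_distr)
  next
    fix x r a assume "x \<in> carrier (reg_mod R)" "r \<in> carrier ?A" "a \<in> I"
    then show "(r \<odot>\<^bsub>reg_mod R\<^esub> x) \<odot>\<^bsub>E\<^esub> f a = x \<odot>\<^bsub>E\<^esub> f (r \<otimes>\<^bsub>?A\<^esub> a)"
      using fE f_smult A(2) by (simp add: reg_mod_def E.smult_assoc1[symmetric] R.m_comm subset_eq)
  next
    show "Poly_Mapping.keys u \<subseteq> carrier (reg_mod R) \<times> I" using U_I[OF that(1)] .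
    show "\<mu> u = \<zero>\<^bsub>reg_mod R\<^esub>" using that by (simp add: reg_mod_def)
  qed
  \<comment> \<open>Well-definedness on IR, by flatness applied to the difference of two formal sums
    with the same value.\<close>
  have wd: "\<Phi> u = \<Phi> v" if "u \<in> U" "v \<in> U" "\<mu> u = \<mu> v" for u v
  proof -
    have "\<mu> (u - v) = \<zero>\<^bsub>R\<^esub>" using \<mu>_diff[OF that(1,2)] that(3) \<mu>c[OF that(2)] by (simp add: R.minus_eq R.r_neg)
    then have "\<Phi> u \<ominus>\<^bsub>E\<^esub> \<Phi> v = \<zero>\<^bsub>E\<^esub>" using wd0[OF U_diff[OF that(1,2)]] \<Phi>_diff[OF that(1,2)] by simp
    then show ?thesis using E.minus_eq_zero_iff[OF \<Phi>c[OF that(1)] \<Phi>c[OF that(2)]] by simp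
  qed
  have U_induct: "T u" if u: "u \<in> U" and "T 0" and "\<And>r a. r \<in> carrier R \<Longrightarrow> a \<in> I \<Longrightarrow> T (frag_of (r, a))"
    and "\<And>u v. u \<in> U \<Longrightarrow> v \<in> U \<Longrightarrow> T u \<Longrightarrow> T v \<Longrightarrow> T (u - v)" for T u
  proof -
    have "u \<in> U \<and> T u"
      using u[unfolded U_def mem_Collect_eq]
      by (induction u rule: frag_induction) (use that(2-) U_0 U_of U_diff in auto)
    then show ?thesis ..
  qed
  \<comment> \<open>Replacing each \<open>r\<close> by its component of degree \<open>k\<close>
    lifts the projection of R to formal sums, because each \<open>a\<close> has degree 0. This
    yields both that IR is a homogeneous ideal and that the induced map respects the shifted
    grading.\<close>
  have homog: "\<exists>v\<in>U. \<mu> v = hom_component R gR k (\<mu> u) \<and> \<Phi> v \<in> gE (int k + n)" if "u \<in> U" for u k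
    using that
  proof (rule U_induct[of u "\<lambda>u. \<exists>v\<in>U. \<mu> v = hom_component R gR k (\<mu> u) \<and> \<Phi> v \<in> gE (int k + n)"])
    show "\<exists>v\<in>U. \<mu> v = hom_component R gR k (\<mu> 0) \<and> \<Phi> v \<in> gE (int k + n)"
    proof (intro bexI conjI)
      show "\<mu> 0 = hom_component R gR k (\<mu> 0)"
        using hom_component_homogeneous[OF M hom_part_zero[OF M], of k k] \<mu>_0 by simp
      show "\<Phi> 0 \<in> gE (int k + n)" using \<Phi>p(3) hom_part_zero[OF ME] by simp
    qed (rule U_0)
  next
    fix r a assume r: "r \<in> carrier R" and a: "a \<in> I"
    have hr: "hom_component R gR k r \<in> gR k" by (rule hom_component_props(1)[OF M r])
    then have hrR: "hom_component R gR k r \<in> carrier R" by (rule hom_part_carrier[OF M])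
    show "\<exists>v\<in>U. \<mu> v = hom_component R gR k (\<mu> (frag_of (r, a))) \<and> \<Phi> v \<in> gE (int k + n)"
    proof (intro bexI conjI)
      have "hom_component R gR k (a \<otimes>\<^bsub>R\<^esub> r) = a \<otimes>\<^bsub>R\<^esub> hom_component R gR k r"
      proof (rule hom_component_map[OF M M _ _ _ _ r])
        show "a \<otimes>\<^bsub>R\<^esub> x \<in> gR l" if "x \<in> gR l" for l x
        proof -
          have "a \<otimes>\<^bsub>R\<^esub> x \<in> gR (0 + l)" using R I0[OF a] that unfolding graded_ring_def by blast
          then show ?thesis by simp
        qed
      qed (use IR[OF a] in \<open>auto simp: R.r_distr\<close>)
      then show "\<mu> (frag_of (hom_component R gR k r, a)) = hom_component R gR k (\<mu> (frag_of (r, a)))"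
        using \<mu>_of r hrR I0[OF a] by simp
      show "\<Phi> (frag_of (hom_component R gR k r, a)) \<in> gE (int k + n)"
        using \<Phi>_of[OF hrR a] E hr fE(1)[OF a] unfolding graded_module_def by simp
      show "frag_of (hom_component R gR k r, a) \<in> U" by (rule U_of[OF hrR a])
    qed
  next
    fix u w assume u: "u \<in> U" and w: "w \<in> U"
      and "\<exists>v\<in>U. \<mu> v = hom_component R gR k (\<mu> u) \<and> \<Phi> v \<in> gE (int k + n)"
      and "\<exists>v\<in>U. \<mu> v = hom_component R gR k (\<mu> w) \<and> \<Phi> v \<in> gE (int k + n)"
    then obtain u' w' where *: "u' \<in> U" "\<mu> u' = hom_component R gR k (\<mu> u)" "\<Phi> u' \<in> gE (int k + n)"
      "w' \<in> U" "\<mu> w' = hom_component R gR k (\<mu> w)" "\<Phi> w' \<in> gE (int k + n)" by blast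
    show "\<exists>v\<in>U. \<mu> v = hom_component R gR k (\<mu> (u - w)) \<and> \<Phi> v \<in> gE (int k + n)"
    proof (intro bexI conjI)
      show "\<mu> (u' - w') = hom_component R gR k (\<mu> (u - w))"
        using \<mu>_diff[OF u w] \<mu>_diff[OF *(1,4)] *(2,5) \<mu>c[OF u] \<mu>c[OF w]
          hom_component_add[OF M, of "\<mu> u" "\<ominus>\<^bsub>R\<^esub> \<mu> w" k] hom_component_neg[OF M, of "\<mu> w" k]
        by (simp add: R.minus_eq)
      show "\<Phi> (u' - w') \<in> gE (int k + n)"
        using \<Phi>_diff[OF *(1,4)] hom_part_add[OF ME *(3) hom_part_neg[OF ME *(6)]] by (simp add: E.minus_eq)
      show "u' - w' \<in> U" by (rule U_diff[OF *(1,4)])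
    qed
  qed
  \<comment> \<open>Scalars of R act on formal sums through the first entry. Tracking the values of
    \<open>\<mu>\<close> and \<open>\<Phi>\<close> together gives R-linearity of the induced
    map.\<close>
  have scal: "\<exists>v\<in>U. \<mu> v = s \<otimes>\<^bsub>R\<^esub> \<mu> u \<and> \<Phi> v = s \<odot>\<^bsub>E\<^esub> \<Phi> u" if "u \<in> U" and s: "s \<in> carrier R" for u s
    using that(1)
  proof (rule U_induct[of u "\<lambda>u. \<exists>v\<in>U. \<mu> v = s \<otimes>\<^bsub>R\<^esub> \<mu> u \<and> \<Phi> v = s \<odot>\<^bsub>E\<^esub> \<Phi> u"])
    show "\<exists>v\<in>U. \<mu> v = s \<otimes>\<^bsub>R\<^esub> \<mu> 0 \<and> \<Phi> v = s \<odot>\<^bsub>E\<^esub> \<Phi> 0"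
      using s \<mu>_0 \<Phi>p(3) U_0 by (intro bexI[of _ 0]) auto
  next
    fix r a assume r: "r \<in> carrier R" and a: "a \<in> I"
    show "\<exists>v\<in>U. \<mu> v = s \<otimes>\<^bsub>R\<^esub> \<mu> (frag_of (r, a)) \<and> \<Phi> v = s \<odot>\<^bsub>E\<^esub> \<Phi> (frag_of (r, a))"
      using s r a IR[OF a] I0[OF a] fE(2)[OF a] U_of
      by (intro bexI[of _ "frag_of (s \<otimes>\<^bsub>R\<^esub> r, a)"]) (simp_all add: \<mu>_of \<Phi>_of R.m_lcomm E.smult_assoc1)
  next
    fix u w assume u: "u \<in> U" and w: "w \<in> U"
      and "\<exists>v\<in>U. \<mu> v = s \<otimes>\<^bsub>R\<^esub> \<mu> u \<and> \<Phi> v = s \<odot>\<^bsub>E\<^esub> \<Phi> u"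
      and "\<exists>v\<in>U. \<mu> v = s \<otimes>\<^bsub>R\<^esub> \<mu> w \<and> \<Phi> v = s \<odot>\<^bsub>E\<^esub> \<Phi> w"
    then obtain u' w' where *: "u' \<in> U" "\<mu> u' = s \<otimes>\<^bsub>R\<^esub> \<mu> u" "\<Phi> u' = s \<odot>\<^bsub>E\<^esub> \<Phi> u"
      "w' \<in> U" "\<mu> w' = s \<otimes>\<^bsub>R\<^esub> \<mu> w" "\<Phi> w' = s \<odot>\<^bsub>E\<^esub> \<Phi> w" by blast
    show "\<exists>v\<in>U. \<mu> v = s \<otimes>\<^bsub>R\<^esub> \<mu> (u - w) \<and> \<Phi> v = s \<odot>\<^bsub>E\<^esub> \<Phi> (u - w)"
      using \<mu>_diff[OF u w] \<mu>_diff[OF *(1,4)] \<Phi>_diff[OF u w] \<Phi>_diff[OF *(1,4)] *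
        \<mu>c[OF u] \<mu>c[OF w] \<Phi>c[OF u] \<Phi>c[OF w] s U_diff[OF *(1,4)]
      by (intro bexI[of _ "u' - w'"])
        (simp_all add: R.minus_eq E.minus_eq R.r_distr R.r_minus E.smult_r_distr E.smult_r_minus)
  qed

  \<comment> \<open>The ideal IR, obtained as the image of the multiplication map so that each
    element comes with a formal sum.\<close>
  define H where "H = \<mu> ` U"
  have H_sub: "H \<subseteq> carrier R" using \<mu>c by (auto simp: H_def)
  have H_smult: "s \<otimes>\<^bsub>R\<^esub> x \<in> H" if s: "s \<in> carrier R" and x: "x \<in> H" for s x
  proof -
    obtain u where "u \<in> U" "x = \<mu> u" using x by (auto simp: H_def)
    then show ?thesis using scal[of u s] s unfolding H_def by force
  qed
  have H_add: "x \<oplus>\<^bsub>R\<^esub> y \<in> H" if xy: "x \<in> H" "y \<in> H" for x y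
  proof -
    obtain u v where "u \<in> U" "x = \<mu> u" "v \<in> U" "y = \<mu> v" using xy by (auto simp: H_def)
    then show ?thesis using \<mu>_add[of u v] U_add[of u v] unfolding H_def by force
  qed
  have H: "submodule H R (reg_mod R)"
  proof (rule Q.submoduleI)
    show "\<ominus>\<^bsub>reg_mod R\<^esub> x \<in> H" if "x \<in> H" for x
    proof -
      have "\<ominus>\<^bsub>reg_mod R\<^esub> x = (\<ominus>\<^bsub>R\<^esub> \<one>\<^bsub>R\<^esub>) \<odot>\<^bsub>reg_mod R\<^esub> x"
        using that H_sub Q.smult_l_minus[of "\<one>\<^bsub>R\<^esub>" x] by (auto simp: car)
      also have "\<dots> = (\<ominus>\<^bsub>R\<^esub> \<one>\<^bsub>R\<^esub>) \<otimes>\<^bsub>R\<^esub> x" by (simp add: reg_mod_def)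
      also have "\<dots> \<in> H" using H_smult that by simp
      finally show ?thesis .
    qed
    show "\<zero>\<^bsub>reg_mod R\<^esub> \<in> H" using \<mu>_0 U_0 by (force simp: reg_mod_def H_def)
  qed (use H_sub H_smult H_add in \<open>auto simp: reg_mod_def\<close>)
  have H_comp: "hom_component R gR k x \<in> H" if x: "x \<in> H" for x k
  proof -
    obtain u where "u \<in> U" "x = \<mu> u" using x by (auto simp: H_def)
    then show ?thesis using homog[of u k] unfolding H_def by force
  qed
  let ?P = "(reg_mod R)\<lparr>carrier := H\<rparr>" and ?gP = "\<lambda>l. reg_grading R gR (l - n) \<inter> H"
  \<comment> \<open>The regular module with the shape of record that
    \<open>reg_mod_graded_submodule\<close> produces for the whole ring.\<close>
  let ?Q = "(reg_mod R)\<lparr>carrier := carrier (reg_mod R)\<rparr>"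
  let ?gQ = "\<lambda>l. reg_grading R gR (l - n) \<inter> carrier (reg_mod R)"
  have P: "graded_module R gR ?P ?gP" by (rule reg_mod_graded_submodule[OF R H H_comp])
  have Q: "graded_module R gR ?Q ?gQ"
    by (rule reg_mod_graded_submodule[OF R Q.carrier_is_submodule])
      (use hom_component_props(1)[OF M] hom_part_carrier[OF M] in \<open>auto simp: car\<close>)
  define F where "F = (\<lambda>x\<in>H. \<Phi> (SOME u. u \<in> U \<and> \<mu> u = x))"
  have F: "F (\<mu> u) = \<Phi> u" if "u \<in> U" for u
  proof -
    have "(SOME v. v \<in> U \<and> \<mu> v = \<mu> u) \<in> U \<and> \<mu> (SOME v. v \<in> U \<and> \<mu> v = \<mu> u) = \<mu> u"
      using that by (intro someI_ex[of "\<lambda>v. v \<in> U \<and> \<mu> v = \<mu> u"]) auto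
    then have "\<Phi> (SOME v. v \<in> U \<and> \<mu> v = \<mu> u) = \<Phi> u" using wd that by blast
    then show ?thesis using that by (simp add: F_def H_def)
  qed
  have F_hom: "F \<in> mhom R ?P E"
  proof (rule mhomI)
    have "F x \<in> carrier E" if "x \<in> H" for x using that F \<Phi>c by (auto simp: H_def)
    then show "F \<in> carrier ?P \<rightarrow>\<^sub>E carrier E" by (auto simp: F_def)
  next
    fix x y assume "x \<in> carrier ?P" "y \<in> carrier ?P"
    then obtain u v where "u \<in> U" "v \<in> U" "x = \<mu> u" "y = \<mu> v" by (auto simp: H_def)
    then show "F (x \<oplus>\<^bsub>?P\<^esub> y) = F x \<oplus>\<^bsub>E\<^esub> F y"
      using F[OF U_add[of u v]] \<mu>_add[of u v] \<Phi>_add[of u v] F by (simp add: reg_mod_def)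
  next
    fix s x assume s: "s \<in> carrier R" and "x \<in> carrier ?P"
    then obtain u where u: "u \<in> U" "x = \<mu> u" by (auto simp: H_def)
    obtain v where "v \<in> U" "\<mu> v = s \<otimes>\<^bsub>R\<^esub> \<mu> u" "\<Phi> v = s \<odot>\<^bsub>E\<^esub> \<Phi> u" using scal[OF u(1) s] by blast
    then show "F (s \<odot>\<^bsub>?P\<^esub> x) = s \<odot>\<^bsub>E\<^esub> F x"
      using F[of v] F[OF u(1)] u by (simp add: reg_mod_def)
  qed
  have F_ghom: "F \<in> ghom R ?P ?gP E gE 0"
    unfolding ghom_def
  proof (intro CollectI conjI allI subsetI F_hom)
    fix l y assume "y \<in> F ` ?gP l"
    then obtain x where x: "x \<in> reg_grading R gR (l - n)" "x \<in> H" "y = F x" by blast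
    then obtain u where u: "u \<in> U" "x = \<mu> u" by (auto simp: H_def)
    show "y \<in> gE (l + 0)"
    proof (cases "l - n < 0")
      case True
      then have "x = \<zero>\<^bsub>R\<^esub>" using x by (simp add: reg_grading_def)
      \<comment> \<open>Below degree \<open>n\<close> the shifted ideal is zero, and
        \<open>wd0\<close> sends zero to zero.\<close>
      then have "y = \<zero>\<^bsub>E\<^esub>" using x(3) u F[OF u(1)] wd0[OF u(1)] by simp
      then show ?thesis using hom_part_zero[OF ME] by simp
    next
      case False
      then have xg: "x \<in> gR (nat (l - n))" using x by (simp add: reg_grading_def)
      obtain v where v: "v \<in> U" "\<mu> v = hom_component R gR (nat (l - n)) x" "\<Phi> v \<in> gE (int (nat (l - n)) + n)"
        using homog[OF u(1)] u(2) by blast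
      have "\<mu> v = x" using v(2) hom_component_homogeneous[OF M xg] by simp
      then have "y = \<Phi> v" using F[OF v(1)] x by simp
      then show ?thesis using v(3) False by simp
    qed
  qed
  have j: "(\<lambda>x\<in>H. x) \<in> ghom R ?P ?gP ?Q ?gQ 0"
    using H_sub H_add H_smult
    unfolding ghom_def by (auto intro!: mhomI simp: reg_mod_def)
  have "inj_on (\<lambda>x\<in>H. x) (carrier ?P)" by (auto simp: inj_on_def)
  then have "\<exists>g\<in>ghom R ?Q ?gQ E gE 0. \<forall>x\<in>carrier ?P. g ((\<lambda>x\<in>H. x) x) = F x"
    using conjunct2[OF star[unfolded star_injective_module_def], rule_format, OF j F_ghom P Q] by blast
  then obtain g where g: "g \<in> ghom R ?Q ?gQ E gE 0" "\<And>x. x \<in> H \<Longrightarrow> g x = F x" by auto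
  have gm: "g \<in> mhom R ?Q E" using g(1) by (simp add: ghom_def)
  show "\<exists>y\<in>carrier ?D. \<forall>a\<in>I. f a = a \<odot>\<^bsub>?D\<^esub> y"
  proof (intro bexI ballI)
    \<comment> \<open>The purpose of the shift: 1 has degree \<open>n\<close>, so its image lies in
      the component under consideration.\<close>
    have "\<one>\<^bsub>R\<^esub> \<in> ?gQ n" using R by (simp add: graded_ring_def reg_grading_def car)
    moreover have "g ` ?gQ n \<subseteq> gE (n + 0)" using g(1) unfolding ghom_def by blast
    ultimately show "g \<one>\<^bsub>R\<^esub> \<in> carrier ?D" by auto
    fix a assume a: "a \<in> I"
    have "\<mu> (frag_of (\<one>\<^bsub>R\<^esub>, a)) = a" using \<mu>_of[of "\<one>\<^bsub>R\<^esub>" a] I0[OF a] IR[OF a] by simp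
    moreover have "\<Phi> (frag_of (\<one>\<^bsub>R\<^esub>, a)) = f a" using \<Phi>_of[of "\<one>\<^bsub>R\<^esub>" a] a fE(2)[OF a] by simp
    ultimately have "a \<in> H" "F a = f a"
      using F[OF U_of[OF R.one_closed a]] U_of[OF R.one_closed a] by (auto simp: H_def intro: rev_image_eqI)
    moreover have "g (a \<odot>\<^bsub>?Q\<^esub> \<one>\<^bsub>R\<^esub>) = a \<odot>\<^bsub>E\<^esub> g \<one>\<^bsub>R\<^esub>"
      by (rule mhom_smult[OF gm]) (use IR[OF a] in \<open>auto simp: car\<close>)
    ultimately show "f a = a \<odot>\<^bsub>?D\<^esub> g \<one>\<^bsub>R\<^esub>"
      using g(2)[of a] IR[OF a] by (simp add: reg_mod_def)
  qed
qed

section \<open>Homomorphisms from a cyclic module\<close>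

abbreviation unit_coset :: "'a ring \<Rightarrow> 'a set \<Rightarrow> 'a set" where
  "unit_coset A I \<equiv> I +>\<^bsub>reg_mod A\<^esub> \<one>\<^bsub>A\<^esub>"

text \<open>The inverse of evaluation at the class of 1. A representative of the coset is chosen
  arbitrarily, so the function behaves as a homomorphism with value \<open>y\<close> at that class
  when \<open>y\<close> is annihilated by the ideal.\<close>

definition cyclic_hom :: "'a ring \<Rightarrow> 'a set \<Rightarrow> ('a, 'm) module \<Rightarrow> 'm \<Rightarrow> 'a set \<Rightarrow> 'm" where
  "cyclic_hom A I V y = (\<lambda>C\<in>carrier (quot_mod (reg_mod A) I).
     (SOME a. a \<in> carrier A \<and> I +>\<^bsub>reg_mod A\<^esub> a = C) \<odot>\<^bsub>V\<^esub> y)"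

context
  fixes A :: "'a ring" and I :: "'a set"
  assumes A: "cring A" and I: "ideal I A"
begin

interpretation A: cring A by (rule A)
interpretation I: ideal I A by (rule I)

lemma cyclic_carrier:
  "carrier (quot_mod (reg_mod A) I) = (\<lambda>a. I +>\<^bsub>reg_mod A\<^esub> a) ` carrier A"
  by (auto simp: quot_mod_def A_RCOSETS_def' reg_mod_def)

lemma cyclic_add:
  assumes "a \<in> carrier A" "b \<in> carrier A"
  shows "(I +>\<^bsub>reg_mod A\<^esub> a) \<oplus>\<^bsub>quot_mod (reg_mod A) I\<^esub> (I +>\<^bsub>reg_mod A\<^esub> b) = I +>\<^bsub>reg_mod A\<^esub> (a \<oplus>\<^bsub>A\<^esub> b)"
  using submodule_coset_add[OF reg_mod_module[OF A] ideal_submodule_reg_mod[OF A I], of a b] assms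
  by (simp add: quot_mod_def) (simp add: reg_mod_def)

lemma cyclic_smult:
  assumes "a \<in> carrier A" "b \<in> carrier A"
  shows "a \<odot>\<^bsub>quot_mod (reg_mod A) I\<^esub> (I +>\<^bsub>reg_mod A\<^esub> b) = I +>\<^bsub>reg_mod A\<^esub> (a \<otimes>\<^bsub>A\<^esub> b)"
  using submodule_coset_smult[OF reg_mod_module[OF A] ideal_submodule_reg_mod[OF A I], of b a] assms
  by (simp add: quot_mod_def) (simp add: reg_mod_def)

lemma cyclic_closed:
  "x \<in> carrier (quot_mod (reg_mod A) I) \<Longrightarrow> y \<in> carrier (quot_mod (reg_mod A) I) \<Longrightarrow>
     x \<oplus>\<^bsub>quot_mod (reg_mod A) I\<^esub> y \<in> carrier (quot_mod (reg_mod A) I)"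
  "a \<in> carrier A \<Longrightarrow> x \<in> carrier (quot_mod (reg_mod A) I) \<Longrightarrow>
     a \<odot>\<^bsub>quot_mod (reg_mod A) I\<^esub> x \<in> carrier (quot_mod (reg_mod A) I)"
  by (auto simp: cyclic_carrier cyclic_add cyclic_smult)

lemma unit_coset_carrier: "unit_coset A I \<in> carrier (quot_mod (reg_mod A) I)"
  by (auto simp: cyclic_carrier)

lemma cyclic_hom_mod_module: "module A V \<Longrightarrow> module A (hom_mod A (quot_mod (reg_mod A) I) V)"
  using cyclic_closed by (intro mod_hom_module)

lemma mhom_cyclic:
  assumes "f \<in> mhom A (quot_mod (reg_mod A) I) V" "a \<in> carrier A"
  shows "f (I +>\<^bsub>reg_mod A\<^esub> a) = a \<odot>\<^bsub>V\<^esub> f (unit_coset A I)"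
  using mhom_smult[OF assms unit_coset_carrier] cyclic_smult[OF assms(2) A.one_closed] assms(2) by simp

lemma mhom_cyclic_eqI:
  assumes "f \<in> mhom A (quot_mod (reg_mod A) I) V" "g \<in> mhom A (quot_mod (reg_mod A) I) V"
    and "f (unit_coset A I) = g (unit_coset A I)"
  shows "f = g"
proof (rule mhom_eqI[OF assms(1,2)])
  fix x assume "x \<in> carrier (quot_mod (reg_mod A) I)"
  then obtain a where a: "a \<in> carrier A" "x = I +>\<^bsub>reg_mod A\<^esub> a" by (auto simp: cyclic_carrier)
  show "f x = g x"
    unfolding a(2) mhom_cyclic[OF assms(1) a(1)] mhom_cyclic[OF assms(2) a(1)] assms(3) ..
qed

text \<open>An element of the ideal has the same coset as zero, so its multiple of the generator is
  zero.\<close>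

lemma mhom_cyclic_annihilated:
  assumes "module A V" "f \<in> mhom A (quot_mod (reg_mod A) I) V"
  shows "f (unit_coset A I) \<in> annihilated I V"
proof -
  interpret V: module A V by fact
  note Q = reg_mod_module[OF A]
  interpret Q: module A "reg_mod A" by (rule Q)
  have fV: "f (unit_coset A I) \<in> carrier V" by (rule mhom_closed[OF assms(2) unit_coset_carrier])
  have "a \<odot>\<^bsub>V\<^esub> f (unit_coset A I) = \<zero>\<^bsub>V\<^esub>" if "a \<in> I" for a
  proof -
    have aA: "a \<in> carrier A" using that I.a_subset by auto
    have car: "a \<in> carrier (reg_mod A)" "\<zero>\<^bsub>A\<^esub> \<in> carrier (reg_mod A)" using aA by (auto simp: reg_mod_def)
    have z: "\<zero>\<^bsub>reg_mod A\<^esub> = \<zero>\<^bsub>A\<^esub>" by (simp add: reg_mod_def)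
    have "a \<ominus>\<^bsub>reg_mod A\<^esub> \<zero>\<^bsub>A\<^esub> = a" using Q.add.inv_one car(1) unfolding z[symmetric] by (simp add: Q.minus_eq)
    then have "I +>\<^bsub>reg_mod A\<^esub> a = I +>\<^bsub>reg_mod A\<^esub> \<zero>\<^bsub>A\<^esub>"
      using submodule_coset_eq_iff[OF Q ideal_submodule_reg_mod[OF A I] car] that by simp
    then show ?thesis
      using mhom_cyclic[OF assms(2) aA] mhom_cyclic[OF assms(2) A.zero_closed] fV by simp
  qed
  then show ?thesis using fV by (simp add: annihilated_def)
qed

lemma cyclic_hom_coset:
  assumes V: "module A V" and y: "y \<in> annihilated I V" and a: "a \<in> carrier A"
  shows "cyclic_hom A I V y (I +>\<^bsub>reg_mod A\<^esub> a) = a \<odot>\<^bsub>V\<^esub> y"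
proof -
  interpret V: module A V by fact
  note Q = reg_mod_module[OF A]
  interpret Q: module A "reg_mod A" by (rule Q)
  have yV: "y \<in> carrier V" using y by (simp add: annihilated_def)
  define b where "b = (SOME b. b \<in> carrier A \<and> I +>\<^bsub>reg_mod A\<^esub> b = I +>\<^bsub>reg_mod A\<^esub> a)"
  have "b \<in> carrier A \<and> I +>\<^bsub>reg_mod A\<^esub> b = I +>\<^bsub>reg_mod A\<^esub> a"
    unfolding b_def by (rule someI[of _ a]) (use a in simp)
  then have b: "b \<in> carrier A" "I +>\<^bsub>reg_mod A\<^esub> b = I +>\<^bsub>reg_mod A\<^esub> a" by auto
  have car: "a \<in> carrier (reg_mod A)" "b \<in> carrier (reg_mod A)" using a b by (auto simp: reg_mod_def)
  \<comment> \<open>The chosen representative and \<open>a\<close> differ by an element of the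
    ideal, which kills \<open>y\<close>.\<close>
  define c where "c = b \<ominus>\<^bsub>reg_mod A\<^esub> a"
  have cI: "c \<in> I"
    using submodule_coset_eq_iff[OF Q ideal_submodule_reg_mod[OF A I] car(2,1)] b(2) by (simp add: c_def)
  have "c \<oplus>\<^bsub>reg_mod A\<^esub> a = b" using car by (simp add: c_def Q.minus_eq Q.a_assoc Q.l_neg)
  then have "b = c \<oplus>\<^bsub>A\<^esub> a" by (simp add: reg_mod_def)
  then have "b \<odot>\<^bsub>V\<^esub> y = c \<odot>\<^bsub>V\<^esub> y \<oplus>\<^bsub>V\<^esub> a \<odot>\<^bsub>V\<^esub> y"
    using cI I.a_subset a yV by (auto simp: V.smult_l_distr)
  then have "b \<odot>\<^bsub>V\<^esub> y = a \<odot>\<^bsub>V\<^esub> y" using cI y a yV by (simp add: annihilated_def)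
  then show ?thesis using a by (simp add: cyclic_hom_def cyclic_carrier b_def)
qed

lemma cyclic_hom_unit:
  assumes "module A V" "y \<in> annihilated I V"
  shows "cyclic_hom A I V y (unit_coset A I) = y"
proof -
  interpret V: module A V by fact
  show ?thesis using cyclic_hom_coset[OF assms A.one_closed] assms(2) by (simp add: annihilated_def)
qed

lemma cyclic_hom_mhom:
  assumes "module A V" "y \<in> annihilated I V"
  shows "cyclic_hom A I V y \<in> mhom A (quot_mod (reg_mod A) I) V"
proof -
  interpret V: module A V by fact
  have yV: "y \<in> carrier V" using assms by (simp add: annihilated_def)
  note e = cyclic_hom_coset[OF assms]
  show ?thesis
  proof (rule mhomI)
    have "cyclic_hom A I V y \<in> extensional (carrier (quot_mod (reg_mod A) I))" by (simp add: cyclic_hom_def)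
    moreover have "cyclic_hom A I V y x \<in> carrier V" if "x \<in> carrier (quot_mod (reg_mod A) I)" for x
      using that yV by (auto simp: cyclic_carrier e)
    ultimately show "cyclic_hom A I V y \<in> carrier (quot_mod (reg_mod A) I) \<rightarrow>\<^sub>E carrier V"
      by (simp add: PiE_def)
  qed (use yV in \<open>auto simp: cyclic_carrier e cyclic_add cyclic_smult V.smult_l_distr V.smult_assoc1\<close>)
qed

text \<open>A homomorphism from a cyclic module is determined by its value at the generator, so the
  composite with \<open>d i\<close> is zero as soon as it vanishes there.\<close>

lemma cyclic_cocycles:
  assumes E: "\<And>i. module A (E i)" and d: "\<And>i. d i \<in> mhom A (E i) (E (Suc i))"
  shows "cocycles (\<lambda>k. hom_mod A (quot_mod (reg_mod A) I) (E k))
      (\<lambda>k f. compose (carrier (quot_mod (reg_mod A) I)) (d k) f) i =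
    {f \<in> mhom A (quot_mod (reg_mod A) I) (E i). f (unit_coset A I) \<in> a_kernel (E i) (E (Suc i)) (d i)}"
proof -
  let ?N = "quot_mod (reg_mod A) I"
  have "compose (carrier ?N) (d i) f = (\<lambda>x\<in>carrier ?N. \<zero>\<^bsub>E (Suc i)\<^esub>) \<longleftrightarrow> d i (f (unit_coset A I)) = \<zero>\<^bsub>E (Suc i)\<^esub>"
    if f: "f \<in> mhom A ?N (E i)" for f
  proof
    assume "compose (carrier ?N) (d i) f = (\<lambda>x\<in>carrier ?N. \<zero>\<^bsub>E (Suc i)\<^esub>)"
    then show "d i (f (unit_coset A I)) = \<zero>\<^bsub>E (Suc i)\<^esub>"
      using unit_coset_carrier by (metis compose_eq restrict_apply')
  next
    assume *: "d i (f (unit_coset A I)) = \<zero>\<^bsub>E (Suc i)\<^esub>"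
    show "compose (carrier ?N) (d i) f = (\<lambda>x\<in>carrier ?N. \<zero>\<^bsub>E (Suc i)\<^esub>)"
    proof (rule mhom_cyclic_eqI)
      show "compose (carrier ?N) (d i) f \<in> mhom A ?N (E (Suc i))"
        by (rule mhom_compose[OF f d cyclic_closed])
      interpret H: module A "hom_mod A ?N (E (Suc i))" by (rule cyclic_hom_mod_module[OF E])
      show "(\<lambda>x\<in>carrier ?N. \<zero>\<^bsub>E (Suc i)\<^esub>) \<in> mhom A ?N (E (Suc i))"
        using H.zero_closed by (simp only: hom_mod_def partial_object.simps ring.simps)
    qed (use unit_coset_carrier * in \<open>simp add: compose_eq\<close>)
  qed
  then show ?thesis
    using mhom_closed[OF _ unit_coset_carrier]
    by (auto simp: cocycles_def mem_a_kernel) (auto simp: hom_mod_def)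
qed

text \<open>To be a coboundary, the value at the generator must have a preimage that is itself the
  value of a homomorphism, that is, one annihilated by the ideal. This is the origin of
  \<open>annihilated_boundaries\<close>.\<close>

lemma cyclic_coboundaries:
  assumes E: "\<And>i. module A (E i)" and d: "\<And>i. d i \<in> mhom A (E i) (E (Suc i))"
  shows "coboundaries (\<lambda>k. hom_mod A (quot_mod (reg_mod A) I) (E k))
      (\<lambda>k f. compose (carrier (quot_mod (reg_mod A) I)) (d k) f) i =
    {f \<in> mhom A (quot_mod (reg_mod A) I) (E i). f (unit_coset A I) \<in> annihilated_boundaries I E d i}"
proof (cases i)
  case 0
  let ?N = "quot_mod (reg_mod A) I"
  interpret H: module A "hom_mod A ?N (E 0)" by (rule cyclic_hom_mod_module[OF E])
  have zero_mhom: "(\<lambda>x\<in>carrier ?N. \<zero>\<^bsub>E 0\<^esub>) \<in> mhom A ?N (E 0)"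
    using H.zero_closed by (simp only: hom_mod_def partial_object.simps ring.simps)
  define z where "z = (\<lambda>x\<in>carrier ?N. \<zero>\<^bsub>E 0\<^esub>)"
  have zp: "z \<in> mhom A ?N (E 0)" "z (unit_coset A I) = \<zero>\<^bsub>E 0\<^esub>"
    using zero_mhom unit_coset_carrier unfolding z_def by simp_all
  have "{f \<in> mhom A ?N (E 0). f (unit_coset A I) = \<zero>\<^bsub>E 0\<^esub>} = {z}"
  proof (rule Set.set_eqI, rule iffI)
    fix f assume "f \<in> {f \<in> mhom A ?N (E 0). f (unit_coset A I) = \<zero>\<^bsub>E 0\<^esub>}"
    then have "f = z" using mhom_cyclic_eqI[of f "E 0" z] zp by simp
    then show "f \<in> {z}" by simp
  qed (use zp in simp)
  moreover have "\<zero>\<^bsub>hom_mod A ?N (E 0)\<^esub> = z" unfolding hom_mod_def z_def by simp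
  ultimately show ?thesis
    by (simp add: 0 coboundaries_def annihilated_boundaries_def)
next
  case (Suc j)
  let ?N = "quot_mod (reg_mod A) I"
  have "f \<in> compose (carrier ?N) (d j) ` mhom A ?N (E j) \<longleftrightarrow>
      f \<in> mhom A ?N (E (Suc j)) \<and> f (unit_coset A I) \<in> d j ` annihilated I (E j)" for f
  proof
    assume "f \<in> compose (carrier ?N) (d j) ` mhom A ?N (E j)"
    then obtain g where g: "g \<in> mhom A ?N (E j)" "f = compose (carrier ?N) (d j) g" by blast
    then show "f \<in> mhom A ?N (E (Suc j)) \<and> f (unit_coset A I) \<in> d j ` annihilated I (E j)"
      using mhom_compose[OF g(1) d cyclic_closed] mhom_cyclic_annihilated[OF E g(1)] unit_coset_carrier
      by (auto simp: compose_eq)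
  next
    assume f: "f \<in> mhom A ?N (E (Suc j)) \<and> f (unit_coset A I) \<in> d j ` annihilated I (E j)"
    then obtain y where y: "y \<in> annihilated I (E j)" "f (unit_coset A I) = d j y" by blast
    note h = cyclic_hom_mhom[OF E y(1)]
    have "f = compose (carrier ?N) (d j) (cyclic_hom A I (E j) y)"
      by (rule mhom_cyclic_eqI[OF conjunct1[OF f] mhom_compose[OF h d cyclic_closed]])
        (use y unit_coset_carrier cyclic_hom_unit[OF E y(1)] in \<open>simp_all add: compose_eq\<close>)
    then show "f \<in> compose (carrier ?N) (d j) ` mhom A ?N (E j)" using h by blast
  qed
  then show ?thesis
    by (auto simp: Suc coboundaries_def annihilated_boundaries_def hom_mod_def)
qed

end

section \<open>Submodules cut out by evaluation at the generator\<close>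

lemma hom_mod_eval:
  assumes "c \<in> carrier N"
  shows "(f \<oplus>\<^bsub>hom_mod A N V\<^esub> g) c = f c \<oplus>\<^bsub>V\<^esub> g c" "(a \<odot>\<^bsub>hom_mod A N V\<^esub> f) c = a \<odot>\<^bsub>V\<^esub> f c"
    "\<zero>\<^bsub>hom_mod A N V\<^esub> c = \<zero>\<^bsub>V\<^esub>"
  using assms by (simp_all add: hom_mod_def)

text \<open>The scalars \<open>B\<close> may be a subring of \<open>A\<close>.\<close>

lemma hom_mod_eval_minus:
  assumes H: "module B (hom_mod A N V)" and V: "module B V" and c: "c \<in> carrier N"
    and fg: "f \<in> mhom A N V" "g \<in> mhom A N V"
  shows "(f \<ominus>\<^bsub>hom_mod A N V\<^esub> g) c = f c \<ominus>\<^bsub>V\<^esub> g c"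
proof -
  interpret H: module B "hom_mod A N V" by fact
  interpret V: module B V by fact
  have "(\<ominus>\<^bsub>hom_mod A N V\<^esub> g) = (\<ominus>\<^bsub>B\<^esub> \<one>\<^bsub>B\<^esub>) \<odot>\<^bsub>hom_mod A N V\<^esub> g"
    using H.smult_l_minus[of "\<one>\<^bsub>B\<^esub>" g] H.smult_one[of g] fg by (simp add: hom_mod_def)
  then have "(\<ominus>\<^bsub>hom_mod A N V\<^esub> g) c = (\<ominus>\<^bsub>B\<^esub> \<one>\<^bsub>B\<^esub>) \<odot>\<^bsub>V\<^esub> g c" using c by (simp add: hom_mod_eval)
  also have "\<dots> = \<ominus>\<^bsub>V\<^esub> g c" using mhom_closed[OF fg(2) c] by (simp add: V.smult_l_minus)
  finally show ?thesis using c by (simp add: H.minus_eq V.minus_eq hom_mod_eval)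
qed

text \<open>The preimage of a submodule under evaluation at \<open>c\<close>. It supplies the
  submodules of cocycles and boundaries used to form the two cohomology modules.\<close>

lemma hom_mod_eval_submodule:
  assumes H: "module B (hom_mod A N V)" and V: "module B V" and T: "submodule T B V" and c: "c \<in> carrier N"
  shows "submodule {f \<in> mhom A N V. f c \<in> T} B (hom_mod A N V)"
proof -
  interpret H: module B "hom_mod A N V" by fact
  interpret V: module B V by fact
  interpret T: submodule T B V by fact
  have car: "carrier (hom_mod A N V) = mhom A N V" by (simp add: hom_mod_def)
  show ?thesis
  proof (rule H.submoduleI)
    fix f assume f: "f \<in> {f \<in> mhom A N V. f c \<in> T}"
    \<comment> \<open>Negation is written as a difference in order to be evaluated by
      \<open>hom_mod_eval_minus\<close>.\<close>
    have e: "\<ominus>\<^bsub>hom_mod A N V\<^esub> f = \<zero>\<^bsub>hom_mod A N V\<^esub> \<ominus>\<^bsub>hom_mod A N V\<^esub> f"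
      using f H.a_inv_closed[of f] by (simp add: H.minus_eq car)
    have "(\<ominus>\<^bsub>hom_mod A N V\<^esub> f) c = \<ominus>\<^bsub>V\<^esub> f c"
      unfolding e using hom_mod_eval_minus[OF H V c, of "\<zero>\<^bsub>hom_mod A N V\<^esub>" f] f H.zero_closed
        mhom_closed[of f A N V c] c
      by (simp add: hom_mod_eval car V.minus_eq)
    also have "\<dots> \<in> T" using V.submoduleE(3)[OF T] f by simp
    finally show "\<ominus>\<^bsub>hom_mod A N V\<^esub> f \<in> {f \<in> mhom A N V. f c \<in> T}"
      using H.a_inv_closed[of f] f by (simp add: car)
  qed (use H.zero_closed H.a_closed H.smult_closed c T.one_closed T.m_closed T.smult_closed in
      \<open>auto simp: car hom_mod_eval\<close>)
qed

lemma a_kernel_submodule: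
  assumes E: "module A E" and F: "module A F" and d: "d \<in> mhom A E F"
  shows "submodule (a_kernel E F d) A E"
proof -
  interpret E: module A E by fact
  interpret F: module A F by fact
  show ?thesis
  proof (rule E.submoduleI)
    show "\<ominus>\<^bsub>E\<^esub> x \<in> a_kernel E F d" if "x \<in> a_kernel E F d" for x
      using that mhom_minus[OF E F d E.zero_closed, of x] mhom_zero[OF E F d]
      by (simp add: mem_a_kernel E.minus_eq F.minus_eq)
  qed (use mhom_zero[OF E F d] in \<open>auto simp: mem_a_kernel mhom_add[OF d] mhom_smult[OF d]\<close>)
qed

lemma annihilated_boundaries_submodule:
  assumes E: "\<And>i. module A (E i)" and d: "\<And>i. d i \<in> mhom A (E i) (E (Suc i))" and I: "I \<subseteq> carrier A"
  shows "submodule (annihilated_boundaries I E d i) A (E i)"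
proof -
  interpret E: module A "E k" for k by (rule E)
  show ?thesis
  proof (cases i)
    case 0
    have "annihilated_boundaries I E d i = {\<zero>\<^bsub>E i\<^esub>}" using 0 by (simp add: annihilated_boundaries_def)
    then show ?thesis by (intro E.submoduleI) auto
  next
    case (Suc j)
    have ann_add: "x \<oplus>\<^bsub>E j\<^esub> y \<in> annihilated I (E j)" if "x \<in> annihilated I (E j)" "y \<in> annihilated I (E j)" for x y
      using that I by (auto simp: annihilated_def E.smult_r_distr subset_eq)
    have ann_smult: "a \<odot>\<^bsub>E j\<^esub> x \<in> annihilated I (E j)" if "x \<in> annihilated I (E j)" "a \<in> carrier A" for a x
    proof -
      have "b \<odot>\<^bsub>E j\<^esub> (a \<odot>\<^bsub>E j\<^esub> x) = \<zero>\<^bsub>E j\<^esub>" if b: "b \<in> I" for b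
      proof -
        have *: "b \<in> carrier A" "a \<in> carrier A" "x \<in> carrier (E j)" "b \<odot>\<^bsub>E j\<^esub> x = \<zero>\<^bsub>E j\<^esub>"
          using b I \<open>a \<in> carrier A\<close> \<open>x \<in> annihilated I (E j)\<close> by (auto simp: annihilated_def)
        \<comment> \<open>Commutativity lets \<open>b\<close> act first, where it already gives
          zero.\<close>
        have "b \<odot>\<^bsub>E j\<^esub> (a \<odot>\<^bsub>E j\<^esub> x) = (a \<otimes>\<^bsub>A\<^esub> b) \<odot>\<^bsub>E j\<^esub> x"
          using *(1-3) by (simp add: E.smult_assoc1[symmetric] E.R.m_comm)
        also have "\<dots> = \<zero>\<^bsub>E j\<^esub>" using * by (simp add: E.smult_assoc1)
        finally show ?thesis .
      qed
      then show ?thesis using that by (auto simp: annihilated_def)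
    qed
    have zero: "\<zero>\<^bsub>E j\<^esub> \<in> annihilated I (E j)" using I by (auto simp: annihilated_def)
    have ann: "x \<in> carrier (E j)" if "x \<in> annihilated I (E j)" for x using that by (simp add: annihilated_def)
    have eq: "annihilated_boundaries I E d i = d j ` annihilated I (E j)"
      using Suc by (simp add: annihilated_boundaries_def)
    have "submodule (d j ` annihilated I (E j)) A (E (Suc j))"
    proof (rule module.submoduleI[OF E])
      show "d j ` annihilated I (E j) \<subseteq> carrier (E (Suc j))" using mhom_closed[OF d] ann by auto
      show "\<zero>\<^bsub>E (Suc j)\<^esub> \<in> d j ` annihilated I (E j)"
        using zero mhom_zero[OF E E d, of j] by (metis image_eqI)
      show "u \<oplus>\<^bsub>E (Suc j)\<^esub> v \<in> d j ` annihilated I (E j)"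
        if "u \<in> d j ` annihilated I (E j)" "v \<in> d j ` annihilated I (E j)" for u v
        using that ann_add by (auto simp: mhom_add[OF d, symmetric] ann)
      show sm: "a \<odot>\<^bsub>E (Suc j)\<^esub> u \<in> d j ` annihilated I (E j)"
        if "a \<in> carrier A" "u \<in> d j ` annihilated I (E j)" for a u
        using that ann_smult by (auto simp: mhom_smult[OF d, symmetric] ann)
      show "\<ominus>\<^bsub>E (Suc j)\<^esub> u \<in> d j ` annihilated I (E j)" if "u \<in> d j ` annihilated I (E j)" for u
      proof -
        have "u \<in> carrier (E (Suc j))" using that mhom_closed[OF d] ann by auto
        then show ?thesis using sm[of "\<ominus>\<^bsub>A\<^esub> \<one>\<^bsub>A\<^esub>" u] that by (simp add: E.smult_l_minus)
      qed
    qed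
    then show ?thesis using eq Suc by simp
  qed
qed

text \<open>The scalars killing a fixed element form an ideal, which contains the generated ideal
  once it contains \<open>I\<close>. This makes homomorphisms out of R/I_0R over R and out of
  R_0/I_0 over R_0 subject to the same condition on the image of the generator.\<close>

lemma annihilated_genideal:
  assumes V: "module R V" and I: "I \<subseteq> carrier R"
  shows "annihilated (Idl\<^bsub>R\<^esub> I) V = annihilated I V"
proof -
  interpret V: module R V by fact
  have sub: "I \<subseteq> Idl\<^bsub>R\<^esub> I" by (rule V.R.genideal_self[OF I])
  have "r \<odot>\<^bsub>V\<^esub> x = \<zero>\<^bsub>V\<^esub>" if x: "x \<in> annihilated I V" and r: "r \<in> Idl\<^bsub>R\<^esub> I" for x r
  proof -
    let ?K = "{r \<in> carrier R. r \<odot>\<^bsub>V\<^esub> x = \<zero>\<^bsub>V\<^esub>}"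
    have xV: "x \<in> carrier V" using x by (simp add: annihilated_def)
    have "ideal ?K R"
    proof (rule idealI)
      show "ring R" by (rule V.R.ring_axioms)
      show "subgroup ?K (add_monoid R)"
        by (rule V.R.add.subgroupI) (use xV in \<open>auto simp: V.smult_l_minus V.smult_l_distr\<close>)
      show "s \<otimes>\<^bsub>R\<^esub> a \<in> ?K" if "a \<in> ?K" "s \<in> carrier R" for a s
        using that xV by (simp add: V.smult_assoc1)
      then show "a \<otimes>\<^bsub>R\<^esub> s \<in> ?K" if "a \<in> ?K" "s \<in> carrier R" for a s
        using that by (simp add: V.R.m_comm)
    qed
    moreover have "I \<subseteq> ?K" using x I by (auto simp: annihilated_def)
    ultimately have "Idl\<^bsub>R\<^esub> I \<subseteq> ?K" by (rule V.R.genideal_minimal)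
    then show ?thesis using r by auto
  qed
  then show ?thesis using sub by (auto simp: annihilated_def)
qed

section \<open>Graded homomorphisms from \<open>R/I\<^sub>0R\<close>\<close>

text \<open>Multiplication by a scalar of degree 0 commutes with the projections, so annihilation by
  such scalars can be tested degree by degree.\<close>

lemma annihilated_hom_component:
  assumes R: "graded_ring R gR" and E: "graded_module R gR E gE" and I0: "I0 \<subseteq> gR 0"
    and x: "x \<in> annihilated I0 E"
  shows "hom_component E gE k x \<in> annihilated I0 E"
proof -
  interpret E: module R E using E by (simp add: graded_module_def)
  have ME: "abelian_group E" "direct_sum_dec E gE"
    using E E.abelian_group_axioms by (auto simp: graded_module_def)
  have xE: "x \<in> carrier E" using x by (simp add: annihilated_def)
  have "a \<odot>\<^bsub>E\<^esub> hom_component E gE k x = \<zero>\<^bsub>E\<^esub>" if a: "a \<in> I0" for a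
  proof -
    have a0: "a \<in> gR 0" and aR: "a \<in> carrier R" using a I0 deg0_ring_cring(2)[OF R] by auto
    have "a \<odot>\<^bsub>E\<^esub> hom_component E gE k x = hom_component E gE k (a \<odot>\<^bsub>E\<^esub> x)"
      by (rule hom_component_smult_deg0[OF E a0 aR xE, symmetric])
    also have "\<dots> = hom_component E gE k \<zero>\<^bsub>E\<^esub>" using x a by (simp add: annihilated_def)
    also have "\<dots> = \<zero>\<^bsub>E\<^esub>"
      using hom_component_homogeneous[OF ME hom_part_zero[OF ME], of k k] by simp
    finally show ?thesis .
  qed
  moreover have "hom_component E gE k x \<in> carrier E"
    by (rule hom_part_carrier[OF ME hom_component_props(1)[OF ME xE]])
  ultimately show ?thesis by (simp add: annihilated_def)
qed

text \<open>The class of 1 generates the quotient and has degree 0, so a homomorphism is homogeneous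
  of degree \<open>n\<close> exactly when the image of this class is.\<close>

lemma ghom_cyclic_iff:
  assumes R: "graded_ring R gR" and E: "graded_module R gR E gE" and K: "ideal K R"
    and f: "f \<in> mhom R (quot_mod (reg_mod R) K) E"
  shows "f \<in> ghom R (quot_mod (reg_mod R) K) (quot_grading (reg_mod R) K (reg_grading R gR)) E gE n
    \<longleftrightarrow> f (unit_coset R K) \<in> gE n"
proof
  interpret R: cring R using R by (simp add: graded_ring_def)
  have M: "abelian_group R" "direct_sum_dec R gR" using R R.abelian_group_axioms by (auto simp: graded_ring_def)
  interpret E: module R E using E by (simp add: graded_module_def)
  have ME: "abelian_group E" "direct_sum_dec E gE"
    using E E.abelian_group_axioms by (auto simp: graded_module_def)
  let ?gN = "quot_grading (reg_mod R) K (reg_grading R gR)"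
  {
    assume "f \<in> ghom R (quot_mod (reg_mod R) K) ?gN E gE n"
    then have "f ` ?gN 0 \<subseteq> gE (0 + n)" unfolding ghom_def by blast
    moreover have "unit_coset R K \<in> ?gN 0"
      using R by (auto simp: quot_grading_def reg_grading_def graded_ring_def)
    ultimately show "f (unit_coset R K) \<in> gE n" by auto
  next
    assume f1: "f (unit_coset R K) \<in> gE n"
    have "f C \<in> gE (k + n)" if C: "C \<in> ?gN k" for k C
    proof -
      obtain r where r: "r \<in> reg_grading R gR k" "C = K +>\<^bsub>reg_mod R\<^esub> r"
        using C by (auto simp: quot_grading_def)
      have rR: "r \<in> carrier R"
        using r(1) hom_part_carrier[OF M] by (auto simp: reg_grading_def split: if_splits)
      have "f C = r \<odot>\<^bsub>E\<^esub> f (unit_coset R K)"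
        unfolding r(2) by (rule mhom_cyclic[OF R.cring_axioms K f rR])
      moreover have "r \<odot>\<^bsub>E\<^esub> f (unit_coset R K) \<in> gE (k + n)"
      proof (cases "k < 0")
        case True
        then have "r = \<zero>\<^bsub>R\<^esub>" using r(1) by (simp add: reg_grading_def)
        then show ?thesis using hom_part_carrier[OF ME f1] hom_part_zero[OF ME] by simp
      next
        case False
        then have "r \<in> gR (nat k)" using r(1) by (simp add: reg_grading_def)
        then have "r \<odot>\<^bsub>E\<^esub> f (unit_coset R K) \<in> gE (int (nat k) + n)"
          using E f1 unfolding graded_module_def by blast
        then show ?thesis using False by simp
      qed
      ultimately show ?thesis by simp
    qed
    then show "f \<in> ghom R (quot_mod (reg_mod R) K) ?gN E gE n"
      using f unfolding ghom_def by auto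
  }
qed

text \<open>As \<open>R/I\<^sub>0R\<close> is generated by one element, every homomorphism from it is the finite sum of the
  homogeneous ones obtained by decomposing the image of that generator.\<close>

lemma star_hom_mod_cyclic:
  assumes R: "graded_ring R gR" and E: "graded_module R gR E gE" and I0: "I0 \<subseteq> gR 0"
  shows "star_hom_mod R (quot_mod (reg_mod R) (Idl\<^bsub>R\<^esub> I0))
      (quot_grading (reg_mod R) (Idl\<^bsub>R\<^esub> I0) (reg_grading R gR)) E gE
    = hom_mod R (quot_mod (reg_mod R) (Idl\<^bsub>R\<^esub> I0)) E"
proof -
  let ?K = "Idl\<^bsub>R\<^esub> I0"
  let ?N = "quot_mod (reg_mod R) ?K" and ?gN = "quot_grading (reg_mod R) ?K (reg_grading R gR)"
  let ?H = "hom_mod R ?N E"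
  interpret R: cring R using R by (simp add: graded_ring_def)
  have I0R: "I0 \<subseteq> carrier R" using I0 deg0_ring_cring(2)[OF R] by auto
  have K: "ideal ?K R" by (rule R.genideal_ideal[OF I0R])
  have mE: "module R E" using E by (simp add: graded_module_def)
  interpret E: module R E by fact
  have ME: "abelian_group E" "direct_sum_dec E gE"
    using E E.abelian_group_axioms by (auto simp: graded_module_def)
  note RK = R.cring_axioms K
  have H: "module R ?H" by (rule cyclic_hom_mod_module[OF RK mE])
  interpret H: module R ?H by fact
  have car: "carrier ?H = mhom R ?N E" by (simp add: hom_mod_def)
  note ucar = unit_coset_carrier[OF RK]
  let ?S = "{\<Oplus>\<^bsub>?H\<^esub>k \<in> S. h k | h S. finite S \<and> (\<forall>k \<in> S. h k \<in> ghom R ?N ?gN E gE k)}"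
  have "f \<in> ?S \<longleftrightarrow> f \<in> carrier ?H" for f
  proof
    assume "f \<in> ?S"
    then obtain h :: "int \<Rightarrow> 'a set \<Rightarrow> 'b" and S where h: "f = (\<Oplus>\<^bsub>?H\<^esub>k \<in> S. h k)" "finite S" "\<forall>k \<in> S. h k \<in> ghom R ?N ?gN E gE k"
      by blast
    then have "h \<in> S \<rightarrow> carrier ?H" by (auto simp: car ghom_def)
    then show "f \<in> carrier ?H" using h(1) H.finsum_closed by simp
  next
    assume "f \<in> carrier ?H"
    then have f: "f \<in> mhom R ?N E" by (simp add: car)
    define y where "y = f (unit_coset R ?K)"
    have yK: "y \<in> annihilated I0 E"
      using mhom_cyclic_annihilated[OF RK mE f] annihilated_genideal[OF mE I0R] by (simp add: y_def)
    then have yE: "y \<in> carrier E" by (simp add: annihilated_def)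
    define S where "S = {k. hom_component E gE k y \<noteq> \<zero>\<^bsub>E\<^esub>}"
    \<comment> \<open>The homogeneous part of degree \<open>k\<close> sends the generator to the
      component of degree \<open>k\<close> of \<open>y\<close>. It exists because that component is
      again annihilated by the ideal.\<close>
    define h where "h k = cyclic_hom R ?K E (hom_component E gE k y)" for k
    note hc = hom_component_props[OF ME yE]
    have ann: "hom_component E gE k y \<in> annihilated ?K E" for k
      using annihilated_hom_component[OF R E I0 yK] annihilated_genideal[OF mE I0R] by simp
    have hm: "h k \<in> mhom R ?N E" for k unfolding h_def by (rule cyclic_hom_mhom[OF RK mE ann])
    have h1: "h k (unit_coset R ?K) = hom_component E gE k y" for k
      unfolding h_def by (rule cyclic_hom_unit[OF RK mE ann])
    have hg: "h k \<in> ghom R ?N ?gN E gE k" for k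
      using ghom_cyclic_iff[OF R E K hm] h1 hc(1) by simp
    have sum: "(\<Oplus>\<^bsub>?H\<^esub>k \<in> S. h k) \<in> mhom R ?N E"
      using H.finsum_closed[of h S] hm by (auto simp: car)
    have "(\<Oplus>\<^bsub>?H\<^esub>k \<in> S. h k) (unit_coset R ?K) = (\<Oplus>\<^bsub>E\<^esub>k \<in> S. h k (unit_coset R ?K))"
      by (rule finsum_hom[OF H.abelian_group_axioms ME(1), of "\<lambda>f. f (unit_coset R ?K)"])
        (use mhom_closed[OF _ ucar] hm hom_mod_eval[OF ucar] in \<open>auto simp: car\<close>)
    also have "\<dots> = y" unfolding h1 S_def using hc(3) by (rule sym)
    finally have "f = (\<Oplus>\<^bsub>?H\<^esub>k \<in> S. h k)"
      using mhom_cyclic_eqI[OF RK f sum] by (simp add: y_def)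
    moreover have "finite S" unfolding S_def by (rule hc(2))
    ultimately show "f \<in> ?S" using hg by blast
  qed
  then have "?S = carrier ?H" by blast
  then show ?thesis unfolding star_hom_mod_def by simp
qed

text \<open>If an element of degree \<open>n\<close> is the boundary of an annihilated element, it
  is also the boundary of the component of degree \<open>n\<close> of that element, which is again
  annihilated.\<close>

lemma component_annihilated_boundaries_iff:
  assumes R: "graded_ring R gR" and E: "\<And>i. graded_module R gR (E i) (gE i)" and I0: "I0 \<subseteq> gR 0"
    and d: "\<And>i. d i \<in> ghom R (E i) (gE i) (E (Suc i)) (gE (Suc i)) 0" and y: "y \<in> gE i n"
  shows "y \<in> annihilated_boundaries I0 (\<lambda>i. component (E i) (gE i) n) (\<lambda>i. restrict (d i) (gE i n)) i
    \<longleftrightarrow> y \<in> annihilated_boundaries I0 E d i"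
proof (cases i)
  case 0
  then show ?thesis by (simp add: annihilated_boundaries_def)
next
  case (Suc j)
  have ME: "abelian_group (E i)" "direct_sum_dec (E i) (gE i)" for i
    using E[of i] by (auto simp: graded_module_def module_def)
  have "y \<in> restrict (d j) (gE j n) ` annihilated I0 (component (E j) (gE j) n)
      \<longleftrightarrow> y \<in> d j ` annihilated I0 (E j)"
  proof
    assume "y \<in> restrict (d j) (gE j n) ` annihilated I0 (component (E j) (gE j) n)"
    then show "y \<in> d j ` annihilated I0 (E j)"
      using hom_part_carrier[OF ME] by (auto simp: annihilated_def)
  next
    assume "y \<in> d j ` annihilated I0 (E j)"
    then obtain x where x: "x \<in> annihilated I0 (E j)" "y = d j x" by blast
    have xE: "x \<in> carrier (E j)" using x by (simp add: annihilated_def)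
    have "y = hom_component (E (Suc j)) (gE (Suc j)) n (d j x)"
      using hom_component_homogeneous[OF ME y, of n] x(2) Suc by simp
    also have "\<dots> = d j (hom_component (E j) (gE j) n x)"
      by (rule ghom_hom_component[OF E E d xE])
    finally have "y = d j (hom_component (E j) (gE j) n x)" .
    moreover have "hom_component (E j) (gE j) n x \<in> gE j n" by (rule hom_component_props(1)[OF ME xE])
    ultimately show "y \<in> restrict (d j) (gE j n) ` annihilated I0 (component (E j) (gE j) n)"
      using annihilated_hom_component[OF R E I0 x(1), of n] by (auto simp: annihilated_def)
  qed
  then show ?thesis by (simp add: annihilated_boundaries_def Suc)
qed

lemma submodule_restrict_scalars:
  assumes "submodule T R V" "S \<subseteq> carrier R" shows "submodule T (R\<lparr>carrier := S\<rparr>) V"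
  using assms by (auto simp: submodule_def submodule_axioms_def)

text \<open>The isomorphism sends the class of a cocycle f of degree \<open>n\<close> to the class
  of the homomorphism from R_0/I_0 with value \<phi>(f(1)) at the generator, where \<phi> is the
  part in cohomological degree \<open>i\<close> of a comparison map from E_n to \<open>J\<close>.
  All cocycles and boundaries are expressed through values at generators, where
  \<open>annihilated_cohomology_comparison\<close> applies.\<close>

theorem lemma2p3:
  fixes R :: "'a ring" and gR :: "nat \<Rightarrow> 'a set"
    and M :: "('a, 'm) module" and gM :: "int \<Rightarrow> 'm set"
    and n :: int and i :: nat and I0 :: "'a set"
    and E :: "nat \<Rightarrow> ('a, 'e) module" and gE :: "nat \<Rightarrow> int \<Rightarrow> 'e set"
    and d :: "nat \<Rightarrow> 'e \<Rightarrow> 'e" and \<epsilon> :: "'m \<Rightarrow> 'e"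
    and J :: "nat \<Rightarrow> ('a, 'j) module" and \<delta> :: "nat \<Rightarrow> 'j \<Rightarrow> 'j" and \<eta> :: "'m \<Rightarrow> 'j"
  assumes "standard_graded_ring R gR"
    and "noetherian_ring R"
    and "flat_module (deg0_ring R gR) (reg_mod R)"
    and "graded_module R gR M gM"
    and "ideal I0 (deg0_ring R gR)"
    and "star_injective_resolution R gR M gM \<epsilon> E gE d"
    and "injective_resolution (deg0_ring R gR) (component M gM n) \<eta> J \<delta>"
  shows "let N = quot_mod (reg_mod R) (Idl\<^bsub>R\<^esub> I0);
             gN = quot_grading (reg_mod R) (Idl\<^bsub>R\<^esub> I0) (reg_grading R gR);
             N0 = quot_mod (reg_mod (deg0_ring R gR)) I0
         in mod_iso (deg0_ring R gR)
              (component (star_Ext_mod R N gN E gE d i) (star_Ext_grading R N gN E gE d i) n)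
              (Ext_mod (deg0_ring R gR) N0 J \<delta> i)"
proof -
  let ?A = "deg0_ring R gR" and ?K = "Idl\<^bsub>R\<^esub> I0"
  let ?N = "quot_mod (reg_mod R) ?K" and ?gN = "quot_grading (reg_mod R) ?K (reg_grading R gR)"
  let ?NA = "quot_mod (reg_mod ?A) I0"
  have R: "graded_ring R gR" using assms(1) by (simp add: standard_graded_ring_def)
  interpret R: cring R using R by (simp add: graded_ring_def)
  have A: "cring ?A" "gR 0 \<subseteq> carrier R" using deg0_ring_cring[OF R] by auto
  interpret I0: ideal I0 ?A by fact
  have I0: "I0 \<subseteq> gR 0" using I0.a_subset by simp
  then have I0R: "I0 \<subseteq> carrier R" and I0A: "I0 \<subseteq> carrier ?A" using A(2) by auto
  have K: "ideal ?K R" by (rule R.genideal_ideal[OF I0R])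
  note RK = R.cring_axioms K and AI = A(1) assms(5)

  have res: "coresolution R M \<epsilon> E d" and star: "star_injective_module R gR (E k) (gE k)"
    and \<epsilon>: "\<epsilon> \<in> ghom R M gM (E 0) (gE 0) 0"
    and d: "d k \<in> ghom R (E k) (gE k) (E (Suc k)) (gE (Suc k)) 0" for k
    using assms(6) by (auto simp: star_injective_resolution_def)
  have gE: "graded_module R gR (E k) (gE k)" for k using star by (simp add: star_injective_module_def)
  have dm: "d k \<in> mhom R (E k) (E (Suc k))" for k using d by (simp add: ghom_def)
  have mE: "module R (E k)" for k using gE by (simp add: graded_module_def)
  have mEA: "module ?A (E k)" for k by (rule module_restrict_scalars[OF mE A])
  have resJ: "coresolution ?A (component M gM n) \<eta> J \<delta>" and injJ: "injective_module ?A (J k)" for k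
    using assms(7) by (auto simp: injective_resolution_def)
  have mJ: "module ?A (J k)" and \<delta>m: "\<delta> k \<in> mhom ?A (J k) (J (Suc k))" for k
    using coresolution_module[OF resJ] coresolution_diff[OF resJ] by auto
  have ME: "abelian_group (E k)" "direct_sum_dec (E k) (gE k)" for k
    using gE[of k] by (auto simp: graded_module_def module_def)

  let ?E = "\<lambda>k. component (E k) (gE k) n" and ?d = "\<lambda>k. restrict (d k) (gE k n)"
  have resE: "coresolution ?A (component M gM n) (restrict \<epsilon> (gM n)) ?E ?d"
    by (rule component_coresolution[OF R assms(4) res gE \<epsilon> d])
  obtain \<phi> where \<phi>: "\<phi> \<in> mhom ?A (?E i) (J i)"
    and \<phi>_cocycle: "\<And>x. x \<in> annihilated I0 (?E i) \<Longrightarrow> ?d i x = \<zero>\<^bsub>?E (Suc i)\<^esub> \<Longrightarrow> \<delta> i (\<phi> x) = \<zero>\<^bsub>J (Suc i)\<^esub>"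
    and \<phi>_inj: "\<And>x. x \<in> annihilated I0 (?E i) \<Longrightarrow> ?d i x = \<zero>\<^bsub>?E (Suc i)\<^esub> \<Longrightarrow>
      \<phi> x \<in> annihilated_boundaries I0 J \<delta> i \<longleftrightarrow> x \<in> annihilated_boundaries I0 ?E ?d i"
    and \<phi>_surj: "\<And>y. y \<in> annihilated I0 (J i) \<Longrightarrow> \<delta> i y = \<zero>\<^bsub>J (Suc i)\<^esub> \<Longrightarrow>
      \<exists>x\<in>annihilated I0 (?E i). ?d i x = \<zero>\<^bsub>?E (Suc i)\<^esub> \<and> \<phi> x \<ominus>\<^bsub>J i\<^esub> y \<in> annihilated_boundaries I0 J \<delta> i"
    by (rule annihilated_cohomology_comparison[OF component_module[OF R assms(4)] resE resJ
          star_injective_component_baer[OF R assms(3) star] injective_imp_baer[OF A(1) injJ] I0A, where i = i])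
      (rule that, assumption+)

  let ?V = "hom_mod R ?N (E i)" and ?V' = "hom_mod ?A ?NA (J i)"
  let ?u = "unit_coset R ?K" and ?uA = "unit_coset ?A I0"
  note u = unit_coset_carrier[OF RK] and u0 = unit_coset_carrier[OF AI]
  \<comment> \<open>\<open>Z\<close> and \<open>B\<close> are the cocycles and boundaries of the
    whole Hom complex over R, in all internal degrees; \<open>W\<close> singles out the cocycles of
    degree \<open>n\<close>. Their primed counterparts belong to the complex over R_0.\<close>
  define Z where "Z = {f \<in> mhom R ?N (E i). f ?u \<in> a_kernel (E i) (E (Suc i)) (d i)}"
  define B where "B = {f \<in> mhom R ?N (E i). f ?u \<in> annihilated_boundaries I0 E d i}"
  define W where "W = {f \<in> mhom R ?N (E i). f ?u \<in> a_kernel (?E i) (?E (Suc i)) (?d i)}"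
  define Z' where "Z' = {f \<in> mhom ?A ?NA (J i). f ?uA \<in> a_kernel (J i) (J (Suc i)) (\<delta> i)}"
  define B' where "B' = {f \<in> mhom ?A ?NA (J i). f ?uA \<in> annihilated_boundaries I0 J \<delta> i}"
  \<comment> \<open>Evaluation at the generator, then the comparison map, then the homomorphism over
    R_0 with that value.\<close>
  define \<Phi> where "\<Phi> f = cyclic_hom ?A I0 (J i) (\<phi> (f ?u))" for f

  \<comment> \<open>The module of R-homomorphisms with scalars restricted to R_0, so that both sides
    are modules over the same ring.\<close>
  have mV: "module ?A ?V"
    by (rule module_restrict_scalars[OF cyclic_hom_mod_module[OF RK mE] A])
  have mV': "module ?A ?V'" by (rule cyclic_hom_mod_module[OF AI mJ])
  interpret V: module ?A ?V by fact
  interpret V': module ?A ?V' by fact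
  have carV: "carrier ?V = mhom R ?N (E i)" and carV': "carrier ?V' = mhom ?A ?NA (J i)"
    by (simp_all add: hom_mod_def)
  have ker_n: "x \<in> a_kernel (?E i) (?E (Suc i)) (?d i) \<longleftrightarrow> x \<in> gE i n \<and> d i x = \<zero>\<^bsub>E (Suc i)\<^esub>" for x
    by (auto simp: mem_a_kernel)
  have gEc: "x \<in> carrier (E i)" if "x \<in> gE i n" for x using hom_part_carrier[OF ME that] .

  have subB: "submodule B ?A ?V"
    unfolding B_def
    by (rule hom_mod_eval_submodule[OF mV mEA submodule_restrict_scalars[OF annihilated_boundaries_submodule[where E = E and d = d, OF mE dm I0R] A(2)] u])
  have subW: "submodule W ?A ?V"
    unfolding W_def
  proof (rule hom_mod_eval_submodule[OF mV mEA _ u])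
    have k: "submodule (a_kernel (?E i) (?E (Suc i)) (?d i)) ?A (?E i)"
      by (rule a_kernel_submodule[OF coresolution_module[OF resE] coresolution_module[OF resE] coresolution_diff[OF resE]])
    \<comment> \<open>The kernel is a submodule of the component; since the component has the
      operations of the full module, it is also a submodule of the latter over R_0.\<close>
    have "module ?A ((?E i)\<lparr>carrier := a_kernel (?E i) (?E (Suc i)) (?d i)\<rparr>)"
      by (rule submodule.submodule_is_module[OF k coresolution_module[OF resE]])
    then show "submodule (a_kernel (?E i) (?E (Suc i)) (?d i)) ?A (E i)"
      by (intro module.module_incl_imp_submodule[OF mEA]) (auto simp: ker_n gEc)
  qed
  have subB': "submodule B' ?A ?V'"
    unfolding B'_def
    by (rule hom_mod_eval_submodule[OF mV' mJ annihilated_boundaries_submodule[where E = J and d = \<delta>, OF mJ \<delta>m I0A] u0])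
  have subZ': "submodule Z' ?A ?V'"
    unfolding Z'_def
    by (rule hom_mod_eval_submodule[OF mV' mJ a_kernel_submodule[OF mJ mJ \<delta>m] u0])

  have W_props: "f \<in> mhom R ?N (E i)" "f ?u \<in> annihilated I0 (?E i)" "?d i (f ?u) = \<zero>\<^bsub>?E (Suc i)\<^esub>"
      "f ?u \<in> gE i n" if "f \<in> W" for f
  proof -
    show f: "f \<in> mhom R ?N (E i)" using that by (simp add: W_def)
    show g: "f ?u \<in> gE i n" using that by (simp add: W_def ker_n)
    show "?d i (f ?u) = \<zero>\<^bsub>?E (Suc i)\<^esub>" using that g by (simp add: W_def ker_n)
    show "f ?u \<in> annihilated I0 (?E i)"
      using mhom_cyclic_annihilated[OF RK mE f, unfolded annihilated_genideal[OF mE I0R]] g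
      by (simp add: annihilated_def)
  qed
  have \<phi>_ann: "\<phi> (f ?u) \<in> annihilated I0 (J i)" if "f \<in> W" for f
    by (rule mhom_annihilated[OF coresolution_module[OF resE] mJ \<phi> I0A W_props(2)[OF that]])
  have \<Phi>m: "\<Phi> f \<in> mhom ?A ?NA (J i)" and \<Phi>1: "\<Phi> f ?uA = \<phi> (f ?u)" if "f \<in> W" for f
    unfolding \<Phi>_def using cyclic_hom_mhom[OF AI mJ \<phi>_ann[OF that]] cyclic_hom_unit[OF AI mJ \<phi>_ann[OF that]] by auto
  have Wadd: "f \<oplus>\<^bsub>?V\<^esub> g \<in> W" if "f \<in> W" "g \<in> W" for f g
    using V.submoduleE(5)[OF subW that] .
  have Wsmult: "a \<odot>\<^bsub>?V\<^esub> f \<in> W" if "a \<in> carrier ?A" "f \<in> W" for a f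
    using V.submoduleE(4)[OF subW that] .

  have "mod_iso ?A ((quot_mod (?V\<lparr>carrier := Z\<rparr>) B)\<lparr>carrier := (\<lambda>w. B +>\<^bsub>?V\<^esub> w) ` W\<rparr>)
      (quot_mod (?V'\<lparr>carrier := Z'\<rparr>) B')"
  proof (rule quot_mod_iso[OF mV subB subW mV' subB' subZ'])
    show "W \<subseteq> Z" using W_props(1) by (auto simp: W_def Z_def ker_n mem_a_kernel gEc)
  next
    fix f assume f: "f \<in> W"
    show "\<Phi> f \<in> Z'"
      using \<Phi>m[OF f] \<Phi>1[OF f] \<phi>_cocycle[OF W_props(2,3)[OF f]] \<phi>_ann[OF f]
      by (simp add: Z'_def mem_a_kernel annihilated_def)
    \<comment> \<open>\<open>B\<close> is formed with boundaries of elements of arbitrary degree,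
      whereas the comparison concerns E_n; for a value of degree \<open>n\<close> the two notions
      agree.\<close>
    have "f \<in> B \<longleftrightarrow> f ?u \<in> annihilated_boundaries I0 ?E ?d i"
      using component_annihilated_boundaries_iff[OF R gE I0 d W_props(4)[OF f]] W_props(1)[OF f]
      by (simp add: B_def)
    then show "\<Phi> f \<in> B' \<longleftrightarrow> f \<in> B"
      using \<Phi>m[OF f] \<Phi>1[OF f] \<phi>_inj[OF W_props(2,3)[OF f]] by (simp add: B'_def)
  next
    fix f g assume f: "f \<in> W" and g: "g \<in> W"
    show "\<Phi> (f \<oplus>\<^bsub>?V\<^esub> g) = \<Phi> f \<oplus>\<^bsub>?V'\<^esub> \<Phi> g"
    proof (rule mhom_cyclic_eqI[OF AI \<Phi>m[OF Wadd[OF f g]]])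
      show "\<Phi> f \<oplus>\<^bsub>?V'\<^esub> \<Phi> g \<in> mhom ?A ?NA (J i)"
        using V'.a_closed[of "\<Phi> f" "\<Phi> g"] \<Phi>m[OF f] \<Phi>m[OF g] by (simp add: carV')
      have "\<phi> (f ?u \<oplus>\<^bsub>E i\<^esub> g ?u) = \<phi> (f ?u) \<oplus>\<^bsub>J i\<^esub> \<phi> (g ?u)"
        using mhom_add[OF \<phi>, of "f ?u" "g ?u"] W_props(4)[OF f] W_props(4)[OF g] by simp
      then show "\<Phi> (f \<oplus>\<^bsub>?V\<^esub> g) ?uA = (\<Phi> f \<oplus>\<^bsub>?V'\<^esub> \<Phi> g) ?uA"
        by (simp only: \<Phi>1[OF Wadd[OF f g]] hom_mod_eval[OF u] hom_mod_eval[OF u0] \<Phi>1[OF f] \<Phi>1[OF g])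
    qed
  next
    fix a f assume a: "a \<in> carrier ?A" and f: "f \<in> W"
    show "\<Phi> (a \<odot>\<^bsub>?V\<^esub> f) = a \<odot>\<^bsub>?V'\<^esub> \<Phi> f"
    proof (rule mhom_cyclic_eqI[OF AI \<Phi>m[OF Wsmult[OF a f]]])
      show "a \<odot>\<^bsub>?V'\<^esub> \<Phi> f \<in> mhom ?A ?NA (J i)"
        using V'.smult_closed[OF a, of "\<Phi> f"] \<Phi>m[OF f] by (simp add: carV')
      have "\<phi> (a \<odot>\<^bsub>E i\<^esub> f ?u) = a \<odot>\<^bsub>J i\<^esub> \<phi> (f ?u)"
        using mhom_smult[OF \<phi> a, of "f ?u"] W_props(4)[OF f] by simp
      then show "\<Phi> (a \<odot>\<^bsub>?V\<^esub> f) ?uA = (a \<odot>\<^bsub>?V'\<^esub> \<Phi> f) ?uA"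
        by (simp only: \<Phi>1[OF Wsmult[OF a f]] hom_mod_eval[OF u] hom_mod_eval[OF u0] \<Phi>1[OF f])
    qed
  next
    fix z assume z: "z \<in> Z'"
    then have zm: "z \<in> mhom ?A ?NA (J i)" and z0: "\<delta> i (z ?uA) = \<zero>\<^bsub>J (Suc i)\<^esub>"
      by (auto simp: Z'_def mem_a_kernel)
    obtain x where x: "x \<in> annihilated I0 (?E i)" "?d i x = \<zero>\<^bsub>?E (Suc i)\<^esub>"
      "\<phi> x \<ominus>\<^bsub>J i\<^esub> z ?uA \<in> annihilated_boundaries I0 J \<delta> i"
      using \<phi>_surj[OF mhom_cyclic_annihilated[OF AI mJ zm] z0] by blast
    have xg: "x \<in> gE i n" using x(1) by (simp add: annihilated_def)
    have xK: "x \<in> annihilated ?K (E i)"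
      unfolding annihilated_genideal[OF mE I0R] using x(1) gEc by (simp add: annihilated_def)
    \<comment> \<open>A degree \<open>n\<close> cocycle annihilated by I_0 is annihilated by I_0R
      too, hence is the value of an R-homomorphism at the generator.\<close>
    define w where "w = cyclic_hom R ?K (E i) x"
    have wm: "w \<in> mhom R ?N (E i)" and w1: "w ?u = x"
      unfolding w_def using cyclic_hom_mhom[OF RK mE xK] cyclic_hom_unit[OF RK mE xK] by auto
    have wW: "w \<in> W" using wm w1 xg x(2) by (simp add: W_def ker_n)
    have "(\<Phi> w \<ominus>\<^bsub>?V'\<^esub> z) ?uA = \<phi> x \<ominus>\<^bsub>J i\<^esub> z ?uA"
      using hom_mod_eval_minus[OF mV' mJ u0 \<Phi>m[OF wW] zm] \<Phi>1[OF wW] w1 by simp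
    moreover have "\<Phi> w \<ominus>\<^bsub>?V'\<^esub> z \<in> mhom ?A ?NA (J i)"
      using V'.minus_closed[of "\<Phi> w" z] \<Phi>m[OF wW] zm by (simp add: carV')
    ultimately show "\<exists>w\<in>W. \<Phi> w \<ominus>\<^bsub>?V'\<^esub> z \<in> B'"
      using wW x(3) by (auto simp: B'_def)
  qed
  moreover have "Ext_mod ?A ?NA J \<delta> i = quot_mod (?V'\<lparr>carrier := Z'\<rparr>) B'"
    unfolding Ext_mod_def cohomology_def cyclic_cocycles[where E = J and d = \<delta>, OF AI mJ \<delta>m] cyclic_coboundaries[where E = J and d = \<delta>, OF AI mJ \<delta>m]
      Z'_def B'_def ..
  moreover have "component (star_Ext_mod R ?N ?gN E gE d i) (star_Ext_grading R ?N ?gN E gE d i) n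
      = (quot_mod (?V\<lparr>carrier := Z\<rparr>) B)\<lparr>carrier := (\<lambda>w. B +>\<^bsub>?V\<^esub> w) ` W\<rparr>"
  proof -
    \<comment> \<open>Over R the coboundaries come out in terms of elements annihilated by the
      extended ideal; these are the elements annihilated by \<open>I0\<close>.\<close>
    have B_K: "annihilated_boundaries ?K E d i = annihilated_boundaries I0 E d i"
      by (simp add: annihilated_boundaries_def annihilated_genideal[OF mE I0R] split: nat.split)
    \<comment> \<open>The degree of a homomorphism is read off at the generator, so the cocycles of
      degree \<open>n\<close> are those whose value there is a cocycle of E_n.\<close>
    have ZW: "Z \<inter> ghom R ?N ?gN (E i) (gE i) n = W"
    proof (rule Set.set_eqI)
      fix f show "f \<in> Z \<inter> ghom R ?N ?gN (E i) (gE i) n \<longleftrightarrow> f \<in> W"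
      proof (cases "f \<in> mhom R ?N (E i)")
        case True
        then show ?thesis
          using ghom_cyclic_iff[OF R gE K True, of n] gEc by (auto simp: Z_def W_def ker_n mem_a_kernel)
      qed (simp add: Z_def W_def)
    qed
    show ?thesis
      unfolding star_Ext_mod_def star_Ext_grading_def cohomology_def quot_grading_def[of "_ i"] Let_def
        star_hom_mod_cyclic[OF R gE I0] cyclic_cocycles[where E = E and d = d, OF RK mE dm] cyclic_coboundaries[where E = E and d = d, OF RK mE dm]
        B_K Z_def[symmetric] B_def[symmetric] quot_grading_def ZW ..
  qed
  ultimately show ?thesis unfolding Let_def by simp
qed

end
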